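(* Using the definition that accumulates $\mathcal{D}(nat)$, $\mathcal{D}_{list}(atm)$, $\mathcal{D}(intuit)$, $\mathcal{D}(lambda)$ and the clause $X\equiv X\triangleq\top$ (for $\equiv\,: i\to i\to o$), the following formulas are derivable in $FO\lambda^{\Delta\mathbb{N}}$ ($\supset$ associating to the right): Determinacy: $\forall m\forall m_1\forall m_2(\vdash\langle m\Downarrow m_1\rangle\supset\ \vdash\langle m\Downarrow m_2\rangle\supset m_1\equiv m_2)$; $\forall m\forall m_1\forall m_2(\vdash\langle m\leadsto m_1\rangle\supset\ \vdash\langle m\leadsto m_2\rangle\supset m_1\equiv m_2)$; $\forall m\forall r_1\forall r_2(\vdash\langle m\leadsto^*(abs\,r_1)\rangle\supset\ \vdash\langle m\leadsto^*(abs\,r_2)\rangle\supset(abs\,r_1)\equiv(abs\,r_2))$. Equivalence: $\forall m\forall r(\vdash\langle m\Downarrow(abs\,r)\rangle\supset\ \vdash\langle m\leadsto^*(abs\,r)\rangle)$; $\forall m\forall r(\vdash\langle m\leadsto^*(abs\,r)\rangle\supset\ \vdash\langle m\Downarrow(abs\,r)\rangle)$. Subject reduction: for each $R\in\{\Downarrow,\leadsto,\leadsto^*\}$, $\forall m\forall n(\vdash\langle m\,R\,n\rangle\supset\forall t(\vdash\langle typeof\,m\,t\rangle\supset\ \vdash\langle typeof\,n\,t\rangle))$.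
   Context: $FO\lambda^{\Delta\mathbb{N}}$ is the following intuitionistic sequent calculus. Terms are simply typed $\lambda$-terms (up to $\alpha\beta\eta$-conversion) over a signature of typed constants; $o$ is the type of formulas, and quantifiers range only over types not containing $o$. Formulas are built from atomic formulas with $\bot,\top,\land,\lor,\supset,\forall,\exists$. There is a type $nt$ with constants $z:nt$, $s:nt\to nt$ and a predicate $nat: nt\to o$. Sequents are $\Gamma\longrightarrow B$, $\Gamma$ a finite multiset. Rules: $\bot,\Gamma\longrightarrow B$ and $\Gamma\longrightarrow\top$ are axioms; the usual intuitionistic left and right rules for $\land,\lor,\supset,\forall,\exists$ (with the usual eigenvariable conditions); initial sequents $A,\Gamma\longrightarrow A$ for atomic $A$; left contraction; cut. For $nat$: $\Gamma\longrightarrow nat\,z$; from $\Gamma\longrightarrow nat\,I$ infer $\Gamma\longrightarrow nat\,(s\,I)$; induction: for $B:nt\to o$ and eigenvariable $j$ not free in $B$, from $\longrightarrow B\,z$, $B\,j\longrightarrow B\,(s\,j)$, $B\,I,\Gamma\longrightarrow C$ infer $nat\,I,\Gamma\longrightarrow C$. Relative to a definition (set of clauses $\forall\bar x[p\,\bar t\triangleq B]$, free variables of $B$ occurring in $\bar t$, satisfying a level condition): right rule: from $\Gamma\longrightarrow B\theta$ infer $\Gamma\longrightarrow p\,\bar u$ when $p\,\bar u=(p\,\bar t)\theta$; left rule: infer $p\,\bar u,\Gamma\longrightarrow C$ from the premises $B\theta,\Gamma\theta\longrightarrow C\theta$ for every clause (renamed apart) and every $\theta$ in a complete set of unifiers of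 $p\,\bar u$ and $p\,\bar t$. A formula is derivable using a definition if $\longrightarrow F$ has a derivation. $\mathcal{D}(nat)$: predicates $=,<,\le: nt\to nt\to o$, $sum: nt\to nt\to nt\to o$; clauses $I=I\triangleq\top$; $sum\,z\,J\,J\triangleq nat\,J$; $sum\,(s\,I)\,J\,(s\,K)\triangleq sum\,I\,J\,K$; $z<(s\,J)\triangleq nat\,J$; $(s\,I)<(s\,J)\triangleq I<J$; $I\le I\triangleq\top$; $I\le J\triangleq I<J$. Object logic: types $i$, $atm$, $prp$, constants $\langle\cdot\rangle: atm\to prp$, $tt: prp$, $\&: prp\to prp\to prp$, $\Rightarrow: atm\to prp\to prp$, $\bigwedge: (i\to prp)\to prp$. $atmlst$ is the list type over $atm$ with $nil$ and infix $::$. $\mathcal{D}_{list}(atm)$ has clauses $length\,nil\,z\triangleq\top$; $length\,(X::L)\,(s\,I)\triangleq length\,L\,I$; $list\,L\triangleq\exists i(nat\,i\land length\,L\,i)$; $element\,X\,(X::L)\triangleq\top$; $element\,X\,(Y::L)\triangleq element\,X\,L$; $split\,nil\,nil\,nil\triangleq\top$; $split\,(X::L_1)\,(X::L_2)\,L_3\triangleq split\,L_1\,L_2\,L_3$; $split\,(X::L_1)\,L_2\,(X::L_3)\triangleq split\,L_1\,L_2\,L_3$; $permute\,nil\,nil\triangleq\top$; $permute\,(X::L_1)\,L_2\triangleq\exists l_{22}(split\,L_2\,(X::nil)\,l_{22}\land permute\,L_1\,l_{22})$. With $prog: atm\to prp\to o$ and $seq: nt\to atmlst\to prp\to o$ (first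 argument as subscript), $\mathcal{D}(intuit)$ is: $seq_I\,(A'::L)\,\langle A\rangle\triangleq element\,A\,(A'::L)$; $seq_I\,L\,tt\triangleq\top$; $seq_{(s I)}\,L\,(B\,\&\,C)\triangleq seq_I\,L\,B\land seq_I\,L\,C$; $seq_{(s I)}\,L\,(A\Rightarrow B)\triangleq seq_I\,(A::L)\,B$; $seq_{(s I)}\,L\,(\bigwedge B)\triangleq\forall x\,seq_I\,L\,(B\,x)$; $seq_{(s I)}\,L\,\langle A\rangle\triangleq\exists b(prog\,A\,b\land seq_I\,L\,b)$. $\vdash B$ abbreviates $\exists i(nat\,i\land seq_i\,nil\,B)$. Untyped $\lambda$-calculus: constants $abs:(i\to i)\to i$, $app: i\to i\to i$, $gnd: i$, $arr: i\to i\to i$, object predicates $typeof: i\to i\to atm$ and infix $\Downarrow,\leadsto,\leadsto^*: i\to i\to atm$. $\mathcal{D}(lambda)$ consists of the clauses $prog\,A\,G\triangleq\top$ for the following pairs $(A,G)$: $(typeof\,(abs\,R)\,(arr\,T\,U),\ \bigwedge n(typeof\,n\,T\Rightarrow\langle typeof\,(R\,n)\,U\rangle))$; $(typeof\,(app\,M\,N)\,T,\ \langle typeof\,M\,(arr\,U\,T)\rangle\,\&\,\langle typeof\,N\,U\rangle)$; $((abs\,R)\Downarrow(abs\,R),\ tt)$; $((app\,M\,N)\Downarrow V,\ \langle M\Downarrow(abs\,R)\rangle\,\&\,\langle(R\,N)\Downarrow V\rangle)$; $((app\,(abs\,R)\,M)\leadsto(R\,M),\ tt)$; $((app\,M\,N)\leadsto(app\,M'\,N),\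 \langle M\leadsto M'\rangle)$; $(M\leadsto^* M,\ tt)$; $(M\leadsto^* N,\ \langle M\leadsto M'\rangle\,\&\,\langle M'\leadsto^* N\rangle)$ (all variables universally quantified). *)

theory Defs
  imports "HOL-Library.Multiset"
begin

section \<open>Simply typed terms over the signature\<close>

datatype ty = To | Tnt | Ti | Tatm | Tprp | Tlst | Fun ty ty  (infixr "\<rightarrow>\<^sub>t" 65)

primrec o_free :: "ty \<Rightarrow> bool" where
  "o_free To = False"
| "o_free Tnt = True"
| "o_free Ti = True"
| "o_free Tatm = True"
| "o_free Tprp = True"
| "o_free Tlst = True"
| "o_free (T \<rightarrow>\<^sub>t U) = (o_free T \<and> o_free U)"

datatype pred =
    P_nat | P_eq | P_less | P_le | P_sum
  | P_length | P_list | P_element | P_split | P_permute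
  | P_prog | P_seq | P_equiv

datatype fsym =
    F_z | F_s
  | F_nil | F_cons
  | F_atom | F_tt | F_amp | F_imp | F_forall
  | F_abs | F_app | F_gnd | F_arr
  | F_typeof | F_eval | F_red | F_reds

datatype cst =
    C_bot | C_top | C_and | C_or | C_imp | C_all ty | C_ex ty
  | Pred pred | Fn fsym

primrec pred_type :: "pred \<Rightarrow> ty" where
  "pred_type P_nat = Tnt \<rightarrow>\<^sub>t To"
| "pred_type P_eq = Tnt \<rightarrow>\<^sub>t Tnt \<rightarrow>\<^sub>t To"
| "pred_type P_less = Tnt \<rightarrow>\<^sub>t Tnt \<rightarrow>\<^sub>t To"
| "pred_type P_le = Tnt \<rightarrow>\<^sub>t Tnt \<rightarrow>\<^sub>t To"
| "pred_type P_sum = Tnt \<rightarrow>\<^sub>t Tnt \<rightarrow>\<^sub>t Tnt \<rightarrow>\<^sub>t To"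
| "pred_type P_length = Tlst \<rightarrow>\<^sub>t Tnt \<rightarrow>\<^sub>t To"
| "pred_type P_list = Tlst \<rightarrow>\<^sub>t To"
| "pred_type P_element = Tatm \<rightarrow>\<^sub>t Tlst \<rightarrow>\<^sub>t To"
| "pred_type P_split = Tlst \<rightarrow>\<^sub>t Tlst \<rightarrow>\<^sub>t Tlst \<rightarrow>\<^sub>t To"
| "pred_type P_permute = Tlst \<rightarrow>\<^sub>t Tlst \<rightarrow>\<^sub>t To"
| "pred_type P_prog = Tatm \<rightarrow>\<^sub>t Tprp \<rightarrow>\<^sub>t To"
| "pred_type P_seq = Tnt \<rightarrow>\<^sub>t Tlst \<rightarrow>\<^sub>t Tprp \<rightarrow>\<^sub>t To"
| "pred_type P_equiv = Ti \<rightarrow>\<^sub>t Ti \<rightarrow>\<^sub>t To"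

primrec fsym_type :: "fsym \<Rightarrow> ty" where
  "fsym_type F_z = Tnt"
| "fsym_type F_s = Tnt \<rightarrow>\<^sub>t Tnt"
| "fsym_type F_nil = Tlst"
| "fsym_type F_cons = Tatm \<rightarrow>\<^sub>t Tlst \<rightarrow>\<^sub>t Tlst"
| "fsym_type F_atom = Tatm \<rightarrow>\<^sub>t Tprp"
| "fsym_type F_tt = Tprp"
| "fsym_type F_amp = Tprp \<rightarrow>\<^sub>t Tprp \<rightarrow>\<^sub>t Tprp"
| "fsym_type F_imp = Tatm \<rightarrow>\<^sub>t Tprp \<rightarrow>\<^sub>t Tprp"
| "fsym_type F_forall = (Ti \<rightarrow>\<^sub>t Tprp) \<rightarrow>\<^sub>t Tprp"
| "fsym_type F_abs = (Ti \<rightarrow>\<^sub>t Ti) \<rightarrow>\<^sub>t Ti"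
| "fsym_type F_app = Ti \<rightarrow>\<^sub>t Ti \<rightarrow>\<^sub>t Ti"
| "fsym_type F_gnd = Ti"
| "fsym_type F_arr = Ti \<rightarrow>\<^sub>t Ti \<rightarrow>\<^sub>t Ti"
| "fsym_type F_typeof = Ti \<rightarrow>\<^sub>t Ti \<rightarrow>\<^sub>t Tatm"
| "fsym_type F_eval = Ti \<rightarrow>\<^sub>t Ti \<rightarrow>\<^sub>t Tatm"
| "fsym_type F_red = Ti \<rightarrow>\<^sub>t Ti \<rightarrow>\<^sub>t Tatm"
| "fsym_type F_reds = Ti \<rightarrow>\<^sub>t Ti \<rightarrow>\<^sub>t Tatm"

primrec cst_type :: "cst \<Rightarrow> ty" where
  "cst_type C_bot = To"
| "cst_type C_top = To"
| "cst_type C_and = To \<rightarrow>\<^sub>t To \<rightarrow>\<^sub>t To"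
| "cst_type C_or = To \<rightarrow>\<^sub>t To \<rightarrow>\<^sub>t To"
| "cst_type C_imp = To \<rightarrow>\<^sub>t To \<rightarrow>\<^sub>t To"
| "cst_type (C_all T) = (T \<rightarrow>\<^sub>t To) \<rightarrow>\<^sub>t To"
| "cst_type (C_ex T) = (T \<rightarrow>\<^sub>t To) \<rightarrow>\<^sub>t To"
| "cst_type (Pred p) = pred_type p"
| "cst_type (Fn f) = fsym_type f"

primrec cst_ok :: "cst \<Rightarrow> bool" where
  "cst_ok C_bot = True"
| "cst_ok C_top = True"
| "cst_ok C_and = True"
| "cst_ok C_or = True"
| "cst_ok C_imp = True"
| "cst_ok (C_all T) = o_free T"
| "cst_ok (C_ex T) = o_free T"
| "cst_ok (Pred p) = True"
| "cst_ok (Fn f) = True"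

text \<open>
  Free variables are names tagged with their type; bound variables are de Bruijn indices, so that
  terms are identified up to \<open>\<alpha>\<close>-conversion.  Formulas are the terms of type \<open>To\<close>.
\<close>

type_synonym var = "nat \<times> ty"

datatype tm =
    Cst cst
  | Free var
  | Bnd nat
  | App tm tm  (infixl "\<cdot>" 100)
  | Lam tm

primrec fv :: "tm \<Rightarrow> var set" where
  "fv (Cst c) = {}"
| "fv (Free v) = {v}"
| "fv (Bnd i) = {}"
| "fv (t \<cdot> u) = fv t \<union> fv u"
| "fv (Lam t) = fv t"

primrec lift :: "tm \<Rightarrow> nat \<Rightarrow> tm" where
  "lift (Cst c) k = Cst c"
| "lift (Free v) k = Free v"
| "lift (Bnd i) k = (if i < k then Bnd i else Bnd (Suc i))"
| "lift (t \<cdot> u) k = lift t k \<cdot> lift u k"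
| "lift (Lam t) k = Lam (lift t (Suc k))"

primrec inst :: "tm \<Rightarrow> nat \<Rightarrow> tm \<Rightarrow> tm" where
  "inst (Cst c) k s = Cst c"
| "inst (Free v) k s = Free v"
| "inst (Bnd i) k s = (if i < k then Bnd i else if i = k then s else Bnd (i - 1))"
| "inst (t \<cdot> u) k s = inst t k s \<cdot> inst u k s"
| "inst (Lam t) k s = Lam (inst t (Suc k) (lift s 0))"

primrec bind :: "var \<Rightarrow> nat \<Rightarrow> tm \<Rightarrow> tm" where
  "bind v k (Cst c) = Cst c"
| "bind v k (Free w) = (if w = v then Bnd k else Free w)"
| "bind v k (Bnd i) = (if i < k then Bnd i else Bnd (Suc i))"
| "bind v k (t \<cdot> u) = bind v k t \<cdot> bind v k u"
| "bind v k (Lam t) = Lam (bind v (Suc k) t)"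

definition lam :: "var \<Rightarrow> tm \<Rightarrow> tm" where
  "lam v t = Lam (bind v 0 t)"

inductive has_type :: "ty list \<Rightarrow> tm \<Rightarrow> ty \<Rightarrow> bool" where
  ht_cst: "cst_ok c \<Longrightarrow> has_type \<Delta> (Cst c) (cst_type c)"
| ht_free: "o_free T \<Longrightarrow> has_type \<Delta> (Free (x, T)) T"
| ht_bnd: "i < length \<Delta> \<Longrightarrow> has_type \<Delta> (Bnd i) (\<Delta> ! i)"
| ht_app: "has_type \<Delta> t (T \<rightarrow>\<^sub>t U) \<Longrightarrow> has_type \<Delta> u T \<Longrightarrow> has_type \<Delta> (t \<cdot> u) U"
| ht_lam: "has_type (T # \<Delta>) t U \<Longrightarrow> has_type \<Delta> (Lam t) (T \<rightarrow>\<^sub>t U)"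

inductive conv :: "tm \<Rightarrow> tm \<Rightarrow> bool"  (infix "\<approx>" 50) where
  conv_beta: "Lam t \<cdot> u \<approx> inst t 0 u"
| conv_eta: "Lam (lift t 0 \<cdot> Bnd 0) \<approx> t"
| conv_app: "t \<approx> t' \<Longrightarrow> u \<approx> u' \<Longrightarrow> t \<cdot> u \<approx> t' \<cdot> u'"
| conv_lam: "t \<approx> t' \<Longrightarrow> Lam t \<approx> Lam t'"
| conv_refl: "t \<approx> t"
| conv_sym: "t \<approx> u \<Longrightarrow> u \<approx> t"
| conv_trans: "t \<approx> u \<Longrightarrow> u \<approx> w \<Longrightarrow> t \<approx> w"

type_synonym subst = "var \<Rightarrow> tm"

text \<open>
  The terms substituted for variables have no loose bound variables (see \<open>is_subst\<close>), so they
  need not be lifted below \<open>Lam\<close>.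
\<close>

primrec subst :: "subst \<Rightarrow> tm \<Rightarrow> tm" where
  "subst \<theta> (Cst c) = Cst c"
| "subst \<theta> (Free v) = \<theta> v"
| "subst \<theta> (Bnd i) = Bnd i"
| "subst \<theta> (t \<cdot> u) = subst \<theta> t \<cdot> subst \<theta> u"
| "subst \<theta> (Lam t) = Lam (subst \<theta> t)"

definition is_subst :: "subst \<Rightarrow> bool" where
  "is_subst \<theta> \<longleftrightarrow> (\<forall>x T. o_free T \<longrightarrow> has_type [] (\<theta> (x, T)) T)"

definition unifier :: "subst \<Rightarrow> tm \<Rightarrow> tm \<Rightarrow> bool" where
  "unifier \<theta> t u \<longleftrightarrow> is_subst \<theta> \<and> subst \<theta> t \<approx> subst \<theta> u"

text \<open>
  A set \<open>S\<close> of unifiers is complete if each unifier is an instance of some member of \<open>S\<close>, as far as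
  the variables in \<open>V\<close> are concerned.  Members of \<open>S\<close> may thus introduce variables, but only ones
  that are fresh for \<open>V\<close>, which must contain all the variables the members are applied to.
\<close>

definition complete_unifiers :: "var set \<Rightarrow> tm \<Rightarrow> tm \<Rightarrow> subst set \<Rightarrow> bool" where
  "complete_unifiers V t u S \<longleftrightarrow>
     (\<forall>\<theta>\<in>S. unifier \<theta> t u) \<and>
     (\<forall>\<sigma>. unifier \<sigma> t u \<longrightarrow>
        (\<exists>\<theta>\<in>S. \<exists>\<rho>. is_subst \<rho> \<and> (\<forall>v\<in>V. \<sigma> v \<approx> subst \<rho> (\<theta> v))))"

definition is_renaming :: "(var \<Rightarrow> var) \<Rightarrow> bool" where
  "is_renaming \<pi> \<longleftrightarrow> inj \<pi> \<and> (\<forall>v. snd (\<pi> v) = snd v)"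

definition rename :: "(var \<Rightarrow> var) \<Rightarrow> tm \<Rightarrow> tm" where
  "rename \<pi> t = subst (\<lambda>v. Free (\<pi> v)) t"


section \<open>Formulas\<close>

abbreviation bot_fm :: tm  ("\<^bold>\<bottom>") where "\<^bold>\<bottom> \<equiv> Cst C_bot"
abbreviation top_fm :: tm  ("\<^bold>\<top>") where "\<^bold>\<top> \<equiv> Cst C_top"
abbreviation and_fm :: "tm \<Rightarrow> tm \<Rightarrow> tm"  (infixr "\<^bold>\<and>" 64) where "A \<^bold>\<and> B \<equiv> Cst C_and \<cdot> A \<cdot> B"
abbreviation or_fm :: "tm \<Rightarrow> tm \<Rightarrow> tm"  (infixr "\<^bold>\<or>" 63) where "A \<^bold>\<or> B \<equiv> Cst C_or \<cdot> A \<cdot> B"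
abbreviation imp_fm :: "tm \<Rightarrow> tm \<Rightarrow> tm"  (infixr "\<^bold>\<supset>" 62) where "A \<^bold>\<supset> B \<equiv> Cst C_imp \<cdot> A \<cdot> B"

definition all_fm :: "var \<Rightarrow> tm \<Rightarrow> tm" where
  "all_fm v B = Cst (C_all (snd v)) \<cdot> lam v B"

definition ex_fm :: "var \<Rightarrow> tm \<Rightarrow> tm" where
  "ex_fm v B = Cst (C_ex (snd v)) \<cdot> lam v B"

definition patom :: "pred \<Rightarrow> tm list \<Rightarrow> tm" where
  "patom p us = foldl (\<cdot>) (Cst (Pred p)) us"

abbreviation zero_tm :: tm where "zero_tm \<equiv> Cst (Fn F_z)"
abbreviation suc_tm :: "tm \<Rightarrow> tm" where "suc_tm t \<equiv> Cst (Fn F_s) \<cdot> t"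
abbreviation nat_fm :: "tm \<Rightarrow> tm" where "nat_fm t \<equiv> patom P_nat [t]"


section \<open>The sequent calculus\<close>

text \<open>A clause \<open>(p, ts, B)\<close> is implicitly closed over its free variables.\<close>

type_synonym clause = "pred \<times> tm list \<times> tm"

definition fvs :: "tm multiset \<Rightarrow> var set" where
  "fvs \<Gamma> = (\<Union>B\<in>set_mset \<Gamma>. fv B)"

definition wf_seq :: "tm multiset \<Rightarrow> tm \<Rightarrow> bool" where
  "wf_seq \<Gamma> C \<longleftrightarrow> (\<forall>B\<in>#\<Gamma>. has_type [] B To) \<and> has_type [] C To"

text \<open>
  The rule \<open>d_conv\<close> identifies formulas up to \<open>\<beta>\<eta>\<close>-conversion.  In \<open>d_defL\<close> each clause for \<open>p\<close>
  may be renamed apart and each complete set of unifiers be chosen freely; the predicate \<open>nat\<close> is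
  excluded, as it is not given by clauses.
\<close>

inductive derives :: "clause set \<Rightarrow> tm multiset \<Rightarrow> tm \<Rightarrow> bool" for D :: "clause set" where
  d_conv:
    "derives D \<Gamma> C \<Longrightarrow> rel_mset (\<approx>) \<Gamma> \<Gamma>' \<Longrightarrow> C \<approx> C' \<Longrightarrow> wf_seq \<Gamma>' C' \<Longrightarrow> derives D \<Gamma>' C'"
| d_init:
    "wf_seq \<Gamma> (patom p us) \<Longrightarrow> derives D (add_mset (patom p us) \<Gamma>) (patom p us)"
| d_cut:
    "derives D \<Delta> B \<Longrightarrow> derives D (add_mset B \<Gamma>) C \<Longrightarrow> derives D (\<Delta> + \<Gamma>) C"
| d_contract:
    "derives D (add_mset B (add_mset B \<Gamma>)) C \<Longrightarrow> derives D (add_mset B \<Gamma>) C"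
| d_botL:
    "wf_seq \<Gamma> C \<Longrightarrow> derives D (add_mset \<^bold>\<bottom> \<Gamma>) C"
| d_topR:
    "wf_seq \<Gamma> \<^bold>\<top> \<Longrightarrow> derives D \<Gamma> \<^bold>\<top>"
| d_andL1:
    "derives D (add_mset A \<Gamma>) C \<Longrightarrow> has_type [] B To \<Longrightarrow> derives D (add_mset (A \<^bold>\<and> B) \<Gamma>) C"
| d_andL2:
    "derives D (add_mset B \<Gamma>) C \<Longrightarrow> has_type [] A To \<Longrightarrow> derives D (add_mset (A \<^bold>\<and> B) \<Gamma>) C"
| d_andR:
    "derives D \<Gamma> A \<Longrightarrow> derives D \<Gamma> B \<Longrightarrow> derives D \<Gamma> (A \<^bold>\<and> B)"
| d_orL:
    "derives D (add_mset A \<Gamma>) C \<Longrightarrow> derives D (add_mset B \<Gamma>) C \<Longrightarrow>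
     derives D (add_mset (A \<^bold>\<or> B) \<Gamma>) C"
| d_orR1:
    "derives D \<Gamma> A \<Longrightarrow> has_type [] B To \<Longrightarrow> derives D \<Gamma> (A \<^bold>\<or> B)"
| d_orR2:
    "derives D \<Gamma> B \<Longrightarrow> has_type [] A To \<Longrightarrow> derives D \<Gamma> (A \<^bold>\<or> B)"
| d_impL:
    "derives D \<Gamma> A \<Longrightarrow> derives D (add_mset B \<Gamma>) C \<Longrightarrow> derives D (add_mset (A \<^bold>\<supset> B) \<Gamma>) C"
| d_impR:
    "derives D (add_mset A \<Gamma>) B \<Longrightarrow> derives D \<Gamma> (A \<^bold>\<supset> B)"
| d_allL:
    "derives D (add_mset (P \<cdot> t) \<Gamma>) C \<Longrightarrow> o_free T \<Longrightarrow> has_type [] P (T \<rightarrow>\<^sub>t To) \<Longrightarrow> has_type [] t T \<Longrightarrow>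
     derives D (add_mset (Cst (C_all T) \<cdot> P) \<Gamma>) C"
| d_allR:
    "derives D \<Gamma> (P \<cdot> Free (x, T)) \<Longrightarrow> o_free T \<Longrightarrow> has_type [] P (T \<rightarrow>\<^sub>t To) \<Longrightarrow>
     (x, T) \<notin> fvs \<Gamma> \<union> fv P \<Longrightarrow>
     derives D \<Gamma> (Cst (C_all T) \<cdot> P)"
| d_exL:
    "derives D (add_mset (P \<cdot> Free (x, T)) \<Gamma>) C \<Longrightarrow> o_free T \<Longrightarrow> has_type [] P (T \<rightarrow>\<^sub>t To) \<Longrightarrow>
     (x, T) \<notin> fvs \<Gamma> \<union> fv P \<union> fv C \<Longrightarrow>
     derives D (add_mset (Cst (C_ex T) \<cdot> P) \<Gamma>) C"
| d_exR:
    "derives D \<Gamma> (P \<cdot> t) \<Longrightarrow> o_free T \<Longrightarrow> has_type [] P (T \<rightarrow>\<^sub>t To) \<Longrightarrow> has_type [] t T \<Longrightarrow>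
     derives D \<Gamma> (Cst (C_ex T) \<cdot> P)"
| d_natR_z:
    "wf_seq \<Gamma> (nat_fm zero_tm) \<Longrightarrow> derives D \<Gamma> (nat_fm zero_tm)"
| d_natR_s:
    "derives D \<Gamma> (nat_fm t) \<Longrightarrow> derives D \<Gamma> (nat_fm (suc_tm t))"
| d_natL:
    "derives D {#} (B \<cdot> zero_tm) \<Longrightarrow>
     derives D {# B \<cdot> Free (j, Tnt) #} (B \<cdot> suc_tm (Free (j, Tnt))) \<Longrightarrow>
     derives D (add_mset (B \<cdot> t) \<Gamma>) C \<Longrightarrow>
     has_type [] B (Tnt \<rightarrow>\<^sub>t To) \<Longrightarrow> has_type [] t Tnt \<Longrightarrow> (j, Tnt) \<notin> fv B \<Longrightarrow>
     derives D (add_mset (nat_fm t) \<Gamma>) C"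
| d_defR:
    "derives D \<Gamma> (subst \<theta> B) \<Longrightarrow> (p, ts, B) \<in> D \<Longrightarrow> is_subst \<theta> \<Longrightarrow>
     patom p us \<approx> subst \<theta> (patom p ts) \<Longrightarrow> wf_seq \<Gamma> (patom p us) \<Longrightarrow>
     derives D \<Gamma> (patom p us)"
| d_defL:
    "(\<And>ts B. (p, ts, B) \<in> D \<Longrightarrow>
        \<exists>\<pi> S. is_renaming \<pi> \<and>
          fv (rename \<pi> (patom p ts)) \<inter> (fv (patom p us) \<union> fvs \<Gamma> \<union> fv C) = {} \<and>
          complete_unifiers
            (fv (rename \<pi> (patom p ts)) \<union> fv (patom p us) \<union> fvs \<Gamma> \<union> fv C)
            (patom p us) (rename \<pi> (patom p ts)) S \<and>
          (\<forall>\<theta>\<in>S. derives D (add_mset (subst \<theta> (rename \<pi> B)) (image_mset (subst \<theta>) \<Gamma>)) (subst \<theta> C))) \<Longrightarrow>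
     p \<noteq> P_nat \<Longrightarrow> wf_seq (add_mset (patom p us) \<Gamma>) C \<Longrightarrow>
     derives D (add_mset (patom p us) \<Gamma>) C"

definition derivable :: "clause set \<Rightarrow> tm \<Rightarrow> bool" where
  "derivable D B \<longleftrightarrow> derives D {#} B"

text \<open>
  \<open>level_le lvl B n\<close> says that the level of the formula \<open>B\<close> is at most \<open>n\<close>, where the level of an
  atom is that of its predicate, the level of \<open>A \<^bold>\<supset> B\<close> is the maximum of that of \<open>B\<close> and the
  successor of that of \<open>A\<close>, and the other connectives take the maximum.
\<close>

inductive level_le :: "(pred \<Rightarrow> nat) \<Rightarrow> tm \<Rightarrow> nat \<Rightarrow> bool" for lvl :: "pred \<Rightarrow> nat" where
  "lvl p \<le> n \<Longrightarrow> level_le lvl (patom p us) n"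
| "level_le lvl \<^bold>\<bottom> n"
| "level_le lvl \<^bold>\<top> n"
| "level_le lvl A n \<Longrightarrow> level_le lvl B n \<Longrightarrow> level_le lvl (A \<^bold>\<and> B) n"
| "level_le lvl A n \<Longrightarrow> level_le lvl B n \<Longrightarrow> level_le lvl (A \<^bold>\<or> B) n"
| "level_le lvl A n \<Longrightarrow> level_le lvl B (Suc n) \<Longrightarrow> level_le lvl (A \<^bold>\<supset> B) (Suc n)"
| "level_le lvl B n \<Longrightarrow> level_le lvl (Cst (C_all T) \<cdot> Lam B) n"
| "level_le lvl B n \<Longrightarrow> level_le lvl (Cst (C_ex T) \<cdot> Lam B) n"

definition is_definition :: "clause set \<Rightarrow> bool" where
  "is_definition D \<longleftrightarrow> (\<exists>lvl. \<forall>(p, ts, B)\<in>D.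
     p \<noteq> P_nat \<and> has_type [] (patom p ts) To \<and> has_type [] B To \<and>
     fv B \<subseteq> fv (patom p ts) \<and> level_le lvl B (lvl p))"


section \<open>The definitions of the object-level notions\<close>

abbreviation nil_tm :: tm where "nil_tm \<equiv> Cst (Fn F_nil)"
abbreviation cons_tm :: "tm \<Rightarrow> tm \<Rightarrow> tm"  (infixr "\<^bold>#" 95) where
  "X \<^bold># L \<equiv> Cst (Fn F_cons) \<cdot> X \<cdot> L"
abbreviation atom_tm :: "tm \<Rightarrow> tm"  ("\<^bold>\<langle>_\<^bold>\<rangle>") where "\<^bold>\<langle>A\<^bold>\<rangle> \<equiv> Cst (Fn F_atom) \<cdot> A"
abbreviation tt_tm :: tm where "tt_tm \<equiv> Cst (Fn F_tt)"
abbreviation amp_tm :: "tm \<Rightarrow> tm \<Rightarrow> tm"  (infixr "\<^bold>&" 91) where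
  "B \<^bold>& C \<equiv> Cst (Fn F_amp) \<cdot> B \<cdot> C"
abbreviation oimp_tm :: "tm \<Rightarrow> tm \<Rightarrow> tm"  (infixr "\<^bold>\<Rightarrow>" 90) where
  "A \<^bold>\<Rightarrow> B \<equiv> Cst (Fn F_imp) \<cdot> A \<cdot> B"
abbreviation oall_tm :: "tm \<Rightarrow> tm"  ("\<^bold>\<And>") where "\<^bold>\<And> B \<equiv> Cst (Fn F_forall) \<cdot> B"

abbreviation abs_tm :: "tm \<Rightarrow> tm" where "abs_tm R \<equiv> Cst (Fn F_abs) \<cdot> R"
abbreviation app_tm :: "tm \<Rightarrow> tm \<Rightarrow> tm" where "app_tm M N \<equiv> Cst (Fn F_app) \<cdot> M \<cdot> N"
abbreviation arr_tm :: "tm \<Rightarrow> tm \<Rightarrow> tm" where "arr_tm T U \<equiv> Cst (Fn F_arr) \<cdot> T \<cdot> U"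
abbreviation typeof_tm :: "tm \<Rightarrow> tm \<Rightarrow> tm" where "typeof_tm M T \<equiv> Cst (Fn F_typeof) \<cdot> M \<cdot> T"
abbreviation eval_tm :: "tm \<Rightarrow> tm \<Rightarrow> tm"  (infix "\<^bold>\<Down>" 96) where
  "M \<^bold>\<Down> V \<equiv> Cst (Fn F_eval) \<cdot> M \<cdot> V"
abbreviation red_tm :: "tm \<Rightarrow> tm \<Rightarrow> tm"  (infix "\<^bold>\<leadsto>" 96) where
  "M \<^bold>\<leadsto> N \<equiv> Cst (Fn F_red) \<cdot> M \<cdot> N"
abbreviation reds_tm :: "tm \<Rightarrow> tm \<Rightarrow> tm"  (infix "\<^bold>\<leadsto>\<^sup>*" 96) where
  "M \<^bold>\<leadsto>\<^sup>* N \<equiv> Cst (Fn F_reds) \<cdot> M \<cdot> N"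

abbreviation seq_fm :: "tm \<Rightarrow> tm \<Rightarrow> tm \<Rightarrow> tm" where "seq_fm I L B \<equiv> patom P_seq [I, L, B]"
abbreviation prog_fm :: "tm \<Rightarrow> tm \<Rightarrow> tm" where "prog_fm A B \<equiv> patom P_prog [A, B]"
abbreviation equiv_fm :: "tm \<Rightarrow> tm \<Rightarrow> tm"  (infix "\<^bold>\<equiv>" 65) where "X \<^bold>\<equiv> Y \<equiv> patom P_equiv [X, Y]"

definition provable :: "tm \<Rightarrow> tm"  ("\<^bold>\<turnstile> _" [66] 66) where
  "\<^bold>\<turnstile> B = Cst (C_ex Tnt) \<cdot> Lam (nat_fm (Bnd 0) \<^bold>\<and> seq_fm (Bnd 0) nil_tm (lift B 0))"

definition D_nat :: "clause set" where
  "D_nat = (let I = Free (0, Tnt); J = Free (1, Tnt); K = Free (2, Tnt) in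
    {(P_eq, [I, I], \<^bold>\<top>),
     (P_sum, [zero_tm, J, J], nat_fm J),
     (P_sum, [suc_tm I, J, suc_tm K], patom P_sum [I, J, K]),
     (P_less, [zero_tm, suc_tm J], nat_fm J),
     (P_less, [suc_tm I, suc_tm J], patom P_less [I, J]),
     (P_le, [I, I], \<^bold>\<top>),
     (P_le, [I, J], patom P_less [I, J])})"

definition D_list :: "clause set" where
  "D_list = (let i = (0, Tnt); I = Free (0, Tnt); X = Free (0, Tatm); Y = Free (1, Tatm);
      L = Free (0, Tlst); L1 = Free (1, Tlst); L2 = Free (2, Tlst); L3 = Free (3, Tlst);
      l22 = (4, Tlst) in
    {(P_length, [nil_tm, zero_tm], \<^bold>\<top>),
     (P_length, [X \<^bold># L, suc_tm I], patom P_length [L, I]),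
     (P_list, [L], ex_fm i (nat_fm (Free i) \<^bold>\<and> patom P_length [L, Free i])),
     (P_element, [X, X \<^bold># L], \<^bold>\<top>),
     (P_element, [X, Y \<^bold># L], patom P_element [X, L]),
     (P_split, [nil_tm, nil_tm, nil_tm], \<^bold>\<top>),
     (P_split, [X \<^bold># L1, X \<^bold># L2, L3], patom P_split [L1, L2, L3]),
     (P_split, [X \<^bold># L1, L2, X \<^bold># L3], patom P_split [L1, L2, L3]),
     (P_permute, [nil_tm, nil_tm], \<^bold>\<top>),
     (P_permute, [X \<^bold># L1, L2],
        ex_fm l22 (patom P_split [L2, X \<^bold># nil_tm, Free l22] \<^bold>\<and> patom P_permute [L1, Free l22]))})"

definition D_intuit :: "clause set" where
  "D_intuit = (let I = Free (0, Tnt); L = Free (0, Tlst); A = Free (0, Tatm); A' = Free (1, Tatm);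
      B = Free (0, Tprp); C = Free (1, Tprp); b = (2, Tprp); x = (0, Ti);
      F = Free (0, Ti \<rightarrow>\<^sub>t Tprp) in
    {(P_seq, [I, A' \<^bold># L, \<^bold>\<langle>A\<^bold>\<rangle>], patom P_element [A, A' \<^bold># L]),
     (P_seq, [I, L, tt_tm], \<^bold>\<top>),
     (P_seq, [suc_tm I, L, B \<^bold>& C], seq_fm I L B \<^bold>\<and> seq_fm I L C),
     (P_seq, [suc_tm I, L, A \<^bold>\<Rightarrow> B], seq_fm I (A \<^bold># L) B),
     (P_seq, [suc_tm I, L, \<^bold>\<And> F], all_fm x (seq_fm I L (F \<cdot> Free x))),
     (P_seq, [suc_tm I, L, \<^bold>\<langle>A\<^bold>\<rangle>], ex_fm b (prog_fm A (Free b) \<^bold>\<and> seq_fm I L (Free b)))})"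

definition D_lambda :: "clause set" where
  "D_lambda = (let M = Free (0, Ti); N = Free (1, Ti); M' = Free (2, Ti); T = Free (3, Ti);
      U = Free (4, Ti); V = Free (5, Ti); R = Free (0, Ti \<rightarrow>\<^sub>t Ti); n = (6, Ti) in
    (\<lambda>(A, G). (P_prog, [A, G], \<^bold>\<top>)) `
    {(typeof_tm (abs_tm R) (arr_tm T U),
        \<^bold>\<And> (lam n (typeof_tm (Free n) T \<^bold>\<Rightarrow> \<^bold>\<langle>typeof_tm (R \<cdot> Free n) U\<^bold>\<rangle>))),
     (typeof_tm (app_tm M N) T, \<^bold>\<langle>typeof_tm M (arr_tm U T)\<^bold>\<rangle> \<^bold>& \<^bold>\<langle>typeof_tm N U\<^bold>\<rangle>),
     (abs_tm R \<^bold>\<Down> abs_tm R, tt_tm),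
     (app_tm M N \<^bold>\<Down> V, \<^bold>\<langle>M \<^bold>\<Down> abs_tm R\<^bold>\<rangle> \<^bold>& \<^bold>\<langle>(R \<cdot> N) \<^bold>\<Down> V\<^bold>\<rangle>),
     (app_tm (abs_tm R) M \<^bold>\<leadsto> (R \<cdot> M), tt_tm),
     (app_tm M N \<^bold>\<leadsto> app_tm M' N, \<^bold>\<langle>M \<^bold>\<leadsto> M'\<^bold>\<rangle>),
     (M \<^bold>\<leadsto>\<^sup>* M, tt_tm),
     (M \<^bold>\<leadsto>\<^sup>* N, \<^bold>\<langle>M \<^bold>\<leadsto> M'\<^bold>\<rangle> \<^bold>& \<^bold>\<langle>M' \<^bold>\<leadsto>\<^sup>* N\<^bold>\<rangle>)})"

definition D_equiv :: "clause set" where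
  "D_equiv = {(P_equiv, [Free (0, Ti), Free (0, Ti)], \<^bold>\<top>)}"

definition D_all :: "clause set" where
  "D_all = D_nat \<union> D_list \<union> D_intuit \<union> D_lambda \<union> D_equiv"


section \<open>Well-formedness\<close>

inductive_simps has_type_simps:
  "has_type \<Delta> (Cst c) T"
  "has_type \<Delta> (Free v) T"
  "has_type \<Delta> (Bnd i) T"
  "has_type \<Delta> (t \<cdot> u) T"
  "has_type \<Delta> (Lam t) T"

lemma derives_wf_seq: "derives D \<Gamma> C \<Longrightarrow> wf_seq \<Gamma> C"
proof (induction rule: derives.induct)
  case (d_natR_s \<Gamma> t)
  then show ?case by (auto simp: wf_seq_def patom_def has_type_simps)
next
  case (d_natL B j t \<Gamma> C)
  then show ?case by (auto simp: wf_seq_def patom_def has_type_simps)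
qed (auto simp: wf_seq_def has_type_simps)

lemma is_definition_D_all: "is_definition D_all"
proof -
  note defs = D_all_def D_nat_def D_list_def D_intuit_def D_lambda_def D_equiv_def Let_def
  have bp: "bind v k (patom q us) = patom q (map (bind v k) us)" for v k q us
    by (induction us rule: rev_induct) (auto simp: patom_def)
  have "p \<noteq> P_nat \<and> has_type [] (patom p ts) To \<and> has_type [] B To \<and>
     fv B \<subseteq> fv (patom p ts) \<and> level_le (\<lambda>_. 0) B 0" if c: "(p, ts, B) \<in> D_all" for p ts B
  proof (intro conjI)
    show "p \<noteq> P_nat" using c by (auto simp: defs)
    show "has_type [] (patom p ts) To" using c
      by (auto simp: defs patom_def has_type_simps lam_def)
    show "has_type [] B To" using c
      by (auto simp: defs patom_def has_type_simps lam_def ex_fm_def all_fm_def)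
    show "fv B \<subseteq> fv (patom p ts)" using c
      by (auto simp: defs patom_def lam_def ex_fm_def all_fm_def)
    show "level_le (\<lambda>_. 0) B 0" using c
      by (auto simp: defs lam_def ex_fm_def all_fm_def bp intro!: level_le.intros)
  qed
  then show ?thesis unfolding is_definition_def by (intro exI[of _ "\<lambda>_. 0"]) blast
qed

end

theory Submission
  imports Defs "HOL-Library.Confluence"
begin

text \<open>
  Derivations are never written down rule by rule.  \<open>\<Gamma> \<tturnstile>\<^bsub>D\<^esub> C\<close> says that \<open>C\<close> is derivable from some of
  the hypotheses in \<open>\<Gamma>\<close>; it satisfies Kripke-style clauses (for \<open>\<supset>\<close>: for every larger \<open>\<Gamma>'\<close>, and for
  quantifiers: for every typed term), so that object-level proofs become natural deduction in HOL
  over arbitrary typed terms, without eigenvariables.  Definition left rules are used with the set of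
  all unifiers, and the Church-Rosser theorem for \<open>\<beta>\<eta>\<close>-conversion decomposes the unified terms.

  Object-level cut is admissible with a bound on the height that is uniform in the formula, as the
  case of \<open>\<And>\<close> requires.  Induction on the height gives rule induction for \<open>\<Down>\<close>, \<open>\<leadsto>\<close> and \<open>\<leadsto>\<^sup>*\<close>, from
  which the theorem follows as on paper: subject reduction for a beta step is an instance of cut,
  evaluation is closed under expansion, which reduces determinacy of \<open>\<leadsto>\<^sup>*\<close> to that of \<open>\<Down>\<close>, and subject
  reduction for \<open>\<Down>\<close> is reduced to that for \<open>\<leadsto>\<^sup>*\<close>.
\<close>

section \<open>Confluence of beta-eta-conversion\<close>

lemma lift_lift: "i \<le> k \<Longrightarrow> lift (lift t i) (Suc k) = lift (lift t k) i"
  by (induction t arbitrary: i k) auto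

lemma inst_lift_le: "i \<le> j \<Longrightarrow> inst (lift t i) (Suc j) (lift s i) = lift (inst t j s) i"
  by (induction t arbitrary: i j s) (auto simp: lift_lift[of 0, symmetric])

lemma lift_inst: "j \<le> i \<Longrightarrow> lift (inst t j s) i = inst (lift t (Suc i)) j (lift s i)"
  by (induction t arbitrary: i j s) (auto simp: lift_lift)

lemma inst_lift [simp]: "inst (lift t k) k s = t"
  by (induction t arbitrary: k s) auto

lemma inst_inst: "i \<le> j \<Longrightarrow> inst (inst t (Suc j) (lift v i)) i (inst u j v) = inst (inst t i u) j v"
  by (induction t arbitrary: i j u v) (auto simp: lift_lift[symmetric] inst_lift_le[symmetric])

lemma size_lift [simp]: "size (lift t k) = size t"
  by (induction t arbitrary: k) auto

lemma lift_inject [simp]: "lift t k = lift u k \<longleftrightarrow> t = u"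
  by (metis inst_lift)

lemma inst_lift_Suc_Bnd [simp]: "inst (lift t (Suc k)) k (Bnd k) = t"
  by (induction t arbitrary: k) auto

lemma lift_eq_iff:
  "lift t k = Cst c \<longleftrightarrow> t = Cst c"
  "lift t k = Free v \<longleftrightarrow> t = Free v"
  "lift t k = Bnd i \<longleftrightarrow> (\<exists>j. t = Bnd j \<and> i = (if j < k then j else Suc j))"
  "lift t k = a \<cdot> b \<longleftrightarrow> (\<exists>a' b'. t = a' \<cdot> b' \<and> lift a' k = a \<and> lift b' k = b)"
  "lift t k = Lam a \<longleftrightarrow> (\<exists>a'. t = Lam a' \<and> lift a' (Suc k) = a)"
  by (cases t; auto)+

lemma lift_Suc_eq_lift:
  "lift t (Suc k) = lift u j \<Longrightarrow> j \<le> k \<Longrightarrow> \<exists>w. t = lift w j \<and> u = lift w k"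
proof (induction t arbitrary: u j k)
  case (Bnd i)
  then show ?case
    by (cases u; intro exI[of _ "if i < j then Bnd i else Bnd (i - 1)"]) (auto split: if_splits)
next
  case (App a b)
  then obtain u1 u2 where u: "u = u1 \<cdot> u2" "lift a (Suc k) = lift u1 j" "lift b (Suc k) = lift u2 j"
    by (cases u) (auto split: if_splits)
  with App.IH App.prems(2) obtain w1 w2
    where "a = lift w1 j" "u1 = lift w1 k" "b = lift w2 j" "u2 = lift w2 k" by metis
  with u show ?case by (intro exI[of _ "w1 \<cdot> w2"]) simp
next
  case (Lam a)
  then obtain u' where u: "u = Lam u'" "lift a (Suc (Suc k)) = lift u' (Suc j)"
    by (cases u) (auto split: if_splits)
  with Lam.IH[of "Suc k" u' "Suc j"] Lam.prems(2) obtain w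
    where "a = lift w (Suc j)" "u' = lift w (Suc k)" by auto
  with u show ?case by (intro exI[of _ "Lam w"]) simp
qed (auto dest!: sym[of _ "lift _ _"] simp: lift_eq_iff)

inductive par :: "tm \<Rightarrow> tm \<Rightarrow> bool" where
  par_cst: "par (Cst c) (Cst c)"
| par_free: "par (Free v) (Free v)"
| par_bnd: "par (Bnd i) (Bnd i)"
| par_app: "par t t' \<Longrightarrow> par u u' \<Longrightarrow> par (t \<cdot> u) (t' \<cdot> u')"
| par_lam: "par t t' \<Longrightarrow> par (Lam t) (Lam t')"
| par_beta: "par t t' \<Longrightarrow> par u u' \<Longrightarrow> par (Lam t \<cdot> u) (inst t' 0 u')"
| par_eta: "par t t' \<Longrightarrow> par (Lam (lift t 0 \<cdot> Bnd 0)) t'"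

inductive_cases par_cstE: "par (Cst c) s"
inductive_cases par_freeE: "par (Free v) s"
inductive_cases par_bndE: "par (Bnd i) s"
inductive_cases par_appE [consumes 1, case_names app beta]: "par (t \<cdot> u) s"
inductive_cases par_lamE [consumes 1, case_names lam eta]: "par (Lam t) s"

lemma par_refl: "par t t"
  by (induction t) (auto intro: par.intros)

lemma par_lift: "par t t' \<Longrightarrow> par (lift t k) (lift t' k)"
proof (induction arbitrary: k rule: par.induct)
  case (par_beta t t' u u')
  then show ?case by (auto simp: lift_inst intro: par.par_beta)
next
  case (par_eta t t')
  then show ?case using par.par_eta[of "lift t k"] by (simp add: lift_lift)
qed (auto intro: par.intros)

lemma par_inst: "par t t' \<Longrightarrow> par u u' \<Longrightarrow> par (inst t k u) (inst t' k u')"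
proof (induction arbitrary: k u u' rule: par.induct)
  case (par_lam t t')
  then show ?case using par_lam.IH[OF par_lift[OF par_lam.prems]] by (auto intro: par.par_lam)
next
  case (par_beta t t' v v')
  then show ?case
    using par.par_beta[OF par_beta.IH(1)[OF par_lift[OF par_beta.prems, of 0], of "Suc k"]
        par_beta.IH(2)[OF par_beta.prems, of k]]
    by (simp add: inst_inst)
next
  case (par_eta t t')
  then show ?case using par.par_eta[of "inst t k u"] by (simp add: inst_lift_le)
qed (auto intro: par.intros par_refl)

lemma par_lift_inv: "par (lift t k) s \<Longrightarrow> \<exists>t'. s = lift t' k \<and> par t t'"
proof (induction "lift t k" s arbitrary: t k rule: par.induct)
  case (par_app a a' b b')
  then obtain t1 t2 where t: "t = t1 \<cdot> t2" "a = lift t1 k" "b = lift t2 k"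
    by (metis lift_eq_iff(4))
  with par_app obtain t1' t2' where "a' = lift t1' k" "par t1 t1'" "b' = lift t2' k" "par t2 t2'"
    by metis
  with t show ?case by (intro exI[of _ "t1' \<cdot> t2'"]) (auto intro: par.par_app)
next
  case (par_lam a a')
  then obtain t1 where t: "t = Lam t1" "a = lift t1 (Suc k)" by (metis lift_eq_iff(5))
  with par_lam obtain t1' where "a' = lift t1' (Suc k)" "par t1 t1'" by metis
  with t show ?case by (intro exI[of _ "Lam t1'"]) (auto intro: par.par_lam)
next
  case (par_beta a a' b b')
  then obtain t1 t2 where t: "t = Lam t1 \<cdot> t2" "a = lift t1 (Suc k)" "b = lift t2 k"
    by (metis lift_eq_iff(4,5))
  with par_beta obtain t1' t2'
    where "a' = lift t1' (Suc k)" "par t1 t1'" "b' = lift t2' k" "par t2 t2'" by metis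
  with t show ?case by (intro exI[of _ "inst t1' 0 t2'"]) (auto simp: lift_inst intro: par.par_beta)
next
  case (par_eta a a')
  then obtain t1 where t: "t = Lam (t1 \<cdot> Bnd 0)" "lift t1 (Suc k) = lift a 0"
    using par_eta.hyps(3)[symmetric] by (auto simp: lift_eq_iff split: if_splits)
  from lift_Suc_eq_lift[OF this(2)] obtain w where w: "t1 = lift w 0" "a = lift w k" by auto
  with par_eta obtain w' where "a' = lift w' k" "par w w'" by metis
  with t w show ?case by (auto intro: par.par_eta)
qed (auto dest!: sym[of _ "lift _ _"] simp: lift_eq_iff intro: par.intros)

definition joinable :: "tm \<Rightarrow> tm \<Rightarrow> bool" where
  "joinable a b \<longleftrightarrow> (\<exists>w. par a w \<and> par b w)"

definition diamond_at :: "tm \<Rightarrow> bool" where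
  "diamond_at t \<longleftrightarrow> (\<forall>a b. par t a \<longrightarrow> par t b \<longrightarrow> joinable a b)"

lemma joinableI: "par a w \<Longrightarrow> par b w \<Longrightarrow> joinable a b"
  by (auto simp: joinable_def)

lemma joinable_sym: "joinable a b \<Longrightarrow> joinable b a"
  by (auto simp: joinable_def)

lemma diamond_atD:
  assumes "diamond_at t" "par t a" "par t b"
  obtains w where "par a w" "par b w"
  using assms by (auto simp: diamond_at_def joinable_def)

lemma joinable_app_beta:
  assumes "diamond_at q" "diamond_at u"
    and "par (Lam q) f" "par u u1" "par q q'" "par u u2"
  shows "joinable (f \<cdot> u1) (inst q' 0 u2)"
proof -
  from assms(2,4,6) obtain u3 where u3: "par u1 u3" "par u2 u3" by (rule diamond_atD)
  from assms(3) show ?thesis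
  proof (cases rule: par_lamE)
    case (lam q1)
    from assms(1) lam(2) assms(5) obtain w where "par q1 w" "par q' w" by (rule diamond_atD)
    with u3 lam(1) show ?thesis by (auto intro: joinableI par_beta par_inst)
  next
    case (eta s)
    then have "par q (lift f 0 \<cdot> Bnd 0)" by (auto intro: par_app par_lift par_refl)
    from assms(1) this assms(5) obtain w where w: "par (lift f 0 \<cdot> Bnd 0) w" "par q' w"
      by (rule diamond_atD)
    from par_inst[OF w(1) u3(1), of 0] have "par (f \<cdot> u1) (inst w 0 u3)" by simp
    with w(2) u3(2) show ?thesis by (auto intro: joinableI par_inst)
  qed
qed

lemma joinable_lam_eta:
  assumes "diamond_at s" "par (lift s 0 \<cdot> Bnd 0) t" "par s s'"
  shows "joinable (Lam t) s'"
  using assms(2)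
proof (cases rule: par_appE)
  case (app a b)
  then obtain s1 where s1: "a = lift s1 0" "par s s1" "b = Bnd 0"
    using par_lift_inv by (blast elim: par_bndE)
  from assms(1) s1(2) assms(3) obtain w where "par s1 w" "par s' w" by (rule diamond_atD)
  with app s1 show ?thesis by (auto intro: joinableI par_eta)
next
  case (beta q q' b)
  then obtain r where r: "s = Lam r" "q = lift r (Suc 0)"
    by (auto simp: lift_eq_iff)
  with beta obtain r' where r': "q' = lift r' (Suc 0)" "par r r'" using par_lift_inv by blast
  with beta have "t = r'" by (auto elim: par_bndE)
  moreover have "par s (Lam r')" using r r' by (auto intro: par_lam)
  ultimately show ?thesis using assms(1,3) by (auto simp: diamond_at_def)
qed

lemma diamond_at_app:
  assumes "diamond_at a" "diamond_at u" and body: "\<And>q. a = Lam q \<Longrightarrow> diamond_at q"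
  shows "diamond_at (a \<cdot> u)"
  unfolding diamond_at_def
proof (intro allI impI)
  fix x y assume "par (a \<cdot> u) x" "par (a \<cdot> u) y"
  then consider
      (app) a1 u1 a2 u2 where "x = a1 \<cdot> u1" "par a a1" "par u u1" "y = a2 \<cdot> u2" "par a a2" "par u u2"
    | (app_beta) f u1 q q' u2 where "a = Lam q" "x = f \<cdot> u1" "par (Lam q) f" "par u u1"
        "y = inst q' 0 u2" "par q q'" "par u u2"
    | (beta_app) f u1 q q' u2 where "a = Lam q" "y = f \<cdot> u1" "par (Lam q) f" "par u u1"
        "x = inst q' 0 u2" "par q q'" "par u u2"
    | (beta) q q1 u1 q2 u2 where "a = Lam q" "x = inst q1 0 u1" "par q q1" "par u u1"
        "y = inst q2 0 u2" "par q q2" "par u u2"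
    by (elim par_appE) auto
  then show "joinable x y"
  proof cases
    case app
    from assms(1) app(2,5) obtain v where "par a1 v" "par a2 v" by (rule diamond_atD)
    moreover from assms(2) app(3,6) obtain w where "par u1 w" "par u2 w" by (rule diamond_atD)
    ultimately show ?thesis using app by (auto intro: joinableI par_app)
  next
    case app_beta
    then show ?thesis using joinable_app_beta[OF body assms(2)] by blast
  next
    case beta_app
    then show ?thesis using joinable_app_beta[OF body assms(2)] joinable_sym by blast
  next
    case beta
    from body[OF beta(1)] beta(3,6) obtain v where "par q1 v" "par q2 v" by (rule diamond_atD)
    moreover from assms(2) beta(4,7) obtain w where "par u1 w" "par u2 w" by (rule diamond_atD)
    ultimately show ?thesis using beta by (auto intro: joinableI par_inst)
  qed
qed

lemma diamond_at_Lam: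
  assumes "diamond_at b" and eta_body: "\<And>s. b = lift s 0 \<cdot> Bnd 0 \<Longrightarrow> diamond_at s"
  shows "diamond_at (Lam b)"
  unfolding diamond_at_def
proof (intro allI impI)
  fix x y assume "par (Lam b) x" "par (Lam b) y"
  then consider
      (lam) b1 b2 where "x = Lam b1" "par b b1" "y = Lam b2" "par b b2"
    | (lam_eta) s t where "b = lift s 0 \<cdot> Bnd 0" "x = Lam t" "par b t" "par s y"
    | (eta_lam) s t where "b = lift s 0 \<cdot> Bnd 0" "y = Lam t" "par b t" "par s x"
    | (eta) s where "b = lift s 0 \<cdot> Bnd 0" "par s x" "par s y"
    by (elim par_lamE) auto
  then show "joinable x y"
  proof cases
    case lam
    from assms(1) lam(2,4) obtain w where "par b1 w" "par b2 w" by (rule diamond_atD)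
    then show ?thesis using lam by (auto intro: joinableI par_lam)
  next
    case lam_eta
    then show ?thesis using joinable_lam_eta[OF eta_body] by blast
  next
    case eta_lam
    then show ?thesis using joinable_lam_eta[OF eta_body] joinable_sym by blast
  next
    case eta
    then show ?thesis using eta_body by (auto simp: diamond_at_def)
  qed
qed

lemma diamond_at: "diamond_at t"
proof (induction "size t" arbitrary: t rule: less_induct)
  case less
  show ?case
  proof (cases t)
    case (App a u)
    then show ?thesis using less by (auto intro!: diamond_at_app)
  next
    case (Lam b)
    then show ?thesis using less by (auto intro!: diamond_at_Lam)
  qed (auto simp: diamond_at_def intro: joinableI par_refl elim: par_cstE par_freeE par_bndE)
qed

lemma confluentp_par: "confluentp par"
  using diamond_at
  by (intro strong_confluentp_imp_confluentp strong_confluentpI)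
    (meson diamond_atD r_into_rtranclp sup2I1)

lemma pars_app: "par\<^sup>*\<^sup>* t t' \<Longrightarrow> par\<^sup>*\<^sup>* u u' \<Longrightarrow> par\<^sup>*\<^sup>* (t \<cdot> u) (t' \<cdot> u')"
proof (induction rule: rtranclp_induct)
  case base
  then show ?case
    by (induction rule: rtranclp_induct) (auto intro: rtranclp.rtrancl_into_rtrancl par_app par_refl)
next
  case (step y z)
  then show ?case by (meson par_app par_refl rtranclp.rtrancl_into_rtrancl)
qed

lemma pars_Lam: "par\<^sup>*\<^sup>* t t' \<Longrightarrow> par\<^sup>*\<^sup>* (Lam t) (Lam t')"
  by (induction rule: rtranclp_induct) (auto intro: rtranclp.rtrancl_into_rtrancl par_lam)

theorem Church_Rosser: "t \<approx> u \<Longrightarrow> \<exists>w. par\<^sup>*\<^sup>* t w \<and> par\<^sup>*\<^sup>* u w"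
proof (induction rule: conv.induct)
  case (conv_beta t u)
  have "par (Lam t \<cdot> u) (inst t 0 u)" by (auto intro: par_beta par_refl)
  then show ?case by blast
next
  case (conv_eta t)
  have "par (Lam (lift t 0 \<cdot> Bnd 0)) t" by (auto intro: par_eta par_refl)
  then show ?case by blast
next
  case (conv_app t t' u u')
  then show ?case by (meson pars_app)
next
  case (conv_lam t t')
  then show ?case by (meson pars_Lam)
next
  case (conv_trans t u w)
  then obtain a b where "par\<^sup>*\<^sup>* t a" "par\<^sup>*\<^sup>* u a" "par\<^sup>*\<^sup>* u b" "par\<^sup>*\<^sup>* w b" by auto
  with confluentpD[OF confluentp_par, of u a b] show ?case by (meson rtranclp_trans)
qed auto

primrec head :: "tm \<Rightarrow> cst option" where
  "head (Cst c) = Some c"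
| "head (Free v) = None"
| "head (Bnd i) = None"
| "head (t \<cdot> u) = head t"
| "head (Lam t) = None"

lemma par_head: "par t s \<Longrightarrow> head t = Some c \<Longrightarrow> head s = Some c"
  by (induction rule: par.induct) auto

lemma pars_Cst: "par\<^sup>*\<^sup>* (Cst c) s \<Longrightarrow> s = Cst c"
  by (induction rule: rtranclp_induct) (auto elim: par_cstE)

lemma pars_rigid_app:
  "par\<^sup>*\<^sup>* (t \<cdot> u) s \<Longrightarrow> head t = Some c \<Longrightarrow>
    \<exists>t' u'. s = t' \<cdot> u' \<and> head t' = Some c \<and> par\<^sup>*\<^sup>* t t' \<and> par\<^sup>*\<^sup>* u u'"
proof (induction rule: rtranclp_induct)
  case (step y z)
  then obtain t' u' where y: "y = t' \<cdot> u'" "head t' = Some c" "par\<^sup>*\<^sup>* t t'" "par\<^sup>*\<^sup>* u u'" by auto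
  from step.hyps(2)[unfolded y] show ?case
    by (cases rule: par_appE) (use y par_head in \<open>auto intro: rtranclp.rtrancl_into_rtrancl\<close>)
qed auto

lemma par_imp_conv: "par t u \<Longrightarrow> t \<approx> u"
proof (induction rule: par.induct)
  case (par_beta t t' u u')
  then have "Lam t \<cdot> u \<approx> Lam t' \<cdot> u'" by (intro conv_app conv_lam)
  then show ?case using conv_beta conv_trans by blast
next
  case (par_eta t t')
  then show ?case using conv_eta conv_trans by blast
qed (auto intro: conv_refl conv_app conv_lam)

lemma pars_imp_conv: "par\<^sup>*\<^sup>* t u \<Longrightarrow> t \<approx> u"
  by (induction rule: rtranclp_induct) (auto intro: conv_refl conv_trans par_imp_conv)

declare conv_refl [simp]

lemma conv_Cst_Cst [simp]: "Cst c \<approx> Cst d \<longleftrightarrow> c = d"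
  using Church_Rosser pars_Cst by (metis conv_refl tm.inject(1))

lemma not_conv_Cst_app [simp]: "head t = Some d \<Longrightarrow> \<not> Cst c \<approx> t \<cdot> u"
  using Church_Rosser pars_Cst pars_rigid_app by (metis tm.distinct(5))

lemma not_conv_app_Cst [simp]: "head t = Some d \<Longrightarrow> \<not> t \<cdot> u \<approx> Cst c"
  using not_conv_Cst_app conv_sym by blast

lemma conv_rigid_app [simp]:
  assumes "head t = Some c" "head t' = Some d"
  shows "t \<cdot> u \<approx> t' \<cdot> u' \<longleftrightarrow> t \<approx> t' \<and> u \<approx> u'"
proof
  assume "t \<cdot> u \<approx> t' \<cdot> u'"
  then obtain w where w: "par\<^sup>*\<^sup>* (t \<cdot> u) w" "par\<^sup>*\<^sup>* (t' \<cdot> u') w" using Church_Rosser by blast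
  from pars_rigid_app[OF w(1) assms(1)] pars_rigid_app[OF w(2) assms(2)]
  show "t \<approx> t' \<and> u \<approx> u'" by (metis conv_sym conv_trans pars_imp_conv tm.inject(4))
qed (auto intro: conv_app)


section \<open>Typing and substitution\<close>

abbreviation typed :: "tm \<Rightarrow> ty \<Rightarrow> bool" where "typed \<equiv> has_type []"

lemma has_type_append: "has_type \<Delta> t T \<Longrightarrow> has_type (\<Delta> @ \<Delta>') t T"
proof (induction rule: has_type.induct)
  case (ht_bnd i \<Delta>)
  then show ?case using has_type.ht_bnd[of i "\<Delta> @ \<Delta>'"] by (simp add: nth_append)
qed (auto intro: has_type.intros)

lemma typed_weaken: "typed t T \<Longrightarrow> has_type \<Delta> t T"
  using has_type_append[of "[]"] by simp

lemma lift_typed: "has_type \<Delta> t T \<Longrightarrow> length \<Delta> \<le> k \<Longrightarrow> lift t k = t"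
  by (induction arbitrary: k rule: has_type.induct) auto

lemma inst_typed: "has_type \<Delta> t T \<Longrightarrow> length \<Delta> \<le> k \<Longrightarrow> inst t k s = t"
  by (induction arbitrary: k s rule: has_type.induct) auto

lemma has_type_lift:
  "has_type (\<Delta> @ T # \<Delta>') (lift t (length \<Delta>)) U \<longleftrightarrow> has_type (\<Delta> @ \<Delta>') t U"
proof (induction t arbitrary: \<Delta> U)
  case (Bnd i)
  then show ?case by (auto simp: has_type_simps nth_append Suc_diff_le)
next
  case (Lam t)
  then show ?case using Lam[of "_ # \<Delta>"] by (simp add: has_type_simps)
qed (auto simp: has_type_simps)

lemma has_type_lift_Cons [simp]: "has_type (T # \<Delta>) (lift t 0) U \<longleftrightarrow> has_type \<Delta> t U"
  using has_type_lift[of "[]"] by simp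

lemma has_type_subst:
  assumes "is_subst \<theta>"
  shows "has_type \<Delta> t T \<Longrightarrow> has_type \<Delta> (subst \<theta> t) T"
proof (induction rule: has_type.induct)
  case (ht_free T \<Delta> x)
  then show ?case using assms typed_weaken by (auto simp: is_subst_def)
qed (auto intro: has_type.intros)

lemma has_type_inst:
  assumes "typed s T"
  shows "has_type (\<Delta> @ T # \<Delta>') t U \<Longrightarrow> has_type (\<Delta> @ \<Delta>') (inst t (length \<Delta>) s) U"
proof (induction "\<Delta> @ T # \<Delta>'" t U arbitrary: \<Delta> rule: has_type.induct)
  case (ht_bnd i)
  then show ?case
    using typed_weaken[OF assms]
    by (auto simp: nth_append has_type_simps not_less split: if_splits)
next
  case (ht_lam V t U)
  from ht_lam.hyps(2)[of "V # \<Delta>"] show ?case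
    using lift_typed[OF assms] by (auto intro: has_type.ht_lam)
qed (auto intro: has_type.intros)

lemma has_type_inst_Cons: "has_type (T # \<Delta>) b U \<Longrightarrow> typed s T \<Longrightarrow> has_type \<Delta> (inst b 0 s) U"
  using has_type_inst[of s T "[]" \<Delta> b U] by simp

lemma subst_inst:
  assumes "is_subst \<theta>" "typed s U"
  shows "has_type \<Delta> t T \<Longrightarrow> subst \<theta> (inst t k s) = inst (subst \<theta> t) k (subst \<theta> s)"
proof (induction arbitrary: k rule: has_type.induct)
  case (ht_free T \<Delta> x)
  then have "typed (\<theta> (x, T)) T" using assms(1) by (simp add: is_subst_def)
  from inst_typed[OF this] show ?case by simp
next
  case (ht_lam T \<Delta> t U)
  then show ?case using lift_typed[OF assms(2)] lift_typed[OF has_type_subst[OF assms]] by simp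
qed auto

lemma inst_conv: "s \<approx> t \<Longrightarrow> inst b 0 s \<approx> inst b 0 t"
  by (meson conv_app conv_beta conv_refl conv_sym conv_trans)

lemma subst_Free [simp]: "subst Free t = t"
  by (induction t) auto

lemma is_subst_Free [simp]: "is_subst Free"
  by (simp add: is_subst_def has_type_simps)

lemma is_subst_upd [simp]: "is_subst \<theta> \<Longrightarrow> typed t T \<Longrightarrow> is_subst (\<theta>((x, T) := t))"
  by (simp add: is_subst_def)

lemma subst_rename: "subst \<theta> (rename \<pi> t) = subst (\<lambda>v. \<theta> (\<pi> v)) t"
  unfolding rename_def by (induction t) auto

lemma fv_rename: "fv (rename \<pi> t) = \<pi> ` fv t"
  unfolding rename_def by (induction t) auto

lemma finite_fv [simp]: "finite (fv t)"
  by (induction t) auto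

lemma finite_fvs [simp]: "finite (fvs \<Gamma>)"
  by (simp add: fvs_def)

lemma obtain_fresh:
  assumes "finite (V :: var set)"
  obtains x where "(x, T) \<notin> V"
proof -
  obtain x where "x \<notin> fst ` V" using assms ex_new_if_finite[of "fst ` V"] infinite_UNIV_nat by blast
  then show ?thesis using that by force
qed

lemma obtain_renaming_apart:
  assumes "finite (V :: var set)"
  obtains \<pi> where "is_renaming \<pi>" "range \<pi> \<inter> V = {}"
proof -
  obtain k where "\<forall>n\<in>fst ` V. n < k" using assms finite_nat_set_iff_bounded by blast
  then show ?thesis
    by (intro that[of "\<lambda>v. (fst v + k, snd v)"]) (force simp: is_renaming_def inj_def prod_eq_iff)+
qed

primrec arg_types :: "ty \<Rightarrow> ty list" where
  "arg_types To = []"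
| "arg_types Tnt = []"
| "arg_types Ti = []"
| "arg_types Tatm = []"
| "arg_types Tprp = []"
| "arg_types Tlst = []"
| "arg_types (T \<rightarrow>\<^sub>t U) = T # arg_types U"

lemma has_type_foldl_App:
  "has_type \<Delta> (foldl (\<cdot>) t us) U \<longleftrightarrow>
    (\<exists>Ts. has_type \<Delta> t (foldr (\<rightarrow>\<^sub>t) Ts U) \<and> list_all2 (has_type \<Delta>) us Ts)"
proof (induction us arbitrary: t)
  case (Cons u us)
  have "(\<exists>Ts. Q Ts \<and> list_all2 (has_type \<Delta>) (u # us) Ts) \<longleftrightarrow>
      (\<exists>T Ts. Q (T # Ts) \<and> has_type \<Delta> u T \<and> list_all2 (has_type \<Delta>) us Ts)" for Q
    by (force simp: list_all2_Cons1)
  then show ?case by (simp add: Cons has_type_simps) blast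
qed simp

lemma pred_type_eq_iff: "pred_type p = foldr (\<rightarrow>\<^sub>t) Ts To \<longleftrightarrow> Ts = arg_types (pred_type p)"
proof -
  have "arg_types (foldr (\<rightarrow>\<^sub>t) Ts To) = Ts" by (induction Ts) auto
  moreover have "pred_type p = foldr (\<rightarrow>\<^sub>t) (arg_types (pred_type p)) To" by (cases p) auto
  ultimately show ?thesis by metis
qed

lemma has_type_patom [simp]:
  "has_type \<Delta> (patom p us) To \<longleftrightarrow> list_all2 (has_type \<Delta>) us (arg_types (pred_type p))"
  by (auto simp: patom_def has_type_foldl_App has_type_simps pred_type_eq_iff eq_commute[of "foldr _ _ _"])

lemma head_patom [simp]: "head (patom p us) = Some (Pred p)"
  by (induction us rule: rev_induct) (auto simp: patom_def)

lemma subst_patom [simp]: "subst \<theta> (patom p us) = patom p (map (subst \<theta>) us)"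
  by (induction us rule: rev_induct) (auto simp: patom_def)

lemma inst_patom [simp]: "inst (patom p us) k s = patom p (map (\<lambda>u. inst u k s) us)"
  by (induction us rule: rev_induct) (auto simp: patom_def)

lemma bind_patom [simp]: "bind v k (patom p us) = patom p (map (bind v k) us)"
  by (induction us rule: rev_induct) (auto simp: patom_def)

lemma fv_patom [simp]: "fv (patom p us) = (\<Union>u\<in>set us. fv u)"
  by (induction us rule: rev_induct) (auto simp: patom_def)

lemma patom_conv_iff [simp]:
  "length us = length vs \<Longrightarrow> patom p us \<approx> patom p vs \<longleftrightarrow> list_all2 (\<approx>) us vs"
proof (induction us arbitrary: vs rule: rev_induct)
  case (snoc u us)
  then obtain w ws where vs: "vs = ws @ [w]" "length us = length ws"
    by (cases vs rule: rev_cases) auto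
  have "patom p (us @ [u]) \<approx> patom p (ws @ [w]) \<longleftrightarrow> patom p us \<cdot> u \<approx> patom p ws \<cdot> w"
    by (simp add: patom_def)
  then show ?case using snoc vs by (auto simp: list_all2_append)
qed (auto simp: patom_def)


section \<open>Formulas and the generalized initial sequent\<close>

abbreviation Forall :: "ty \<Rightarrow> tm \<Rightarrow> tm" where "Forall T b \<equiv> Cst (C_all T) \<cdot> Lam b"
abbreviation Exists :: "ty \<Rightarrow> tm \<Rightarrow> tm" where "Exists T b \<equiv> Cst (C_ex T) \<cdot> Lam b"

text \<open>
  A term of type \<open>To\<close> need not be built by the connectives, as it may contain redexes.
  \<open>wff\<close> describes the shape only, so that it also makes sense below binders.
\<close>

inductive wff :: "tm \<Rightarrow> bool" where
  wff_atom: "wff (patom p us)"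
| wff_bot: "wff \<^bold>\<bottom>"
| wff_top: "wff \<^bold>\<top>"
| wff_and: "wff A \<Longrightarrow> wff B \<Longrightarrow> wff (A \<^bold>\<and> B)"
| wff_or: "wff A \<Longrightarrow> wff B \<Longrightarrow> wff (A \<^bold>\<or> B)"
| wff_imp: "wff A \<Longrightarrow> wff B \<Longrightarrow> wff (A \<^bold>\<supset> B)"
| wff_all: "wff b \<Longrightarrow> wff (Forall T b)"
| wff_ex: "wff b \<Longrightarrow> wff (Exists T b)"

lemma eq_patom_imp_head: "t = patom p us \<Longrightarrow> head t = Some (Pred p)"
  by simp

lemma wff_simps [simp]:
  "wff (patom p us)" "wff \<^bold>\<bottom>" "wff \<^bold>\<top>"
  "wff (A \<^bold>\<and> B) \<longleftrightarrow> wff A \<and> wff B"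
  "wff (A \<^bold>\<or> B) \<longleftrightarrow> wff A \<and> wff B"
  "wff (A \<^bold>\<supset> B) \<longleftrightarrow> wff A \<and> wff B"
  "wff (Forall T b) \<longleftrightarrow> wff b"
  "wff (Exists T b) \<longleftrightarrow> wff b"
  by (auto intro: wff.intros elim: wff.cases dest!: eq_patom_imp_head)

lemma wff_inst: "wff A \<Longrightarrow> wff (inst A k s)"
  by (induction arbitrary: k s rule: wff.induct) auto

lemma wff_subst: "wff A \<Longrightarrow> wff (subst \<theta> A)"
  by (induction rule: wff.induct) auto

lemma level_le_imp_wff: "level_le lvl A n \<Longrightarrow> wff A"
  by (induction rule: level_le.induct) auto

text \<open>The arguments of atoms do not count, so \<open>fm_size\<close> is invariant under instantiation.\<close>

primrec fm_size :: "tm \<Rightarrow> nat" where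
  "fm_size (Cst c) = 0"
| "fm_size (Free v) = 0"
| "fm_size (Bnd i) = 0"
| "fm_size (t \<cdot> u) = (if \<exists>p. head t = Some (Pred p) then 0 else Suc (fm_size t + fm_size u))"
| "fm_size (Lam t) = fm_size t"

lemma fm_size_patom [simp]: "fm_size (patom p us) = 0"
proof (cases us rule: rev_cases)
  case (snoc vs v)
  then have "patom p us = patom p vs \<cdot> v" by (simp add: patom_def)
  then show ?thesis by simp
qed (simp add: patom_def)

lemma fm_size_inst: "wff A \<Longrightarrow> fm_size (inst A k s) = fm_size A"
  by (induction arbitrary: k s rule: wff.induct) auto

definition formula :: "tm \<Rightarrow> bool" where
  "formula A \<longleftrightarrow> wff A \<and> typed A To"

lemma formula_typed: "formula A \<Longrightarrow> typed A To"
  by (simp add: formula_def)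

lemma formula_simps [simp]:
  "formula (patom p us) \<longleftrightarrow> list_all2 typed us (arg_types (pred_type p))"
  "formula \<^bold>\<bottom>" "formula \<^bold>\<top>"
  "formula (A \<^bold>\<and> B) \<longleftrightarrow> formula A \<and> formula B"
  "formula (A \<^bold>\<or> B) \<longleftrightarrow> formula A \<and> formula B"
  "formula (A \<^bold>\<supset> B) \<longleftrightarrow> formula A \<and> formula B"
  "formula (Forall T b) \<longleftrightarrow> o_free T \<and> wff b \<and> has_type [T] b To"
  "formula (Exists T b) \<longleftrightarrow> o_free T \<and> wff b \<and> has_type [T] b To"
  by (auto simp: formula_def has_type_simps)

lemma formula_inst: "wff b \<Longrightarrow> has_type [T] b To \<Longrightarrow> typed t T \<Longrightarrow> formula (inst b 0 t)"
  by (simp add: formula_def wff_inst has_type_inst_Cons)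

lemma formula_subst: "formula A \<Longrightarrow> is_subst \<theta> \<Longrightarrow> formula (subst \<theta> A)"
  by (simp add: formula_def wff_subst has_type_subst)

lemma formula_clause: "is_definition D \<Longrightarrow> (p, ts, B) \<in> D \<Longrightarrow> formula B"
  by (auto simp: is_definition_def formula_def dest: level_le_imp_wff)

lemma derives_convL:
  assumes "derives D (add_mset A \<Gamma>) C" "A \<approx> A'" "typed A' To"
  shows "derives D (add_mset A' \<Gamma>) C"
proof (rule d_conv[OF assms(1)])
  show "rel_mset (\<approx>) (add_mset A \<Gamma>) (add_mset A' \<Gamma>)"
    using assms(2) by (intro rel_mset_Plus multiset.rel_refl conv_refl)
qed (use derives_wf_seq[OF assms(1)] assms(3) in \<open>auto simp: wf_seq_def\<close>)

lemma derives_convR: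
  assumes "derives D \<Gamma> C" "C \<approx> C'" "typed C' To"
  shows "derives D \<Gamma> C'"
  using assms derives_wf_seq[OF assms(1)]
  by (auto simp: wf_seq_def intro!: d_conv[OF assms(1)] multiset.rel_refl)

lemma derives_beta:
  assumes "derives D (add_mset (inst b 0 t) \<Gamma>) (inst b 0 t)" "has_type [T] b To" "typed t T"
  shows "derives D (add_mset (Lam b \<cdot> t) \<Gamma>) (Lam b \<cdot> t)"
  using assms by (intro derives_convR[OF derives_convL[OF assms(1)]] conv_sym[OF conv_beta])
    (auto intro: ht_app ht_lam)

lemma derives_id_eigenvariable:
  assumes "o_free T" "has_type [T] b To"
    and "\<And>t. typed t T \<Longrightarrow> derives D (add_mset (inst b 0 t) \<Gamma>) (inst b 0 t)"
  obtains x where "(x, T) \<notin> fvs \<Gamma> \<union> fv b" "typed (Free (x, T)) T"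
    "derives D (add_mset (Lam b \<cdot> Free (x, T)) \<Gamma>) (Lam b \<cdot> Free (x, T))"
proof -
  obtain x where "(x, T) \<notin> fvs \<Gamma> \<union> fv b" by (rule obtain_fresh[of "fvs \<Gamma> \<union> fv b"]) auto
  moreover have "typed (Free (x, T)) T" using assms(1) by (simp add: has_type_simps)
  ultimately show ?thesis using that derives_beta[OF assms(3,2)] by blast
qed

lemma derives_id_quantifier:
  assumes b: "o_free T" "has_type [T] b To" and \<Gamma>: "\<forall>B\<in>#\<Gamma>. typed B To"
    and inst: "\<And>t. typed t T \<Longrightarrow> derives D (add_mset (inst b 0 t) \<Gamma>) (inst b 0 t)"
  shows "derives D (add_mset (Forall T b) \<Gamma>) (Forall T b)"
    and "derives D (add_mset (Exists T b) \<Gamma>) (Exists T b)"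
proof -
  obtain x where "(x, T) \<notin> fvs \<Gamma> \<union> fv b" "typed (Free (x, T)) T"
    "derives D (add_mset (Lam b \<cdot> Free (x, T)) \<Gamma>) (Lam b \<cdot> Free (x, T))"
    using b inst by (rule derives_id_eigenvariable)
  then show "derives D (add_mset (Forall T b) \<Gamma>) (Forall T b)"
    and "derives D (add_mset (Exists T b) \<Gamma>) (Exists T b)"
    using b \<Gamma> by (intro d_allR[where x = x] d_allL d_exL[where x = x] d_exR ht_lam;
        auto simp: fvs_def intro: ht_lam)+
qed

lemma derives_id:
  "formula A \<Longrightarrow> \<forall>B\<in>#\<Gamma>. typed B To \<Longrightarrow> derives D (add_mset A \<Gamma>) A"
proof (induction "fm_size A" arbitrary: A \<Gamma> rule: less_induct)
  case less
  have "wff A" using less.prems(1) by (simp add: formula_def)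
  then show ?case
  proof cases
    case (wff_atom p us)
    then show ?thesis using less.prems by (auto simp: wf_seq_def intro: d_init)
  next
    case wff_bot
    then show ?thesis using less.prems by (auto simp: wf_seq_def has_type_simps intro: d_botL)
  next
    case wff_top
    then show ?thesis using less.prems by (auto simp: wf_seq_def has_type_simps intro: d_topR)
  next
    case (wff_and B C)
    then show ?thesis using less
      by (auto intro!: d_andR intro: d_andL1 d_andL2 formula_typed)
  next
    case (wff_or B C)
    then show ?thesis using less
      by (auto intro!: d_orL intro: d_orR1 d_orR2 formula_typed)
  next
    case (wff_imp B C)
    then have "derives D (add_mset (B \<^bold>\<supset> C) (add_mset B \<Gamma>)) C"
      using less by (intro d_impL less.hyps) (auto intro: formula_typed)
    then show ?thesis using wff_imp by (auto intro: d_impR simp: add_mset_commute)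
  next
    case (wff_all b T)
    show ?thesis unfolding wff_all(1) using wff_all less
      by (intro derives_id_quantifier) (auto simp: fm_size_inst intro!: less.hyps formula_inst)
  next
    case (wff_ex b T)
    show ?thesis unfolding wff_ex(1) using wff_ex less
      by (intro derives_id_quantifier) (auto simp: fm_size_inst intro!: less.hyps formula_inst)
  qed
qed

lemma derives_contract:
  "derives D (\<Gamma> + \<Delta>) C \<Longrightarrow> set_mset \<Gamma> \<subseteq> set_mset \<Delta> \<Longrightarrow> derives D \<Delta> C"
proof (induction \<Gamma>)
  case (add A \<Gamma>)
  then obtain \<Delta>' where \<Delta>: "\<Delta> = add_mset A \<Delta>'" by (auto dest: multi_member_split)
  with add.prems have "derives D (add_mset A (add_mset A (\<Gamma> + \<Delta>'))) C" by simp
  from d_contract[OF this] add \<Delta> show ?case by simp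
qed simp

text \<open>The calculus has no weakening rule; cutting the conclusion against itself weakens.\<close>

lemma derives_structural:
  assumes "derives D \<Gamma> C" "formula C" "set_mset \<Gamma> \<subseteq> set_mset \<Delta>" "\<forall>B\<in>#\<Delta>. typed B To"
  shows "derives D \<Delta> C"
  using d_cut[OF assms(1) derives_id[OF assms(2,4)]] assms(3) by (rule derives_contract)


section \<open>Entailment\<close>

definition entails :: "tm multiset \<Rightarrow> clause set \<Rightarrow> tm \<Rightarrow> bool"  ("_ \<tturnstile>\<^bsub>_\<^esub> _" [46, 0, 46] 45)
  where "\<Gamma> \<tturnstile>\<^bsub>D\<^esub> C \<longleftrightarrow> formula C \<and> (\<exists>\<Gamma>'. set_mset \<Gamma>' \<subseteq> set_mset \<Gamma> \<and> derives D \<Gamma>' C)"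

abbreviation extends :: "tm multiset \<Rightarrow> tm multiset \<Rightarrow> bool"  (infix "\<sqsubseteq>" 50) where
  "\<Gamma> \<sqsubseteq> \<Gamma>' \<equiv> set_mset \<Gamma> \<subseteq> set_mset \<Gamma>'"

lemma entailsI: "derives D \<Gamma>' C \<Longrightarrow> formula C \<Longrightarrow> \<Gamma>' \<sqsubseteq> \<Gamma> \<Longrightarrow> \<Gamma> \<tturnstile>\<^bsub>D\<^esub> C"
  by (auto simp: entails_def)

lemma entails_formula: "\<Gamma> \<tturnstile>\<^bsub>D\<^esub> C \<Longrightarrow> formula C"
  by (simp add: entails_def)

lemma entails_mono: "\<Gamma> \<tturnstile>\<^bsub>D\<^esub> C \<Longrightarrow> \<Gamma> \<sqsubseteq> \<Gamma>' \<Longrightarrow> \<Gamma>' \<tturnstile>\<^bsub>D\<^esub> C"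
  by (auto simp: entails_def)

lemma entails_hyp: "A \<in># \<Gamma> \<Longrightarrow> formula A \<Longrightarrow> \<Gamma> \<tturnstile>\<^bsub>D\<^esub> A"
  by (rule entailsI[OF derives_id[where \<Gamma> = "{#}"]]) auto

lemma entails_derives: "\<Gamma> \<tturnstile>\<^bsub>D\<^esub> C \<Longrightarrow> \<forall>A\<in>#\<Gamma>. typed A To \<Longrightarrow> derives D \<Gamma> C"
  by (auto simp: entails_def intro: derives_structural)

lemma entails_insertE:
  assumes "add_mset A \<Gamma> \<tturnstile>\<^bsub>D\<^esub> C" "typed A To"
  obtains \<Delta> where "\<Delta> \<sqsubseteq> \<Gamma>" "derives D (add_mset A \<Delta>) C"
proof -
  from assms(1) obtain \<Gamma>' where \<Gamma>': "\<Gamma>' \<sqsubseteq> add_mset A \<Gamma>" "derives D \<Gamma>' C" "formula C"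
    by (auto simp: entails_def)
  let ?\<Delta> = "filter_mset (\<lambda>B. B \<noteq> A) \<Gamma>'"
  have "derives D (add_mset A ?\<Delta>) C"
    using \<Gamma>' derives_wf_seq[OF \<Gamma>'(2)] assms(2)
    by (intro derives_structural[OF \<Gamma>'(2,3)]) (auto simp: wf_seq_def)
  then show ?thesis using \<Gamma>'(1) by (intro that[of ?\<Delta>]) auto
qed

lemma entails_cut:
  assumes "\<Gamma> \<tturnstile>\<^bsub>D\<^esub> A" "add_mset A \<Gamma> \<tturnstile>\<^bsub>D\<^esub> C"
  shows "\<Gamma> \<tturnstile>\<^bsub>D\<^esub> C"
proof -
  from assms(1) obtain \<Gamma>' where \<Gamma>': "\<Gamma>' \<sqsubseteq> \<Gamma>" "derives D \<Gamma>' A" by (auto simp: entails_def)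
  from assms(2) formula_typed[OF entails_formula[OF assms(1)]]
  obtain \<Delta> where \<Delta>: "\<Delta> \<sqsubseteq> \<Gamma>" "derives D (add_mset A \<Delta>) C" by (rule entails_insertE)
  from d_cut[OF \<Gamma>'(2) \<Delta>(2)] show ?thesis
    by (rule entailsI) (use \<Gamma>' \<Delta> entails_formula[OF assms(2)] in auto)
qed

lemma entails_trans:
  assumes "\<Delta> \<tturnstile>\<^bsub>D\<^esub> C" "\<forall>A\<in>#\<Delta>. \<Gamma> \<tturnstile>\<^bsub>D\<^esub> A"
  shows "\<Gamma> \<tturnstile>\<^bsub>D\<^esub> C"
proof -
  have "\<Delta> + \<Gamma> \<tturnstile>\<^bsub>D\<^esub> C" using assms(1) by (rule entails_mono) auto
  then show ?thesis using assms(2)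
  proof (induction \<Delta>)
    case (add A \<Delta>)
    then have "\<Delta> + \<Gamma> \<tturnstile>\<^bsub>D\<^esub> A" by (auto elim: entails_mono)
    with add show ?case by (auto intro: entails_cut)
  qed simp
qed

lemma entails_by_derives:
  assumes "derives D \<Delta> C" "formula C" "\<forall>A\<in>#\<Delta>. \<Gamma> \<tturnstile>\<^bsub>D\<^esub> A"
  shows "\<Gamma> \<tturnstile>\<^bsub>D\<^esub> C"
  using entailsI[OF assms(1,2)] assms(3) by (blast intro: entails_trans)

lemma entails_conv: "\<Gamma> \<tturnstile>\<^bsub>D\<^esub> A \<Longrightarrow> A \<approx> B \<Longrightarrow> formula B \<Longrightarrow> \<Gamma> \<tturnstile>\<^bsub>D\<^esub> B"
  by (rule entails_by_derives[OF derives_convR[OF derives_id[where \<Gamma> = "{#}" and A = A]]])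
    (auto dest: entails_formula intro: formula_typed)

lemma entails_patom_conv:
  "\<Gamma> \<tturnstile>\<^bsub>D\<^esub> patom p us \<Longrightarrow> list_all2 (\<approx>) us vs \<Longrightarrow> typed (patom p vs) To \<Longrightarrow> \<Gamma> \<tturnstile>\<^bsub>D\<^esub> patom p vs"
  by (erule entails_conv) (auto simp: list_all2_lengthD)

lemma entails_topI: "\<Gamma> \<tturnstile>\<^bsub>D\<^esub> \<^bold>\<top>"
  by (rule entailsI[OF d_topR[of "{#}"]]) (auto simp: wf_seq_def has_type_simps)

lemma entails_botE: "\<Gamma> \<tturnstile>\<^bsub>D\<^esub> \<^bold>\<bottom> \<Longrightarrow> formula C \<Longrightarrow> \<Gamma> \<tturnstile>\<^bsub>D\<^esub> C"
  by (rule entails_by_derives[OF d_botL[of "{#}"]]) (auto simp: wf_seq_def formula_typed)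

lemma entails_and_iff [simp]: "\<Gamma> \<tturnstile>\<^bsub>D\<^esub> A \<^bold>\<and> B \<longleftrightarrow> \<Gamma> \<tturnstile>\<^bsub>D\<^esub> A \<and> \<Gamma> \<tturnstile>\<^bsub>D\<^esub> B"
proof
  assume conj: "\<Gamma> \<tturnstile>\<^bsub>D\<^esub> A \<^bold>\<and> B"
  then have formulas: "formula A" "formula B" by (auto dest: entails_formula)
  then have "derives D {#A \<^bold>\<and> B#} A" "derives D {#A \<^bold>\<and> B#} B"
    by (auto intro!: d_andL1[OF derives_id] d_andL2[OF derives_id] formula_typed)
  with conj formulas show "\<Gamma> \<tturnstile>\<^bsub>D\<^esub> A \<and> \<Gamma> \<tturnstile>\<^bsub>D\<^esub> B" by (auto elim: entails_by_derives)
next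
  assume conjs: "\<Gamma> \<tturnstile>\<^bsub>D\<^esub> A \<and> \<Gamma> \<tturnstile>\<^bsub>D\<^esub> B"
  then have formulas: "formula A" "formula B" by (auto dest: entails_formula)
  then have "derives D {#A, B#} A" "derives D {#B, A#} B"
    by (auto intro!: derives_id formula_typed)
  then have "derives D {#A, B#} (A \<^bold>\<and> B)" by (auto intro: d_andR simp: add_mset_commute)
  with conjs formulas show "\<Gamma> \<tturnstile>\<^bsub>D\<^esub> A \<^bold>\<and> B" by (auto elim: entails_by_derives)
qed

lemma entails_orI1: "\<Gamma> \<tturnstile>\<^bsub>D\<^esub> A \<Longrightarrow> formula B \<Longrightarrow> \<Gamma> \<tturnstile>\<^bsub>D\<^esub> A \<^bold>\<or> B"
  by (rule entails_by_derives[OF d_orR1[OF derives_id[where \<Gamma> = "{#}"]]])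
    (auto dest: entails_formula intro: formula_typed)

lemma entails_orI2: "\<Gamma> \<tturnstile>\<^bsub>D\<^esub> B \<Longrightarrow> formula A \<Longrightarrow> \<Gamma> \<tturnstile>\<^bsub>D\<^esub> A \<^bold>\<or> B"
  by (rule entails_by_derives[OF d_orR2[OF derives_id[where \<Gamma> = "{#}"]]])
    (auto dest: entails_formula intro: formula_typed)

lemma entails_impI:
  assumes "formula A" "\<And>\<Gamma>'. \<Gamma> \<sqsubseteq> \<Gamma>' \<Longrightarrow> \<Gamma>' \<tturnstile>\<^bsub>D\<^esub> A \<Longrightarrow> \<Gamma>' \<tturnstile>\<^bsub>D\<^esub> B"
  shows "\<Gamma> \<tturnstile>\<^bsub>D\<^esub> A \<^bold>\<supset> B"
proof -
  have entails_B: "add_mset A \<Gamma> \<tturnstile>\<^bsub>D\<^esub> B" by (rule assms(2)[OF _ entails_hyp]) (use assms(1) in auto)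
  then obtain \<Delta> where "\<Delta> \<sqsubseteq> \<Gamma>" "derives D (add_mset A \<Delta>) B"
    using formula_typed[OF assms(1)] by (rule entails_insertE)
  then show ?thesis using assms(1) entails_formula[OF entails_B] by (auto intro: entailsI d_impR)
qed

lemma entails_mp: "\<Gamma> \<tturnstile>\<^bsub>D\<^esub> A \<^bold>\<supset> B \<Longrightarrow> \<Gamma> \<tturnstile>\<^bsub>D\<^esub> A \<Longrightarrow> \<Gamma> \<tturnstile>\<^bsub>D\<^esub> B"
  by (rule entails_by_derives[OF d_impL[of _ "{#A#}", OF derives_id derives_id]])
    (auto dest: entails_formula intro: formula_typed)

lemma entails_imp_iff:
  "\<Gamma> \<tturnstile>\<^bsub>D\<^esub> A \<^bold>\<supset> B \<longleftrightarrow> formula A \<and> formula B \<and> (\<forall>\<Gamma>'. \<Gamma> \<sqsubseteq> \<Gamma>' \<longrightarrow> \<Gamma>' \<tturnstile>\<^bsub>D\<^esub> A \<longrightarrow> \<Gamma>' \<tturnstile>\<^bsub>D\<^esub> B)"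
  by (auto intro: entails_impI entails_mp entails_mono dest: entails_formula)

lemma entails_orE:
  assumes "\<Gamma> \<tturnstile>\<^bsub>D\<^esub> A \<^bold>\<or> B"
    and "\<And>\<Gamma>'. \<Gamma> \<sqsubseteq> \<Gamma>' \<Longrightarrow> \<Gamma>' \<tturnstile>\<^bsub>D\<^esub> A \<Longrightarrow> \<Gamma>' \<tturnstile>\<^bsub>D\<^esub> C"
    and "\<And>\<Gamma>'. \<Gamma> \<sqsubseteq> \<Gamma>' \<Longrightarrow> \<Gamma>' \<tturnstile>\<^bsub>D\<^esub> B \<Longrightarrow> \<Gamma>' \<tturnstile>\<^bsub>D\<^esub> C"
  shows "\<Gamma> \<tturnstile>\<^bsub>D\<^esub> C"
proof -
  have formulas: "formula A" "formula B" using entails_formula[OF assms(1)] by auto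
  then have imp: "\<Gamma> \<tturnstile>\<^bsub>D\<^esub> A \<^bold>\<supset> C" "\<Gamma> \<tturnstile>\<^bsub>D\<^esub> B \<^bold>\<supset> C" using assms(2,3) by (auto intro!: entails_impI)
  then have "formula C" by (auto dest: entails_formula)
  have "{#X, A \<^bold>\<supset> C, B \<^bold>\<supset> C#} \<tturnstile>\<^bsub>D\<^esub> C" if "X = A \<or> X = B" for X
    by (rule entails_mp[where A = X]; rule entails_hyp) (use that formulas \<open>formula C\<close> in auto)
  then have "derives D {#X, A \<^bold>\<supset> C, B \<^bold>\<supset> C#} C" if "X = A \<or> X = B" for X
    by (rule entails_derives) (use that formulas \<open>formula C\<close> formula_typed in auto)
  then have "derives D {#A \<^bold>\<or> B, A \<^bold>\<supset> C, B \<^bold>\<supset> C#} C" by (intro d_orL) auto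
  then show ?thesis using assms(1) imp \<open>formula C\<close> by (intro entails_by_derives) auto
qed

lemma entails_allE:
  assumes "\<Gamma> \<tturnstile>\<^bsub>D\<^esub> Forall T b" "typed t T"
  shows "\<Gamma> \<tturnstile>\<^bsub>D\<^esub> inst b 0 t"
proof (rule entails_by_derives)
  have b: "o_free T" "wff b" "has_type [T] b To" using entails_formula[OF assms(1)] by auto
  then show formulas: "formula (inst b 0 t)" using assms(2) by (simp add: formula_inst)
  have "derives D {#Lam b \<cdot> t#} (inst b 0 t)"
    using b assms(2) by (intro derives_convL[OF derives_id[OF formulas] conv_sym[OF conv_beta]])
      (auto intro: ht_app ht_lam)
  then show "derives D {#Forall T b#} (inst b 0 t)"
    using b assms(2) by (auto intro: d_allL ht_lam)
qed (use assms in auto)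

lemma entails_allI:
  assumes "o_free T" "has_type [T] b To" "wff b" "\<And>t. typed t T \<Longrightarrow> \<Gamma> \<tturnstile>\<^bsub>D\<^esub> inst b 0 t"
  shows "\<Gamma> \<tturnstile>\<^bsub>D\<^esub> Forall T b"
proof -
  obtain x where x: "(x, T) \<notin> fvs \<Gamma> \<union> fv b" by (rule obtain_fresh[of "fvs \<Gamma> \<union> fv b"]) auto
  have typed_x: "typed (Free (x, T)) T" using assms(1) by (simp add: has_type_simps)
  from assms(4)[OF this] obtain \<Delta> where \<Delta>: "\<Delta> \<sqsubseteq> \<Gamma>" "derives D \<Delta> (inst b 0 (Free (x, T)))"
    by (auto simp: entails_def)
  have "derives D \<Delta> (Lam b \<cdot> Free (x, T))"
    using assms(2) typed_x by (intro derives_convR[OF \<Delta>(2) conv_sym[OF conv_beta]])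
      (auto intro: ht_app ht_lam)
  then have "derives D \<Delta> (Forall T b)"
    by (rule d_allR) (use assms x \<Delta> in \<open>auto simp: fvs_def intro: ht_lam\<close>)
  then show ?thesis using \<Delta> assms(1-3) by (auto intro: entailsI)
qed

lemma entails_all_iff:
  "\<Gamma> \<tturnstile>\<^bsub>D\<^esub> Forall T b \<longleftrightarrow>
    o_free T \<and> wff b \<and> has_type [T] b To \<and> (\<forall>t. typed t T \<longrightarrow> \<Gamma> \<tturnstile>\<^bsub>D\<^esub> inst b 0 t)"
  by (auto intro: entails_allI entails_allE dest: entails_formula)

lemma entails_exI:
  assumes "\<Gamma> \<tturnstile>\<^bsub>D\<^esub> inst b 0 t" "typed t T" "formula (Exists T b)"
  shows "\<Gamma> \<tturnstile>\<^bsub>D\<^esub> Exists T b"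
proof (rule entails_by_derives)
  have b: "o_free T" "has_type [T] b To" using assms(3) by auto
  then have "derives D {#inst b 0 t#} (Lam b \<cdot> t)"
    using assms entails_formula[OF assms(1)]
    by (intro derives_convR[OF derives_id conv_sym[OF conv_beta]]) (auto intro: ht_app ht_lam)
  then show "derives D {#inst b 0 t#} (Exists T b)"
    using b assms(2) by (auto intro: d_exR ht_lam)
qed (use assms in auto)

lemma entails_exE:
  assumes "\<Gamma> \<tturnstile>\<^bsub>D\<^esub> Exists T b"
    and continuation: "\<And>\<Gamma>' t. \<Gamma> \<sqsubseteq> \<Gamma>' \<Longrightarrow> typed t T \<Longrightarrow> \<Gamma>' \<tturnstile>\<^bsub>D\<^esub> inst b 0 t \<Longrightarrow> \<Gamma>' \<tturnstile>\<^bsub>D\<^esub> C"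
  shows "\<Gamma> \<tturnstile>\<^bsub>D\<^esub> C"
proof (rule entails_cut[OF assms(1)])
  let ?V = "fvs \<Gamma> \<union> fv b \<union> fv C"
  obtain x where x: "(x, T) \<notin> ?V" by (rule obtain_fresh[of ?V]) auto
  have b: "o_free T" "wff b" "has_type [T] b To" using entails_formula[OF assms(1)] by auto
  have typed_x: "typed (Free (x, T)) T" using b(1) by (simp add: has_type_simps)
  let ?A = "inst b 0 (Free (x, T))"
  have formula_A: "formula ?A" using b typed_x by (simp add: formula_inst)
  have entails_C: "add_mset ?A \<Gamma> \<tturnstile>\<^bsub>D\<^esub> C"
    by (rule continuation[OF _ typed_x entails_hyp]) (use formula_A in auto)
  then obtain \<Delta> where \<Delta>: "\<Delta> \<sqsubseteq> \<Gamma>" "derives D (add_mset ?A \<Delta>) C"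
    using formula_typed[OF formula_A] by (rule entails_insertE)
  have "derives D (add_mset (Lam b \<cdot> Free (x, T)) \<Delta>) C"
    using b typed_x by (intro derives_convL[OF \<Delta>(2) conv_sym[OF conv_beta]])
      (auto intro: ht_app ht_lam)
  then have "derives D (add_mset (Exists T b) \<Delta>) C"
    by (rule d_exL) (use b x \<Delta> in \<open>auto simp: fvs_def intro: ht_lam\<close>)
  then show "add_mset (Exists T b) \<Gamma> \<tturnstile>\<^bsub>D\<^esub> C"
    by (rule entailsI) (use \<Delta>(1) entails_formula[OF entails_C] in auto)
qed

lemma entails_ex2I:
  assumes "\<Gamma> \<tturnstile>\<^bsub>D\<^esub> inst (inst b 1 t) 0 u" "typed t T" "typed u U"
    and "formula (Exists T (Exists U b))"
  shows "\<Gamma> \<tturnstile>\<^bsub>D\<^esub> Exists T (Exists U b)"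
proof (rule entails_exI[OF _ assms(2,4)])
  have "formula (inst (Exists U b) 0 t)" using assms(2,4) by (intro formula_inst) auto
  then show "\<Gamma> \<tturnstile>\<^bsub>D\<^esub> inst (Exists U b) 0 t"
    using assms(1,3) lift_typed[OF assms(2)] by (auto intro: entails_exI)
qed

lemma entails_ex2E:
  assumes "\<Gamma> \<tturnstile>\<^bsub>D\<^esub> Exists T (Exists U b)"
    and continuation: "\<And>\<Gamma>' t u. \<Gamma> \<sqsubseteq> \<Gamma>' \<Longrightarrow> typed t T \<Longrightarrow> typed u U \<Longrightarrow> \<Gamma>' \<tturnstile>\<^bsub>D\<^esub> inst (inst b 1 t) 0 u \<Longrightarrow>
      \<Gamma>' \<tturnstile>\<^bsub>D\<^esub> C"
  shows "\<Gamma> \<tturnstile>\<^bsub>D\<^esub> C"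
  using assms(1)
proof (rule entails_exE)
  fix \<Gamma>' t assume \<Gamma>': "\<Gamma> \<sqsubseteq> \<Gamma>'" and t: "typed t T" and "\<Gamma>' \<tturnstile>\<^bsub>D\<^esub> inst (Exists U b) 0 t"
  then have "\<Gamma>' \<tturnstile>\<^bsub>D\<^esub> Exists U (inst b 1 t)" using lift_typed[OF t] by simp
  then show "\<Gamma>' \<tturnstile>\<^bsub>D\<^esub> C"
  proof (rule entails_exE)
    fix \<Gamma>'' u assume "\<Gamma>' \<sqsubseteq> \<Gamma>''" "typed u U" "\<Gamma>'' \<tturnstile>\<^bsub>D\<^esub> inst (inst b 1 t) 0 u"
    then show "\<Gamma>'' \<tturnstile>\<^bsub>D\<^esub> C" using continuation[of \<Gamma>'' t u] \<Gamma>' t by auto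
  qed
qed

lemma entails_ex3I:
  assumes "\<Gamma> \<tturnstile>\<^bsub>D\<^esub> inst (inst (inst b 2 t) 1 u) 0 v" "typed t T" "typed u U" "typed v V"
    and "formula (Exists T (Exists U (Exists V b)))"
  shows "\<Gamma> \<tturnstile>\<^bsub>D\<^esub> Exists T (Exists U (Exists V b))"
proof (rule entails_exI[OF _ assms(2,5)])
  have "formula (inst (Exists U (Exists V b)) 0 t)" using assms(2,5) by (intro formula_inst) auto
  then show "\<Gamma> \<tturnstile>\<^bsub>D\<^esub> inst (Exists U (Exists V b)) 0 t"
    using assms(1,3,4) lift_typed[OF assms(2)] by (auto intro!: entails_ex2I simp: numeral_2_eq_2)
qed

lemma entails_ex3E:
  assumes "\<Gamma> \<tturnstile>\<^bsub>D\<^esub> Exists T (Exists U (Exists V b))"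
    and continuation: "\<And>\<Gamma>' t u v. \<Gamma> \<sqsubseteq> \<Gamma>' \<Longrightarrow> typed t T \<Longrightarrow> typed u U \<Longrightarrow> typed v V \<Longrightarrow>
      \<Gamma>' \<tturnstile>\<^bsub>D\<^esub> inst (inst (inst b 2 t) 1 u) 0 v \<Longrightarrow> \<Gamma>' \<tturnstile>\<^bsub>D\<^esub> C"
  shows "\<Gamma> \<tturnstile>\<^bsub>D\<^esub> C"
  using assms(1)
proof (rule entails_exE)
  fix \<Gamma>' t assume \<Gamma>': "\<Gamma> \<sqsubseteq> \<Gamma>'" and t: "typed t T"
    and "\<Gamma>' \<tturnstile>\<^bsub>D\<^esub> inst (Exists U (Exists V b)) 0 t"
  then have "\<Gamma>' \<tturnstile>\<^bsub>D\<^esub> Exists U (Exists V (inst b 2 t))"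
    using lift_typed[OF t] by (simp add: numeral_2_eq_2)
  then show "\<Gamma>' \<tturnstile>\<^bsub>D\<^esub> C"
  proof (rule entails_ex2E)
    fix \<Gamma>'' u v assume "\<Gamma>' \<sqsubseteq> \<Gamma>''" "typed u U" "typed v V"
      "\<Gamma>'' \<tturnstile>\<^bsub>D\<^esub> inst (inst (inst b 2 t) 1 u) 0 v"
    then show "\<Gamma>'' \<tturnstile>\<^bsub>D\<^esub> C" using continuation[of \<Gamma>'' t u v] \<Gamma>' t by auto
  qed
qed

text \<open>
  A formula with a hole for a term of type \<open>T\<close> is given as a function that commutes with
  instantiation, so the function has to lift its argument below binders.
\<close>

definition predicate :: "ty \<Rightarrow> (tm \<Rightarrow> tm) \<Rightarrow> bool" where
  "predicate T P \<longleftrightarrow> wff (P (Bnd 0)) \<and> has_type [T] (P (Bnd 0)) To \<and>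
    (\<forall>t k s. inst (P t) k s = P (inst t k s))"

lemma predicate_eq_inst: "predicate T P \<Longrightarrow> P t = inst (P (Bnd 0)) 0 t"
  by (simp add: predicate_def)

lemma predicate_formula: "predicate T P \<Longrightarrow> typed t T \<Longrightarrow> formula (P t)"
  by (metis formula_inst predicate_def predicate_eq_inst)

lemma predicate_subst_conv:
  assumes pred_P: "predicate T P" and \<theta>: "is_subst \<theta>"
    and "typed s T" "typed t T" "subst \<theta> s \<approx> subst \<theta> t"
  shows "subst \<theta> (P s) \<approx> subst \<theta> (P t)"
proof -
  have "has_type [T] (P (Bnd 0)) To" using pred_P by (simp add: predicate_def)
  then have "subst \<theta> (P u) = inst (subst \<theta> (P (Bnd 0))) 0 (subst \<theta> u)" if "typed u T" for u
    using subst_inst[OF \<theta> that] predicate_eq_inst[OF pred_P, of u] by simp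
  then show ?thesis using assms(3-5) by (simp add: inst_conv)
qed

lemma entails_nat_typed: "\<Gamma> \<tturnstile>\<^bsub>D\<^esub> nat_fm t \<Longrightarrow> typed t Tnt"
  by (auto dest: entails_formula)

lemma entails_nat_zero: "\<Gamma> \<tturnstile>\<^bsub>D\<^esub> nat_fm zero_tm"
  by (rule entailsI[OF d_natR_z[of "{#}"]]) (auto simp: wf_seq_def has_type_simps)

lemma entails_nat_suc: "\<Gamma> \<tturnstile>\<^bsub>D\<^esub> nat_fm t \<Longrightarrow> \<Gamma> \<tturnstile>\<^bsub>D\<^esub> nat_fm (suc_tm t)"
  by (rule entails_by_derives[OF d_natR_s[OF derives_id[where \<Gamma> = "{#}"]]])
    (auto dest: entails_nat_typed simp: has_type_simps)

lemma entails_nat_induct: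
  assumes "\<Gamma> \<tturnstile>\<^bsub>D\<^esub> nat_fm t" and pred_P: "predicate Tnt P"
    and zero: "\<And>\<Gamma>. \<Gamma> \<tturnstile>\<^bsub>D\<^esub> P zero_tm"
    and suc: "\<And>\<Gamma> j. \<Gamma> \<tturnstile>\<^bsub>D\<^esub> nat_fm j \<Longrightarrow> \<Gamma> \<tturnstile>\<^bsub>D\<^esub> P j \<Longrightarrow> \<Gamma> \<tturnstile>\<^bsub>D\<^esub> P (suc_tm j)"
  shows "\<Gamma> \<tturnstile>\<^bsub>D\<^esub> P t"
proof -
  let ?Q = "\<lambda>i. nat_fm i \<^bold>\<and> P i"
  let ?b = "?Q (Bnd 0)"
  obtain x where x: "(x, Tnt) \<notin> fv (P (Bnd 0))" by (rule obtain_fresh[of "fv (P (Bnd 0))"]) auto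
  let ?x = "Free (x, Tnt)"
  have typing: "typed t Tnt" "typed zero_tm Tnt" "typed ?x Tnt" "typed (suc_tm ?x) Tnt"
    using entails_nat_typed[OF assms(1)] by (auto simp: has_type_simps)
  have formulas: "formula (?Q i)" if "typed i Tnt" for i using that pred_P
    by (simp add: predicate_formula)
  have b: "typed (Lam ?b) (Tnt \<rightarrow>\<^sub>t To)"
    using pred_P by (auto simp: predicate_def has_type_simps)
  have beta: "?Q i \<approx> Lam ?b \<cdot> i" if "typed i Tnt" for i
    using that pred_P conv_sym[OF conv_beta[of ?b i]] by (simp add: predicate_def)
  have "derives D {#} (?Q zero_tm)"
    by (rule entails_derives) (auto intro: zero entails_nat_zero)
  then have "derives D {#} (Lam ?b \<cdot> zero_tm)"
    by (rule derives_convR[OF _ beta]) (use typing b in \<open>auto intro: ht_app\<close>)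
  moreover have "{#?Q ?x#} \<tturnstile>\<^bsub>D\<^esub> ?Q ?x" by (rule entails_hyp) (use formulas typing in auto)
  then have "derives D {#?Q ?x#} (?Q (suc_tm ?x))"
    using formulas typing by (intro entails_derives) (auto intro: suc entails_nat_suc formula_typed)
  then have "derives D {#Lam ?b \<cdot> ?x#} (Lam ?b \<cdot> suc_tm ?x)"
    by (intro derives_convR[OF derives_convL[OF _ beta] beta] ht_app[OF b] typing)
  moreover have "derives D {#?Q t#} (?Q t)" using formulas typing by (auto intro: derives_id)
  then have "derives D {#Lam ?b \<cdot> t#} (?Q t)"
    by (intro derives_convL[OF _ beta] ht_app[OF b] typing)
  ultimately have "derives D {#nat_fm t#} (?Q t)"
    by (rule d_natL) (use b typing x in auto)
  then have "\<Gamma> \<tturnstile>\<^bsub>D\<^esub> ?Q t"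
    by (rule entails_by_derives) (use assms(1) formulas typing in auto)
  then show ?thesis by simp
qed

lemma entails_defR:
  assumes definition_D: "is_definition D" and clause: "(p, ts, B) \<in> D" and \<sigma>: "is_subst \<sigma>"
    and "\<Gamma> \<tturnstile>\<^bsub>D\<^esub> subst \<sigma> B"
  shows "\<Gamma> \<tturnstile>\<^bsub>D\<^esub> patom p (map (subst \<sigma>) ts)"
proof -
  from assms(4) obtain \<Delta> where \<Delta>: "\<Delta> \<sqsubseteq> \<Gamma>" "derives D \<Delta> (subst \<sigma> B)"
    by (auto simp: entails_def)
  have "typed (patom p ts) To" using definition_D clause by (auto simp: is_definition_def)
  from has_type_subst[OF \<sigma> this] have typing: "typed (patom p (map (subst \<sigma>) ts)) To" by simp
  have "derives D \<Delta> (patom p (map (subst \<sigma>) ts))"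
    by (rule d_defR[OF \<Delta>(2) clause \<sigma>]) (use typing derives_wf_seq[OF \<Delta>(2)] in \<open>auto simp: wf_seq_def\<close>)
  then show ?thesis by (rule entailsI) (use \<Delta> typing in auto)
qed

lemma complete_unifiers_all: "complete_unifiers V t u {\<theta>. unifier \<theta> t u}"
  unfolding complete_unifiers_def
proof (intro conjI allI impI)
  fix \<sigma> assume "unifier \<sigma> t u"
  then show "\<exists>\<theta>\<in>{\<theta>. unifier \<theta> t u}. \<exists>\<rho>. is_subst \<rho> \<and> (\<forall>v\<in>V. \<sigma> v \<approx> subst \<rho> (\<theta> v))"
    by (intro bexI[of _ \<sigma>] exI[of _ Free]) auto
qed simp

text \<open>
  Using the set of all unifiers spares the computation of most general ones, at the price that
  every substitution instance of the conclusion has to be derived.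
\<close>

lemma derives_defL:
  assumes "p \<noteq> P_nat" "wf_seq (add_mset (patom p us) \<Delta>) C"
    and clause: "\<And>ts B \<theta> \<sigma>. (p, ts, B) \<in> D \<Longrightarrow> is_subst \<theta> \<Longrightarrow> is_subst \<sigma> \<Longrightarrow>
      patom p (map (subst \<theta>) us) \<approx> patom p (map (subst \<sigma>) ts) \<Longrightarrow>
      derives D (add_mset (subst \<sigma> B) (image_mset (subst \<theta>) \<Delta>)) (subst \<theta> C)"
  shows "derives D (add_mset (patom p us) \<Delta>) C"
proof (rule d_defL)
  fix ts B assume clause_D: "(p, ts, B) \<in> D"
  let ?V = "fv (patom p us) \<union> fvs \<Delta> \<union> fv C"
  obtain \<pi> where \<pi>: "is_renaming \<pi>" "range \<pi> \<inter> ?V = {}"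
    by (rule obtain_renaming_apart[of ?V]) (simp only: finite_Un finite_fv finite_fvs)
  let ?S = "{\<theta>. unifier \<theta> (patom p us) (rename \<pi> (patom p ts))}"
  have "derives D (add_mset (subst \<theta> (rename \<pi> B)) (image_mset (subst \<theta>) \<Delta>)) (subst \<theta> C)"
    if "\<theta> \<in> ?S" for \<theta>
  proof -
    have "is_subst (\<lambda>v. \<theta> (\<pi> v))"
      using that \<pi>(1)
      by (auto simp: unifier_def is_subst_def is_renaming_def) (metis prod.collapse snd_conv)
    with that have "derives D (add_mset (subst (\<lambda>v. \<theta> (\<pi> v)) B) (image_mset (subst \<theta>) \<Delta>)) (subst \<theta> C)"
      by (intro clause[OF clause_D]) (auto simp: unifier_def subst_rename)
    then show ?thesis by (simp add: subst_rename)
  qed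
  moreover have "fv (rename \<pi> (patom p ts)) \<inter> ?V = {}"
    using \<pi>(2) unfolding fv_rename by blast
  ultimately show "\<exists>\<pi> S. is_renaming \<pi> \<and> fv (rename \<pi> (patom p ts)) \<inter> ?V = {} \<and>
      complete_unifiers (fv (rename \<pi> (patom p ts)) \<union> fv (patom p us) \<union> fvs \<Delta> \<union> fv C)
        (patom p us) (rename \<pi> (patom p ts)) S \<and>
      (\<forall>\<theta>\<in>S. derives D (add_mset (subst \<theta> (rename \<pi> B)) (image_mset (subst \<theta>) \<Delta>)) (subst \<theta> C))"
    using \<pi>(1) complete_unifiers_all by (intro exI[of _ \<pi>] exI[of _ ?S]) blast
qed (use assms in auto)

text \<open>
  The hypotheses in \<open>\<Delta>\<close> have to be passed explicitly, as they are subject to the unifier, unlike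
  other facts about \<open>\<Gamma>\<close>.
\<close>

lemma entails_defL:
  assumes definition_D: "is_definition D" and "\<Gamma> \<tturnstile>\<^bsub>D\<^esub> patom p us" "p \<noteq> P_nat" "formula C"
    and \<Delta>: "\<forall>A\<in>#\<Delta>. \<Gamma> \<tturnstile>\<^bsub>D\<^esub> A"
    and clause: "\<And>\<Gamma> ts B \<theta> \<sigma>. (p, ts, B) \<in> D \<Longrightarrow> is_subst \<theta> \<Longrightarrow> is_subst \<sigma> \<Longrightarrow>
      patom p (map (subst \<theta>) us) \<approx> patom p (map (subst \<sigma>) ts) \<Longrightarrow> \<Gamma> \<tturnstile>\<^bsub>D\<^esub> subst \<sigma> B \<Longrightarrow>
      \<forall>A\<in>#\<Delta>. \<Gamma> \<tturnstile>\<^bsub>D\<^esub> subst \<theta> A \<Longrightarrow> \<Gamma> \<tturnstile>\<^bsub>D\<^esub> subst \<theta> C"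
  shows "\<Gamma> \<tturnstile>\<^bsub>D\<^esub> C"
proof (rule entails_by_derives)
  show "derives D (add_mset (patom p us) \<Delta>) C"
  proof (rule derives_defL)
    fix ts B \<theta> \<sigma>
    assume clause_D: "(p, ts, B) \<in> D" and \<theta>: "is_subst \<theta>" and \<sigma>: "is_subst \<sigma>"
      and unified: "patom p (map (subst \<theta>) us) \<approx> patom p (map (subst \<sigma>) ts)"
    let ?\<Gamma> = "add_mset (subst \<sigma> B) (image_mset (subst \<theta>) \<Delta>)"
    have formulas: "formula A" if "A \<in># ?\<Gamma>" for A
      using that formula_clause[OF definition_D clause_D] \<theta> \<sigma> \<Delta>
      by (auto intro: formula_subst dest: entails_formula)
    then have hyp: "?\<Gamma> \<tturnstile>\<^bsub>D\<^esub> A" if "A \<in># ?\<Gamma>" for A using that by (blast intro: entails_hyp)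
    have "?\<Gamma> \<tturnstile>\<^bsub>D\<^esub> subst \<theta> C" using hyp by (intro clause[OF clause_D \<theta> \<sigma> unified]) auto
    then show "derives D ?\<Gamma> (subst \<theta> C)" using formulas
      by (intro entails_derives) (auto intro: formula_typed)
  next
    show "wf_seq (add_mset (patom p us) \<Delta>) C"
      using assms(2,4) \<Delta> entails_formula formula_typed by (fastforce simp: wf_seq_def)
  qed (rule assms(3))
qed (use assms in auto)


section \<open>The clauses of the object logic\<close>

abbreviation entails_D_all :: "tm multiset \<Rightarrow> tm \<Rightarrow> bool"  ("_ \<tturnstile> _" [46, 46] 45) where
  "\<Gamma> \<tturnstile> C \<equiv> \<Gamma> \<tturnstile>\<^bsub>D_all\<^esub> C"

abbreviation element_fm :: "tm \<Rightarrow> tm \<Rightarrow> tm" where "element_fm X L \<equiv> patom P_element [X, L]"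
abbreviation Tii :: ty where "Tii \<equiv> Ti \<rightarrow>\<^sub>t Ti"
abbreviation Tip :: ty where "Tip \<equiv> Ti \<rightarrow>\<^sub>t Tprp"

lemmas lift_inst_typed [simp] =
  lift_typed[where \<Delta> = "[]" and T = Tnt, simplified] inst_typed[where \<Delta> = "[]" and T = Tnt, simplified]
  lift_typed[where \<Delta> = "[]" and T = Ti, simplified] inst_typed[where \<Delta> = "[]" and T = Ti, simplified]
  lift_typed[where \<Delta> = "[]" and T = Tatm, simplified] inst_typed[where \<Delta> = "[]" and T = Tatm, simplified]
  lift_typed[where \<Delta> = "[]" and T = Tprp, simplified] inst_typed[where \<Delta> = "[]" and T = Tprp, simplified]
  lift_typed[where \<Delta> = "[]" and T = Tlst, simplified] inst_typed[where \<Delta> = "[]" and T = Tlst, simplified]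
  lift_typed[where \<Delta> = "[]" and T = Tii, simplified] inst_typed[where \<Delta> = "[]" and T = Tii, simplified]
  lift_typed[where \<Delta> = "[]" and T = Tip, simplified] inst_typed[where \<Delta> = "[]" and T = Tip, simplified]

declare has_type_simps(1,2,3,5) [simp]

lemma has_type_Cst_app [simp]:
  "has_type \<Delta> (Cst c \<cdot> t) U \<longleftrightarrow> (\<exists>T. cst_type c = T \<rightarrow>\<^sub>t U \<and> cst_ok c \<and> has_type \<Delta> t T)"
  "has_type \<Delta> (Cst c \<cdot> t \<cdot> u) V \<longleftrightarrow>
    (\<exists>T U. cst_type c = T \<rightarrow>\<^sub>t U \<rightarrow>\<^sub>t V \<and> cst_ok c \<and> has_type \<Delta> t T \<and> has_type \<Delta> u U)"
  by (auto simp: has_type_simps) metis+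

lemma typed_weaken_Cons [simp]: "typed t T \<Longrightarrow> has_type (U # \<Delta>) t T"
  by (rule typed_weaken)

lemma has_type_app_Ti [simp]:
  "has_type \<Delta> r Tii \<Longrightarrow> has_type \<Delta> n Ti \<Longrightarrow> has_type \<Delta> (r \<cdot> n) Ti"
  "has_type \<Delta> f Tip \<Longrightarrow> has_type \<Delta> n Ti \<Longrightarrow> has_type \<Delta> (f \<cdot> n) Tprp"
  by (auto simp: has_type_simps(4))

lemma typed_subst [simp]:
  "is_subst \<theta> \<Longrightarrow> typed t T \<Longrightarrow> typed (subst \<theta> t) T"
  "is_subst \<theta> \<Longrightarrow> o_free T \<Longrightarrow> typed (\<theta> (x, T)) T"
  by (auto simp: has_type_subst is_subst_def)

lemma entails_typed [dest]:
  "\<Gamma> \<tturnstile> nat_fm i \<Longrightarrow> typed i Tnt"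
  "\<Gamma> \<tturnstile> element_fm x l \<Longrightarrow> typed x Tatm \<and> typed l Tlst"
  "\<Gamma> \<tturnstile> seq_fm i l b \<Longrightarrow> typed i Tnt \<and> typed l Tlst \<and> typed b Tprp"
  "\<Gamma> \<tturnstile> prog_fm a g \<Longrightarrow> typed a Tatm \<and> typed g Tprp"
  "\<Gamma> \<tturnstile> m \<^bold>\<equiv> n \<Longrightarrow> typed m Ti \<and> typed n Ti"
  by (auto dest: entails_formula)

lemma seq_conv:
  "\<Gamma> \<tturnstile> seq_fm i l b \<Longrightarrow> i \<approx> i' \<Longrightarrow> l \<approx> l' \<Longrightarrow> b \<approx> b' \<Longrightarrow>
    typed i' Tnt \<Longrightarrow> typed l' Tlst \<Longrightarrow> typed b' Tprp \<Longrightarrow> \<Gamma> \<tturnstile> seq_fm i' l' b'"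
  by (erule entails_patom_conv) auto

lemma seq_conv_right: "\<Gamma> \<tturnstile> seq_fm i l b \<Longrightarrow> b \<approx> b' \<Longrightarrow> typed b' Tprp \<Longrightarrow> \<Gamma> \<tturnstile> seq_fm i l b'"
  by (frule entails_typed(3), erule seq_conv) auto

lemma D_all_clause_iff:
  "(P_seq, ts, B) \<in> D_all \<longleftrightarrow> (P_seq, ts, B) \<in> D_intuit"
  "(P_element, ts, B) \<in> D_all \<longleftrightarrow> (P_element, ts, B) \<in> D_list"
  "(P_prog, ts, B) \<in> D_all \<longleftrightarrow> (P_prog, ts, B) \<in> D_lambda"
  "(P_equiv, ts, B) \<in> D_all \<longleftrightarrow> (P_equiv, ts, B) \<in> D_equiv"
  by (auto simp: D_all_def D_nat_def D_list_def D_intuit_def D_lambda_def D_equiv_def Let_def)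

lemmas clause_simps = D_all_clause_iff D_intuit_def D_list_def D_lambda_def D_equiv_def
  Let_def all_fm_def ex_fm_def lam_def

lemmas defR = entails_defR[OF is_definition_D_all]
lemmas defL = entails_defL[OF is_definition_D_all]

lemma equivI: "typed m Ti \<Longrightarrow> typed n Ti \<Longrightarrow> m \<approx> n \<Longrightarrow> \<Gamma> \<tturnstile> m \<^bold>\<equiv> n"
proof -
  assume typing: "typed m Ti" "typed n Ti" and "m \<approx> n"
  have "\<Gamma> \<tturnstile> m \<^bold>\<equiv> m"
    using defR[of P_equiv "[Free (0, Ti), Free (0, Ti)]" "\<^bold>\<top>" "Free((0, Ti) := m)"] typing
    by (simp add: clause_simps entails_topI)
  then show ?thesis by (rule entails_patom_conv) (use typing \<open>m \<approx> n\<close> in auto)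
qed

lemma equiv_defL:
  assumes "\<Gamma> \<tturnstile> m \<^bold>\<equiv> n" "formula C" "\<forall>A\<in>#\<Delta>. \<Gamma> \<tturnstile> A"
    and unified: "\<And>\<Gamma> \<theta>. is_subst \<theta> \<Longrightarrow> subst \<theta> m \<approx> subst \<theta> n \<Longrightarrow>
      \<forall>A\<in>#\<Delta>. \<Gamma> \<tturnstile> subst \<theta> A \<Longrightarrow> \<Gamma> \<tturnstile> subst \<theta> C"
  shows "\<Gamma> \<tturnstile> C"
proof (rule defL[OF assms(1) _ assms(2,3)])
  fix \<Gamma> ts B \<theta> \<sigma>
  assume "(P_equiv, ts, B) \<in> D_all" "is_subst \<theta>" "\<forall>A\<in>#\<Delta>. \<Gamma> \<tturnstile> subst \<theta> A"
    "patom P_equiv (map (subst \<theta>) [m, n]) \<approx> patom P_equiv (map (subst \<sigma>) ts)"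
  then show "\<Gamma> \<tturnstile> subst \<theta> C"
    by (intro unified) (auto simp: clause_simps intro: conv_trans conv_sym)
qed simp

lemma equiv_subst:
  assumes "\<Gamma> \<tturnstile> m \<^bold>\<equiv> n" "\<Gamma> \<tturnstile> P m" "predicate Ti P"
  shows "\<Gamma> \<tturnstile> P n"
proof -
  have typing: "typed m Ti" "typed n Ti" using assms(1) by auto
  show ?thesis
  proof (rule equiv_defL[OF assms(1), where \<Delta> = "{#P m#}"])
    fix \<Gamma> \<theta>
    assume \<theta>: "is_subst \<theta>" and mn: "subst \<theta> m \<approx> subst \<theta> n" and "\<forall>A\<in>#{#P m#}. \<Gamma> \<tturnstile> subst \<theta> A"
    have "subst \<theta> (P m) \<approx> subst \<theta> (P n)"
      using assms(3) \<theta> typing mn by (rule predicate_subst_conv)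
    moreover have "formula (subst \<theta> (P n))"
      using predicate_formula[OF assms(3) typing(2)] \<theta> by (rule formula_subst)
    ultimately show "\<Gamma> \<tturnstile> subst \<theta> (P n)" using \<open>\<forall>A\<in>#{#P m#}. _\<close> by (auto intro: entails_conv)
  qed (use assms predicate_formula typing in auto)
qed

lemma element_headI:
  assumes "typed a Tatm" "typed l Tlst"
  shows "\<Gamma> \<tturnstile> element_fm a (a \<^bold># l)"
  using assms defR[of P_element "[Free (0, Tatm), Free (0, Tatm) \<^bold># Free (0, Tlst)]" "\<^bold>\<top>"
      "Free((0, Tatm) := a, (0, Tlst) := l)"]
  by (simp add: clause_simps entails_topI)

lemma element_tailI:
  assumes "\<Gamma> \<tturnstile> element_fm a l" "typed c Tatm"
  shows "\<Gamma> \<tturnstile> element_fm a (c \<^bold># l)"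
  using assms entails_typed(2)[OF assms(1)]
    defR[of P_element "[Free (0, Tatm), Free (1, Tatm) \<^bold># Free (0, Tlst)]"
      "element_fm (Free (0, Tatm)) (Free (0, Tlst))"
      "Free((0, Tatm) := a, (1, Tatm) := c, (0, Tlst) := l)"]
  by (simp add: clause_simps)

lemma element_defL:
  assumes "\<Gamma> \<tturnstile> element_fm x l" "formula C" "\<forall>A\<in>#\<Delta>. \<Gamma> \<tturnstile> A"
    and head: "\<And>\<Gamma> \<theta> k. is_subst \<theta> \<Longrightarrow> typed k Tlst \<Longrightarrow> subst \<theta> l \<approx> subst \<theta> x \<^bold># k \<Longrightarrow>
      \<forall>A\<in>#\<Delta>. \<Gamma> \<tturnstile> subst \<theta> A \<Longrightarrow> \<Gamma> \<tturnstile> subst \<theta> C"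
    and tail: "\<And>\<Gamma> \<theta> y k. is_subst \<theta> \<Longrightarrow> typed y Tatm \<Longrightarrow> subst \<theta> l \<approx> y \<^bold># k \<Longrightarrow>
      \<Gamma> \<tturnstile> element_fm (subst \<theta> x) k \<Longrightarrow> \<forall>A\<in>#\<Delta>. \<Gamma> \<tturnstile> subst \<theta> A \<Longrightarrow> \<Gamma> \<tturnstile> subst \<theta> C"
  shows "\<Gamma> \<tturnstile> C"
proof (rule defL[OF assms(1) _ assms(2,3)])
  fix \<Gamma> ts B \<theta> \<sigma>
  assume "(P_element, ts, B) \<in> D_all" and \<theta>: "is_subst \<theta>" and \<sigma>: "is_subst \<sigma>"
    and unified: "patom P_element (map (subst \<theta>) [x, l]) \<approx> patom P_element (map (subst \<sigma>) ts)"
    and body: "\<Gamma> \<tturnstile> subst \<sigma> B" and \<Delta>: "\<forall>A\<in>#\<Delta>. \<Gamma> \<tturnstile> subst \<theta> A"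
  then consider
      (head) "subst \<theta> x \<approx> \<sigma> (0, Tatm)" "subst \<theta> l \<approx> \<sigma> (0, Tatm) \<^bold># \<sigma> (0, Tlst)"
    | (tail) "subst \<theta> x \<approx> \<sigma> (0, Tatm)" "subst \<theta> l \<approx> \<sigma> (1, Tatm) \<^bold># \<sigma> (0, Tlst)"
        "\<Gamma> \<tturnstile> element_fm (\<sigma> (0, Tatm)) (\<sigma> (0, Tlst))"
    by (auto simp: clause_simps)
  then show "\<Gamma> \<tturnstile> subst \<theta> C"
  proof cases
    case head
    then have "subst \<theta> l \<approx> subst \<theta> x \<^bold># \<sigma> (0, Tlst)"
      by (meson conv_app conv_refl conv_sym conv_trans)
    then show ?thesis using \<sigma> \<Delta> by (intro assms(4)[OF \<theta>]) auto
  next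
    case tail
    then have "\<Gamma> \<tturnstile> element_fm (subst \<theta> x) (\<sigma> (0, Tlst))"
      using \<theta> \<sigma> entails_typed(2)[OF assms(1)] by (auto elim!: entails_patom_conv intro: conv_sym)
    then show ?thesis using tail \<sigma> \<Delta> by (intro assms(5)[OF \<theta>]) auto
  qed
qed simp

lemma element_nilE: "\<Gamma> \<tturnstile> element_fm x nil_tm \<Longrightarrow> formula C \<Longrightarrow> \<Gamma> \<tturnstile> C"
  by (rule entails_botE, rule element_defL[where \<Delta> = "{#}"]) auto

lemma element_ConsE:
  assumes "\<Gamma> \<tturnstile> element_fm x (a \<^bold># l)" and pred_P: "predicate Tatm P"
    and head: "\<Gamma> \<tturnstile> P a"
    and tail: "\<And>\<Gamma>'. \<Gamma> \<sqsubseteq> \<Gamma>' \<Longrightarrow> \<Gamma>' \<tturnstile> element_fm x l \<Longrightarrow> \<Gamma>' \<tturnstile> P x"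
  shows "\<Gamma> \<tturnstile> P x"
proof -
  have typing: "typed x Tatm" "typed a Tatm" "typed l Tlst"
    using entails_typed(2)[OF assms(1)] by auto
  then have formulas: "formula (P x)" using pred_P by (simp add: predicate_formula)
  let ?\<Delta> = "{#P a, element_fm x l \<^bold>\<supset> P x#}"
  show ?thesis
  proof (rule element_defL[OF assms(1) formulas, where \<Delta> = ?\<Delta>])
    show "\<forall>A\<in>#?\<Delta>. \<Gamma> \<tturnstile> A" using head tail typing by (auto intro!: entails_impI)
  next
    fix \<Gamma> \<theta> k
    assume \<theta>: "is_subst \<theta>" and l: "subst \<theta> (a \<^bold># l) \<approx> subst \<theta> x \<^bold># k"
      and \<Delta>: "\<forall>A\<in>#?\<Delta>. \<Gamma> \<tturnstile> subst \<theta> A"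
    have "subst \<theta> (P a) \<approx> subst \<theta> (P x)"
      using pred_P \<theta> typing(2,1) by (rule predicate_subst_conv) (use l in simp)
    then show "\<Gamma> \<tturnstile> subst \<theta> (P x)"
      using \<Delta> formula_subst[OF formulas \<theta>] by (auto intro: entails_conv)
  next
    fix \<Gamma> \<theta> y k
    assume \<theta>: "is_subst \<theta>" and l: "subst \<theta> (a \<^bold># l) \<approx> y \<^bold># k"
      and "\<Gamma> \<tturnstile> element_fm (subst \<theta> x) k" and \<Delta>: "\<forall>A\<in>#?\<Delta>. \<Gamma> \<tturnstile> subst \<theta> A"
    then have "\<Gamma> \<tturnstile> element_fm (subst \<theta> x) (subst \<theta> l)"
      using typing by (auto elim!: entails_patom_conv intro: conv_sym)
    then show "\<Gamma> \<tturnstile> subst \<theta> (P x)" using \<Delta> by (auto intro: entails_mp)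
  qed
qed

text \<open>
  Only \<open>b\<close> is taken up to conversion; conversions of the height and the context are absorbed by the
  entailed bodies.
\<close>

inductive seq_clause :: "tm multiset \<Rightarrow> tm \<Rightarrow> tm \<Rightarrow> tm \<Rightarrow> bool" for \<Gamma> where
  element: "b \<approx> \<^bold>\<langle>a\<^bold>\<rangle> \<Longrightarrow> \<Gamma> \<tturnstile> element_fm a l \<Longrightarrow> typed i Tnt \<Longrightarrow> seq_clause \<Gamma> i l b"
| tt: "b \<approx> tt_tm \<Longrightarrow> typed i Tnt \<Longrightarrow> typed l Tlst \<Longrightarrow> seq_clause \<Gamma> i l b"
| amp: "b \<approx> c \<^bold>& d \<Longrightarrow> \<Gamma> \<tturnstile> seq_fm i l c \<Longrightarrow> \<Gamma> \<tturnstile> seq_fm i l d \<Longrightarrow> seq_clause \<Gamma> (suc_tm i) l b"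
| imp: "b \<approx> a \<^bold>\<Rightarrow> c \<Longrightarrow> \<Gamma> \<tturnstile> seq_fm i (a \<^bold># l) c \<Longrightarrow> seq_clause \<Gamma> (suc_tm i) l b"
| all: "b \<approx> \<^bold>\<And> f \<Longrightarrow> typed f Tip \<Longrightarrow> typed i Tnt \<Longrightarrow> typed l Tlst \<Longrightarrow>
    (\<And>x. typed x Ti \<Longrightarrow> \<Gamma> \<tturnstile> seq_fm i l (f \<cdot> x)) \<Longrightarrow> seq_clause \<Gamma> (suc_tm i) l b"
| prog: "b \<approx> \<^bold>\<langle>a\<^bold>\<rangle> \<Longrightarrow> \<Gamma> \<tturnstile> prog_fm a g \<Longrightarrow> \<Gamma> \<tturnstile> seq_fm i l g \<Longrightarrow> seq_clause \<Gamma> (suc_tm i) l b"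

lemma seq_elementI:
  assumes "\<Gamma> \<tturnstile> element_fm a l" "typed i Tnt"
  shows "\<Gamma> \<tturnstile> seq_fm i l \<^bold>\<langle>a\<^bold>\<rangle>"
proof -
  have Cons: "\<Gamma> \<tturnstile> seq_fm i l \<^bold>\<langle>a\<^bold>\<rangle>"
    if "\<Gamma> \<tturnstile> element_fm a (c \<^bold># k)" "l \<approx> c \<^bold># k" "typed l Tlst" "typed i Tnt" for \<Gamma> i l a c k
  proof -
    have typing: "typed a Tatm" "typed c Tatm" "typed k Tlst" using that(1) by auto
    have "\<Gamma> \<tturnstile> seq_fm i (c \<^bold># k) \<^bold>\<langle>a\<^bold>\<rangle>"
      using that typing
        defR[of P_seq "[Free (0, Tnt), Free (1, Tatm) \<^bold># Free (0, Tlst), \<^bold>\<langle>Free (0, Tatm)\<^bold>\<rangle>]"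
          "element_fm (Free (0, Tatm)) (Free (1, Tatm) \<^bold># Free (0, Tlst))"
          "Free((0, Tatm) := a, (1, Tatm) := c, (0, Tlst) := k, (0, Tnt) := i)"]
      by (simp add: clause_simps)
    then show ?thesis by (rule seq_conv) (use that typing in \<open>auto intro: conv_sym\<close>)
  qed
  have typing: "typed a Tatm" "typed l Tlst" using assms(1) by auto
  show ?thesis
  proof (rule element_defL[OF assms(1), where \<Delta> = "{#}"])
    show "formula (seq_fm i l \<^bold>\<langle>a\<^bold>\<rangle>)" using typing assms(2) by simp
  next
    fix \<Gamma> \<theta> k assume "is_subst \<theta>" "typed k Tlst" "subst \<theta> l \<approx> subst \<theta> a \<^bold># k"
    then show "\<Gamma> \<tturnstile> subst \<theta> (seq_fm i l \<^bold>\<langle>a\<^bold>\<rangle>)"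
      using Cons[OF element_headI] typing assms(2) by simp
  next
    fix \<Gamma> \<theta> y k
    assume "is_subst \<theta>" "typed y Tatm" "subst \<theta> l \<approx> y \<^bold># k" "\<Gamma> \<tturnstile> element_fm (subst \<theta> a) k"
    then show "\<Gamma> \<tturnstile> subst \<theta> (seq_fm i l \<^bold>\<langle>a\<^bold>\<rangle>)"
      using Cons[OF element_tailI] typing assms(2) by simp
  qed simp
qed

lemma seq_ttI: "typed i Tnt \<Longrightarrow> typed l Tlst \<Longrightarrow> \<Gamma> \<tturnstile> seq_fm i l tt_tm"
  using defR[of P_seq "[Free (0, Tnt), Free (0, Tlst), tt_tm]" "\<^bold>\<top>"
      "Free((0, Tnt) := i, (0, Tlst) := l)"]
  by (simp add: clause_simps entails_topI)

lemma seq_ampI: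
  assumes "\<Gamma> \<tturnstile> seq_fm i l b" "\<Gamma> \<tturnstile> seq_fm i l c"
  shows "\<Gamma> \<tturnstile> seq_fm (suc_tm i) l (b \<^bold>& c)"
  using assms entails_typed(3)[OF assms(1)] entails_typed(3)[OF assms(2)]
    defR[of P_seq "[suc_tm (Free (0, Tnt)), Free (0, Tlst), Free (0, Tprp) \<^bold>& Free (1, Tprp)]"
      "seq_fm (Free (0, Tnt)) (Free (0, Tlst)) (Free (0, Tprp)) \<^bold>\<and>
        seq_fm (Free (0, Tnt)) (Free (0, Tlst)) (Free (1, Tprp))"
      "Free((0, Tnt) := i, (0, Tlst) := l, (0, Tprp) := b, (1, Tprp) := c)"]
  by (simp add: clause_simps)

lemma seq_impI:
  assumes "\<Gamma> \<tturnstile> seq_fm i (a \<^bold># l) b"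
  shows "\<Gamma> \<tturnstile> seq_fm (suc_tm i) l (a \<^bold>\<Rightarrow> b)"
  using assms entails_typed(3)[OF assms]
    defR[of P_seq "[suc_tm (Free (0, Tnt)), Free (0, Tlst), Free (0, Tatm) \<^bold>\<Rightarrow> Free (0, Tprp)]"
      "seq_fm (Free (0, Tnt)) (Free (0, Tatm) \<^bold># Free (0, Tlst)) (Free (0, Tprp))"
      "Free((0, Tnt) := i, (0, Tlst) := l, (0, Tprp) := b, (0, Tatm) := a)"]
  by (simp add: clause_simps)

lemma seq_allI:
  assumes "\<And>x. typed x Ti \<Longrightarrow> \<Gamma> \<tturnstile> seq_fm i l (f \<cdot> x)" "typed i Tnt" "typed l Tlst" "typed f Tip"
  shows "\<Gamma> \<tturnstile> seq_fm (suc_tm i) l (\<^bold>\<And> f)"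
  using assms
    defR[of P_seq "[suc_tm (Free (0, Tnt)), Free (0, Tlst), \<^bold>\<And> (Free (0, Tip))]"
      "Forall Ti (seq_fm (Free (0, Tnt)) (Free (0, Tlst)) (Free (0, Tip) \<cdot> Bnd 0))"
      "Free((0, Tnt) := i, (0, Tlst) := l, (0, Tip) := f)"]
  by (simp add: clause_simps entails_all_iff)

lemma seq_progI:
  assumes "\<Gamma> \<tturnstile> prog_fm a g" "\<Gamma> \<tturnstile> seq_fm i l g"
  shows "\<Gamma> \<tturnstile> seq_fm (suc_tm i) l \<^bold>\<langle>a\<^bold>\<rangle>"
proof -
  let ?\<sigma> = "Free((0, Tnt) := i, (0, Tlst) := l, (0, Tatm) := a)"
  let ?B = "Exists Tprp (prog_fm (Free (0, Tatm)) (Bnd 0) \<^bold>\<and>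
    seq_fm (Free (0, Tnt)) (Free (0, Tlst)) (Bnd 0))"
  have typing: "typed i Tnt" "typed l Tlst" "typed a Tatm" "typed g Tprp" using assms by auto
  have "\<Gamma> \<tturnstile> subst ?\<sigma> ?B" using assms typing by (auto intro!: entails_exI[where t = g])
  then show ?thesis
    using defR[of P_seq "[suc_tm (Free (0, Tnt)), Free (0, Tlst), \<^bold>\<langle>Free (0, Tatm)\<^bold>\<rangle>]" ?B ?\<sigma>] typing
    by (simp add: clause_simps)
qed

lemma seq_clause_imp_seq:
  assumes "seq_clause \<Gamma> i l b" "typed b Tprp"
  shows "\<Gamma> \<tturnstile> seq_fm i l b"
  using assms(1)
proof cases
  case (element a)
  show ?thesis by (rule seq_conv[OF seq_elementI]) (use element assms(2) in \<open>auto intro: conv_sym\<close>)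
next
  case tt
  show ?thesis by (rule seq_conv[OF seq_ttI]) (use tt assms(2) in \<open>auto intro: conv_sym\<close>)
next
  case (amp c d j)
  show ?thesis unfolding amp(1)
    by (rule seq_conv[OF seq_ampI[where b = c and c = d]])
      (use amp assms(2) in \<open>auto intro: conv_sym\<close>)
next
  case (imp a c j)
  show ?thesis unfolding imp(1)
    by (rule seq_conv[OF seq_impI]) (use imp assms(2) in \<open>auto intro: conv_sym\<close>)
next
  case (all f j)
  show ?thesis unfolding all(1)
    by (rule seq_conv[OF seq_allI]) (use all assms(2) in \<open>auto intro: conv_sym\<close>)
next
  case (prog a g j)
  show ?thesis unfolding prog(1)
    by (rule seq_conv[OF seq_progI]) (use prog assms(2) in \<open>auto intro: conv_sym\<close>)
qed

lemma seq_clause_conv: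
  assumes "seq_clause \<Gamma> i l' b'" "l' \<approx> l" "typed l Tlst" "b \<approx> b'"
  shows "seq_clause \<Gamma> i l b"
proof -
  have seq: "\<Gamma> \<tturnstile> seq_fm j l c" if "\<Gamma> \<tturnstile> seq_fm j l' c" for j c
    using seq_conv[OF that conv_refl assms(2) conv_refl] entails_typed(3)[OF that] assms(3) by simp
  from assms(1) show ?thesis
  proof cases
    case (element a)
    have "\<Gamma> \<tturnstile> element_fm a l"
      by (rule entails_patom_conv[OF element(2)])
        (use assms(2,3) entails_typed(2)[OF element(2)] in auto)
    with conv_trans[OF assms(4) element(1)] show ?thesis using element(3) by (rule seq_clause.element)
  next
    case tt
    with conv_trans[OF assms(4) tt(1)] show ?thesis using assms(3) by (intro seq_clause.tt)
  next
    case (amp c d j)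
    from conv_trans[OF assms(4) amp(2)] seq[OF amp(3)] seq[OF amp(4)]
    show ?thesis unfolding amp(1) by (rule seq_clause.amp)
  next
    case (imp a c j)
    have "\<Gamma> \<tturnstile> seq_fm j (a \<^bold># l) c"
      by (rule seq_conv[OF imp(3)]) (use assms(2,3) entails_typed(3)[OF imp(3)] in auto)
    with conv_trans[OF assms(4) imp(2)] show ?thesis unfolding imp(1) by (rule seq_clause.imp)
  next
    case (all f j)
    have "\<Gamma> \<tturnstile> seq_fm j l (f \<cdot> x)" if "typed x Ti" for x using all(6)[OF that] by (rule seq)
    with conv_trans[OF assms(4) all(2)] all(3,4) assms(3) show ?thesis
      unfolding all(1) by (rule seq_clause.all)
  next
    case (prog a g j)
    from conv_trans[OF assms(4) prog(2)] prog(3) seq[OF prog(4)]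
    show ?thesis unfolding prog(1) by (rule seq_clause.prog)
  qed
qed

lemma seq_clause_conv_height:
  assumes "seq_clause \<Gamma> i' l b" "i \<approx> i'" "typed i Tnt" and rigid: "i = zero_tm \<or> i \<in> range suc_tm"
  shows "seq_clause \<Gamma> i l b"
proof -
  have suc: "P i" if "i' = suc_tm j"
    and "\<And>k. typed k Tnt \<Longrightarrow> (\<And>l c. \<Gamma> \<tturnstile> seq_fm j l c \<Longrightarrow> \<Gamma> \<tturnstile> seq_fm k l c) \<Longrightarrow> P (suc_tm k)" for P j
  proof -
    from rigid assms(2,3) \<open>i' = suc_tm j\<close> obtain k where k: "i = suc_tm k" "k \<approx> j" "typed k Tnt"
      by auto
    have "\<Gamma> \<tturnstile> seq_fm k l c" if "\<Gamma> \<tturnstile> seq_fm j l c" for l c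
      using seq_conv[OF that conv_sym[OF k(2)] conv_refl conv_refl k(3)] entails_typed(3)[OF that]
      by simp
    with k that(2) show "P i" by simp
  qed
  from assms(1) show ?thesis
  proof cases
    case (amp c d j)
    show ?thesis using amp(1) by (rule suc) (use amp in \<open>auto intro: seq_clause.amp\<close>)
  next
    case (imp a c j)
    show ?thesis using imp(1) by (rule suc) (use imp in \<open>auto intro: seq_clause.imp\<close>)
  next
    case (all f j)
    show ?thesis using all(1) by (rule suc) (use all in \<open>auto intro: seq_clause.all\<close>)
  next
    case (prog a g j)
    show ?thesis using prog(1) by (rule suc) (use prog in \<open>auto intro: seq_clause.prog\<close>)
  qed (use assms(3) in \<open>auto intro: seq_clause.element seq_clause.tt\<close>)
qed

lemma D_all_seq_clauseE:
  assumes "(P_seq, ts, B) \<in> D_all" and \<sigma>: "is_subst \<sigma>" and "\<Gamma> \<tturnstile> subst \<sigma> B"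
    and continuation: "\<And>\<Gamma>' i l b. \<Gamma> \<sqsubseteq> \<Gamma>' \<Longrightarrow> map (subst \<sigma>) ts = [i, l, b] \<Longrightarrow>
      seq_clause \<Gamma>' i l b \<Longrightarrow> \<Gamma>' \<tturnstile> C"
  shows "\<Gamma> \<tturnstile> C"
proof -
  let ?I = "\<sigma> (0, Tnt)" and ?L = "\<sigma> (0, Tlst)" and ?A = "\<sigma> (0, Tatm)" and ?A' = "\<sigma> (1, Tatm)"
    and ?B = "\<sigma> (0, Tprp)" and ?C = "\<sigma> (1, Tprp)" and ?F = "\<sigma> (0, Tip)"
  from assms(1,3) consider
      (element) "map (subst \<sigma>) ts = [?I, ?A' \<^bold># ?L, \<^bold>\<langle>?A\<^bold>\<rangle>]" "\<Gamma> \<tturnstile> element_fm ?A (?A' \<^bold># ?L)"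
    | (tt) "map (subst \<sigma>) ts = [?I, ?L, tt_tm]"
    | (amp) "map (subst \<sigma>) ts = [suc_tm ?I, ?L, ?B \<^bold>& ?C]" "\<Gamma> \<tturnstile> seq_fm ?I ?L ?B" "\<Gamma> \<tturnstile> seq_fm ?I ?L ?C"
    | (imp) "map (subst \<sigma>) ts = [suc_tm ?I, ?L, ?A \<^bold>\<Rightarrow> ?B]" "\<Gamma> \<tturnstile> seq_fm ?I (?A \<^bold># ?L) ?B"
    | (all) "map (subst \<sigma>) ts = [suc_tm ?I, ?L, \<^bold>\<And> ?F]" "\<Gamma> \<tturnstile> Forall Ti (seq_fm ?I ?L (?F \<cdot> Bnd 0))"
    | (prog) "map (subst \<sigma>) ts = [suc_tm ?I, ?L, \<^bold>\<langle>?A\<^bold>\<rangle>]"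
        "\<Gamma> \<tturnstile> Exists Tprp (prog_fm ?A (Bnd 0) \<^bold>\<and> seq_fm ?I ?L (Bnd 0))"
    by (auto simp: clause_simps)
  then show ?thesis
  proof cases
    case element
    show ?thesis by (rule continuation[OF _ element(1) seq_clause.element]) (use \<sigma> element in auto)
  next
    case tt
    show ?thesis by (rule continuation[OF _ tt seq_clause.tt]) (use \<sigma> in auto)
  next
    case amp
    show ?thesis by (rule continuation[OF _ amp(1) seq_clause.amp[OF conv_refl amp(2,3)]]) simp
  next
    case imp
    show ?thesis by (rule continuation[OF _ imp(1) seq_clause.imp[OF conv_refl imp(2)]]) simp
  next
    case all
    have "\<Gamma> \<tturnstile> seq_fm ?I ?L (?F \<cdot> x)" if "typed x Ti" for x
      using entails_allE[OF all(2) that] \<sigma> by simp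
    then show ?thesis
      by (intro continuation[OF _ all(1)] seq_clause.all[OF conv_refl]) (use \<sigma> in auto)
  next
    case prog
    from prog(2) show ?thesis
    proof (rule entails_exE)
      fix \<Gamma>' g assume "\<Gamma> \<sqsubseteq> \<Gamma>'" "typed g Tprp"
        "\<Gamma>' \<tturnstile> inst (prog_fm ?A (Bnd 0) \<^bold>\<and> seq_fm ?I ?L (Bnd 0)) 0 g"
      then show "\<Gamma>' \<tturnstile> C"
        by (intro continuation[OF _ prog(1)] seq_clause.prog[OF conv_refl, of _ _ g]) (use \<sigma> in auto)
    qed
  qed
qed

lemma seq_defL:
  assumes seq: "\<Gamma> \<tturnstile> seq_fm i l b" and rigid: "i = zero_tm \<or> i \<in> range suc_tm"
    and "formula C" "\<forall>A\<in>#\<Delta>. \<Gamma> \<tturnstile> A"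
    and clause: "\<And>\<Gamma> \<theta>. is_subst \<theta> \<Longrightarrow> seq_clause \<Gamma> (subst \<theta> i) (subst \<theta> l) (subst \<theta> b) \<Longrightarrow>
      \<forall>A\<in>#\<Delta>. \<Gamma> \<tturnstile> subst \<theta> A \<Longrightarrow> \<Gamma> \<tturnstile> subst \<theta> C"
  shows "\<Gamma> \<tturnstile> C"
proof (rule defL[OF seq _ assms(3,4)])
  fix \<Gamma> ts B \<theta> \<sigma>
  assume \<theta>: "is_subst \<theta>" and \<Delta>: "\<forall>A\<in>#\<Delta>. \<Gamma> \<tturnstile> subst \<theta> A"
    and heads: "patom P_seq (map (subst \<theta>) [i, l, b]) \<approx> patom P_seq (map (subst \<sigma>) ts)"
    and "(P_seq, ts, B) \<in> D_all" "is_subst \<sigma>" "\<Gamma> \<tturnstile> subst \<sigma> B"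
  from this(4-6) show "\<Gamma> \<tturnstile> subst \<theta> C"
  proof (rule D_all_seq_clauseE)
    fix \<Gamma>' i' l' b' assume \<Gamma>': "\<Gamma> \<sqsubseteq> \<Gamma>'" and "map (subst \<sigma>) ts = [i', l', b']" "seq_clause \<Gamma>' i' l' b'"
    have "seq_clause \<Gamma>' (subst \<theta> i) (subst \<theta> l) (subst \<theta> b)"
    proof (rule seq_clause_conv_height[OF seq_clause_conv])
      show "seq_clause \<Gamma>' i' l' b'" by fact
    qed (use heads \<open>map (subst \<sigma>) ts = _\<close> \<theta> entails_typed(3)[OF seq] rigid in \<open>auto intro: conv_sym\<close>)
    with \<theta> show "\<Gamma>' \<tturnstile> subst \<theta> C" using \<Delta> \<Gamma>' by (intro clause) (auto intro: entails_mono)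
  qed
qed simp

inductive prog_clause :: "tm \<Rightarrow> tm \<Rightarrow> bool" where
  typeof_abs: "typed r Tii \<Longrightarrow> typed t Ti \<Longrightarrow> typed u Ti \<Longrightarrow>
    prog_clause (typeof_tm (abs_tm r) (arr_tm t u))
      (\<^bold>\<And> (Lam (typeof_tm (Bnd 0) t \<^bold>\<Rightarrow> \<^bold>\<langle>typeof_tm (r \<cdot> Bnd 0) u\<^bold>\<rangle>)))"
| typeof_app: "typed m Ti \<Longrightarrow> typed n Ti \<Longrightarrow> typed t Ti \<Longrightarrow> typed u Ti \<Longrightarrow>
    prog_clause (typeof_tm (app_tm m n) t) (\<^bold>\<langle>typeof_tm m (arr_tm u t)\<^bold>\<rangle> \<^bold>& \<^bold>\<langle>typeof_tm n u\<^bold>\<rangle>)"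
| eval_abs: "typed r Tii \<Longrightarrow> prog_clause (abs_tm r \<^bold>\<Down> abs_tm r) tt_tm"
| eval_app: "typed m Ti \<Longrightarrow> typed n Ti \<Longrightarrow> typed v Ti \<Longrightarrow> typed r Tii \<Longrightarrow>
    prog_clause (app_tm m n \<^bold>\<Down> v) (\<^bold>\<langle>m \<^bold>\<Down> abs_tm r\<^bold>\<rangle> \<^bold>& \<^bold>\<langle>(r \<cdot> n) \<^bold>\<Down> v\<^bold>\<rangle>)"
| red_beta: "typed r Tii \<Longrightarrow> typed n Ti \<Longrightarrow> prog_clause (app_tm (abs_tm r) n \<^bold>\<leadsto> (r \<cdot> n)) tt_tm"
| red_app: "typed m Ti \<Longrightarrow> typed n Ti \<Longrightarrow> typed m' Ti \<Longrightarrow>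
    prog_clause (app_tm m n \<^bold>\<leadsto> app_tm m' n) \<^bold>\<langle>m \<^bold>\<leadsto> m'\<^bold>\<rangle>"
| reds_refl: "typed m Ti \<Longrightarrow> prog_clause (m \<^bold>\<leadsto>\<^sup>* m) tt_tm"
| reds_step: "typed m Ti \<Longrightarrow> typed n Ti \<Longrightarrow> typed m' Ti \<Longrightarrow>
    prog_clause (m \<^bold>\<leadsto>\<^sup>* n) (\<^bold>\<langle>m \<^bold>\<leadsto> m'\<^bold>\<rangle> \<^bold>& \<^bold>\<langle>m' \<^bold>\<leadsto>\<^sup>* n\<^bold>\<rangle>)"

lemma prog_clause_subst:
  "(P_prog, [A, G], \<^bold>\<top>) \<in> D_all \<Longrightarrow> is_subst \<sigma> \<Longrightarrow> prog_clause (subst \<sigma> A) (subst \<sigma> G)"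
  by (auto simp: clause_simps intro!: prog_clause.intros)

lemma prog_defR:
  assumes "prog_clause a g"
  shows "\<Gamma> \<tturnstile> prog_fm a g"
proof -
  have instances: "\<forall>A G. (P_prog, [A, G], \<^bold>\<top>) \<in> D_all \<longrightarrow> \<Gamma> \<tturnstile> prog_fm (subst \<sigma> A) (subst \<sigma> G)"
    if "is_subst \<sigma>" for \<sigma>
    using defR[OF _ that, of P_prog] by (force simp: entails_topI)
  note instances_simps = clause_simps imp_conjL all_conj_distrib
  from assms show ?thesis
  proof cases
    case (typeof_abs r t u)
    then show ?thesis
      using instances[of "Free((0, Tii) := r, (3, Ti) := t, (4, Ti) := u)"]
      by (simp add: instances_simps)
  next
    case (typeof_app m n t u)
    then show ?thesis
      using instances[of "Free((0, Ti) := m, (1, Ti) := n, (3, Ti) := t, (4, Ti) := u)"]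
      by (simp add: instances_simps)
  next
    case (eval_abs r)
    then show ?thesis using instances[of "Free((0, Tii) := r)"] by (simp add: instances_simps)
  next
    case (eval_app m n v r)
    then show ?thesis
      using instances[of "Free((0, Tii) := r, (0, Ti) := m, (1, Ti) := n, (5, Ti) := v)"]
      by (simp add: instances_simps)
  next
    case (red_beta r n)
    then show ?thesis
      using instances[of "Free((0, Tii) := r, (0, Ti) := n)"] by (simp add: instances_simps)
  next
    case (red_app m n m')
    then show ?thesis
      using instances[of "Free((0, Ti) := m, (1, Ti) := n, (2, Ti) := m')"]
      by (simp add: instances_simps)
  next
    case (reds_refl m)
    then show ?thesis using instances[of "Free((0, Ti) := m)"] by (simp add: instances_simps)
  next
    case (reds_step m n m')
    then show ?thesis
      using instances[of "Free((0, Ti) := m, (1, Ti) := n, (2, Ti) := m')"]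
      by (simp add: instances_simps)
  qed
qed

lemma prog_defL:
  assumes "\<Gamma> \<tturnstile> prog_fm a g" "formula C" "\<forall>A\<in>#\<Delta>. \<Gamma> \<tturnstile> A"
    and clause: "\<And>\<Gamma> \<theta> a' g'. is_subst \<theta> \<Longrightarrow> prog_clause a' g' \<Longrightarrow>
      subst \<theta> a \<approx> a' \<Longrightarrow> subst \<theta> g \<approx> g' \<Longrightarrow> \<forall>A\<in>#\<Delta>. \<Gamma> \<tturnstile> subst \<theta> A \<Longrightarrow> \<Gamma> \<tturnstile> subst \<theta> C"
  shows "\<Gamma> \<tturnstile> C"
proof (rule defL[OF assms(1) _ assms(2,3)])
  fix \<Gamma> ts B \<theta> \<sigma>
  assume D_all: "(P_prog, ts, B) \<in> D_all" and "is_subst \<theta>" "is_subst \<sigma>"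
    and heads: "patom P_prog (map (subst \<theta>) [a, g]) \<approx> patom P_prog (map (subst \<sigma>) ts)"
    and \<Delta>: "\<forall>A\<in>#\<Delta>. \<Gamma> \<tturnstile> subst \<theta> A"
  from D_all obtain A G where "ts = [A, G]" "B = \<^bold>\<top>" by (auto simp: clause_simps)
  with D_all \<open>is_subst \<sigma>\<close> have "prog_clause (subst \<sigma> A) (subst \<sigma> G)"
    by (auto intro: prog_clause_subst)
  with \<open>is_subst \<theta>\<close> heads \<open>ts = [A, G]\<close> \<Delta> show "\<Gamma> \<tturnstile> subst \<theta> C"
    by (intro clause) auto
qed simp


section \<open>Structural properties of the object logic\<close>

text \<open>The heights \<open>i\<close> and \<open>k\<close> and the contexts \<open>l\<close> and \<open>l'\<close> may contain loose bound variables.\<close>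

definition seq_le_fm :: "tm \<Rightarrow> tm \<Rightarrow> tm \<Rightarrow> tm \<Rightarrow> tm" where
  "seq_le_fm i l k l' = Forall Tprp
    (seq_fm (lift i 0) (lift l 0) (Bnd 0) \<^bold>\<supset> seq_fm (lift k 0) (lift l' 0) (Bnd 0))"

definition seq_le_Cons_fm :: "tm \<Rightarrow> tm \<Rightarrow> tm \<Rightarrow> tm \<Rightarrow> tm" where
  "seq_le_Cons_fm i l k l' = Forall Tatm
    (seq_le_fm (lift i 0) (Bnd 0 \<^bold># lift l 0) (lift k 0) (Bnd 0 \<^bold># lift l' 0))"

definition ctx_le_fm :: "tm \<Rightarrow> tm \<Rightarrow> tm \<Rightarrow> tm" where
  "ctx_le_fm k l l' = Forall Tatm
    (element_fm (Bnd 0) (lift l 0) \<^bold>\<supset> seq_fm (lift k 0) (lift l' 0) \<^bold>\<langle>Bnd 0\<^bold>\<rangle>)"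

definition ctx_subset_fm :: "tm \<Rightarrow> tm \<Rightarrow> tm" where
  "ctx_subset_fm l l' = Forall Tatm
    (element_fm (Bnd 0) (lift l 0) \<^bold>\<supset> element_fm (Bnd 0) (lift l' 0))"

lemmas ctx_fm_defs = seq_le_fm_def seq_le_Cons_fm_def ctx_le_fm_def ctx_subset_fm_def

lemma wff_ctx_fm [simp]:
  "wff (seq_le_fm i l k l')" "wff (seq_le_Cons_fm i l k l')"
  "wff (ctx_le_fm k l l')" "wff (ctx_subset_fm l l')"
  by (simp_all add: ctx_fm_defs)

lemma has_type_ctx_fm [simp]:
  "has_type \<Delta> (seq_le_fm i l k l') To \<longleftrightarrow>
    has_type \<Delta> i Tnt \<and> has_type \<Delta> l Tlst \<and> has_type \<Delta> k Tnt \<and> has_type \<Delta> l' Tlst"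
  "has_type \<Delta> (seq_le_Cons_fm i l k l') To \<longleftrightarrow>
    has_type \<Delta> i Tnt \<and> has_type \<Delta> l Tlst \<and> has_type \<Delta> k Tnt \<and> has_type \<Delta> l' Tlst"
  "has_type \<Delta> (ctx_le_fm k l l') To \<longleftrightarrow> has_type \<Delta> k Tnt \<and> has_type \<Delta> l Tlst \<and> has_type \<Delta> l' Tlst"
  "has_type \<Delta> (ctx_subset_fm l l') To \<longleftrightarrow> has_type \<Delta> l Tlst \<and> has_type \<Delta> l' Tlst"
  by (auto simp: ctx_fm_defs)

lemma formula_ctx_fm [simp]:
  "formula (seq_le_fm i l k l') \<longleftrightarrow> typed i Tnt \<and> typed l Tlst \<and> typed k Tnt \<and> typed l' Tlst"
  "formula (ctx_le_fm k l l') \<longleftrightarrow> typed k Tnt \<and> typed l Tlst \<and> typed l' Tlst"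
  "formula (ctx_subset_fm l l') \<longleftrightarrow> typed l Tlst \<and> typed l' Tlst"
  by (simp_all add: formula_def)

lemma entails_ctx_fm_typed [dest]:
  "\<Gamma> \<tturnstile> seq_le_fm i l k l' \<Longrightarrow> typed i Tnt \<and> typed l Tlst \<and> typed k Tnt \<and> typed l' Tlst"
  "\<Gamma> \<tturnstile> ctx_le_fm k l l' \<Longrightarrow> typed k Tnt \<and> typed l Tlst \<and> typed l' Tlst"
  "\<Gamma> \<tturnstile> ctx_subset_fm l l' \<Longrightarrow> typed l Tlst \<and> typed l' Tlst"
  by (auto dest: entails_formula)

lemma inst_ctx_fm [simp]:
  "inst (seq_le_fm i l k l') j s = seq_le_fm (inst i j s) (inst l j s) (inst k j s) (inst l' j s)"
  "inst (ctx_le_fm k l l') j s = ctx_le_fm (inst k j s) (inst l j s) (inst l' j s)"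
  "inst (ctx_subset_fm l l') j s = ctx_subset_fm (inst l j s) (inst l' j s)"
  by (simp_all add: ctx_fm_defs inst_lift_le)

lemma subst_ctx_fm:
  assumes "is_subst \<theta>" "typed l Tlst" "typed l' Tlst" "typed k Tnt"
  shows "typed i Tnt \<Longrightarrow> subst \<theta> (seq_le_fm i l k l') =
      seq_le_fm (subst \<theta> i) (subst \<theta> l) (subst \<theta> k) (subst \<theta> l')"
    and "typed i Tnt \<Longrightarrow> subst \<theta> (seq_le_Cons_fm i l k l') =
      seq_le_Cons_fm (subst \<theta> i) (subst \<theta> l) (subst \<theta> k) (subst \<theta> l')"
    and "subst \<theta> (ctx_le_fm k l l') = ctx_le_fm (subst \<theta> k) (subst \<theta> l) (subst \<theta> l')"
  using assms by (simp_all add: ctx_fm_defs)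

lemma entails_seq_leI:
  assumes "\<And>\<Gamma>' b. \<Gamma> \<sqsubseteq> \<Gamma>' \<Longrightarrow> \<Gamma>' \<tturnstile> seq_fm i l b \<Longrightarrow> \<Gamma>' \<tturnstile> seq_fm k l' b"
    and "typed i Tnt" "typed l Tlst" "typed k Tnt" "typed l' Tlst"
  shows "\<Gamma> \<tturnstile> seq_le_fm i l k l'"
  using assms by (simp add: seq_le_fm_def entails_all_iff entails_imp_iff)

lemma entails_seq_leD:
  assumes "\<Gamma> \<tturnstile> seq_le_fm i l k l'" "\<Gamma> \<tturnstile> seq_fm i l b"
  shows "\<Gamma> \<tturnstile> seq_fm k l' b"
proof -
  have "\<Gamma> \<tturnstile> seq_fm i l b \<^bold>\<supset> seq_fm k l' b"
    using entails_allE[OF assms(1)[unfolded seq_le_fm_def], of b]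
      entails_ctx_fm_typed(1)[OF assms(1)] entails_formula[OF assms(2)]
    by simp
  then show ?thesis using assms(2) by (rule entails_mp)
qed

lemma entails_seq_le_Cons_iff:
  "\<Gamma> \<tturnstile> seq_le_Cons_fm i l k l' \<longleftrightarrow>
    typed i Tnt \<and> typed l Tlst \<and> typed k Tnt \<and> typed l' Tlst \<and>
    (\<forall>a. typed a Tatm \<longrightarrow> \<Gamma> \<tturnstile> seq_le_fm i (a \<^bold># l) k (a \<^bold># l'))"
  by (auto simp: seq_le_Cons_fm_def entails_all_iff)

lemma entails_ctx_leI:
  assumes "\<And>\<Gamma>' a. \<Gamma> \<sqsubseteq> \<Gamma>' \<Longrightarrow> \<Gamma>' \<tturnstile> element_fm a l \<Longrightarrow> \<Gamma>' \<tturnstile> seq_fm k l' \<^bold>\<langle>a\<^bold>\<rangle>"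
    and "typed k Tnt" "typed l Tlst" "typed l' Tlst"
  shows "\<Gamma> \<tturnstile> ctx_le_fm k l l'"
  using assms by (simp add: ctx_le_fm_def entails_all_iff entails_imp_iff)

lemma entails_ctx_leD:
  assumes "\<Gamma> \<tturnstile> ctx_le_fm k l l'" "\<Gamma> \<tturnstile> element_fm a l"
  shows "\<Gamma> \<tturnstile> seq_fm k l' \<^bold>\<langle>a\<^bold>\<rangle>"
proof -
  have "\<Gamma> \<tturnstile> element_fm a l \<^bold>\<supset> seq_fm k l' \<^bold>\<langle>a\<^bold>\<rangle>"
    using entails_allE[OF assms(1)[unfolded ctx_le_fm_def], of a]
      entails_ctx_fm_typed(2)[OF assms(1)] entails_formula[OF assms(2)]
    by simp
  then show ?thesis using assms(2) by (rule entails_mp)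
qed

lemma entails_ctx_subsetI:
  assumes "\<And>\<Gamma>' a. \<Gamma> \<sqsubseteq> \<Gamma>' \<Longrightarrow> \<Gamma>' \<tturnstile> element_fm a l \<Longrightarrow> \<Gamma>' \<tturnstile> element_fm a l'"
    and "typed l Tlst" "typed l' Tlst"
  shows "\<Gamma> \<tturnstile> ctx_subset_fm l l'"
  using assms by (simp add: ctx_subset_fm_def entails_all_iff entails_imp_iff)

lemma entails_ctx_subsetD:
  assumes "\<Gamma> \<tturnstile> ctx_subset_fm l l'" "\<Gamma> \<tturnstile> element_fm a l"
  shows "\<Gamma> \<tturnstile> element_fm a l'"
proof -
  have "\<Gamma> \<tturnstile> element_fm a l \<^bold>\<supset> element_fm a l'"
    using entails_allE[OF assms(1)[unfolded ctx_subset_fm_def], of a]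
      entails_ctx_fm_typed(3)[OF assms(1)] entails_formula[OF assms(2)]
    by simp
  then show ?thesis using assms(2) by (rule entails_mp)
qed

lemma seq_zero:
  assumes "\<Gamma> \<tturnstile> seq_fm zero_tm l b" "\<Gamma> \<tturnstile> ctx_le_fm k l l'"
  shows "\<Gamma> \<tturnstile> seq_fm k l' b"
proof -
  have typing: "typed l Tlst" "typed b Tprp" "typed k Tnt" "typed l' Tlst"
    using assms(1) entails_formula[OF assms(2)] by auto
  show ?thesis
  proof (rule seq_defL[OF assms(1), where \<Delta> = "{#ctx_le_fm k l l'#}"])
    fix \<Gamma> \<theta>
    assume \<theta>: "is_subst \<theta>" and "\<forall>A\<in>#{#ctx_le_fm k l l'#}. \<Gamma> \<tturnstile> subst \<theta> A"
    then have ctx: "\<Gamma> \<tturnstile> ctx_le_fm (subst \<theta> k) (subst \<theta> l) (subst \<theta> l')"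
      using typing by (simp add: subst_ctx_fm)
    assume "seq_clause \<Gamma> (subst \<theta> zero_tm) (subst \<theta> l) (subst \<theta> b)"
    then have "\<Gamma> \<tturnstile> seq_fm (subst \<theta> k) (subst \<theta> l') (subst \<theta> b)"
    proof cases
      case (element a)
      show ?thesis
        using seq_conv[OF entails_ctx_leD[OF ctx element(2)]] element(1) typing \<theta>
        by (simp add: conv_sym)
    next
      case tt
      then show ?thesis using typing \<theta> by (intro seq_clause_imp_seq seq_clause.tt) auto
    qed auto
    then show "\<Gamma> \<tturnstile> subst \<theta> (seq_fm k l' b)" by simp
  qed (use assms typing in auto)
qed

lemma seq_clause_suc_mono:
  assumes clause: "seq_clause \<Gamma> (suc_tm i) l b" and b: "typed b Tprp"
    and ctx: "\<Gamma> \<tturnstile> ctx_le_fm (suc_tm k) l l'"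
    and seq_le: "\<Gamma> \<tturnstile> seq_le_fm i l k l'" and seq_le_Cons: "\<Gamma> \<tturnstile> seq_le_Cons_fm i l k l'"
  shows "\<Gamma> \<tturnstile> seq_fm (suc_tm k) l' b"
proof -
  have typing: "typed k Tnt" "typed l' Tlst" using seq_le by auto
  from clause show ?thesis
  proof cases
    case (element a)
    show ?thesis
      using seq_conv[OF entails_ctx_leD[OF ctx element(2)]] element(1) typing b
      by (simp add: conv_sym)
  next
    case tt
    then show ?thesis using typing by (intro seq_clause_imp_seq[OF _ b] seq_clause.tt) auto
  next
    case (amp c d)
    then show ?thesis using seq_le
      by (intro seq_clause_imp_seq[OF _ b] seq_clause.amp) (auto intro: entails_seq_leD)
  next
    case (imp a c)
    then have "\<Gamma> \<tturnstile> seq_le_fm i (a \<^bold># l) k (a \<^bold># l')"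
      using seq_le_Cons entails_typed(3)[OF imp(2)] by (simp add: entails_seq_le_Cons_iff)
    then show ?thesis using imp
      by (intro seq_clause_imp_seq[OF _ b] seq_clause.imp) (auto intro: entails_seq_leD)
  next
    case (all f)
    then show ?thesis using seq_le typing
      by (intro seq_clause_imp_seq[OF _ b] seq_clause.all) (auto intro: entails_seq_leD)
  next
    case (prog a g)
    then show ?thesis using seq_le
      by (intro seq_clause_imp_seq[OF _ b] seq_clause.prog) (auto intro: entails_seq_leD)
  qed
qed

lemma seq_suc:
  assumes "\<Gamma> \<tturnstile> seq_fm (suc_tm i) l b" "\<Gamma> \<tturnstile> ctx_le_fm (suc_tm k) l l'"
    and "\<Gamma> \<tturnstile> seq_le_fm i l k l'" "\<Gamma> \<tturnstile> seq_le_Cons_fm i l k l'"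
  shows "\<Gamma> \<tturnstile> seq_fm (suc_tm k) l' b"
proof -
  let ?\<Delta> = "{#ctx_le_fm (suc_tm k) l l', seq_le_fm i l k l', seq_le_Cons_fm i l k l'#}"
  have typing: "typed i Tnt" "typed l Tlst" "typed b Tprp" "typed k Tnt" "typed l' Tlst"
    using assms(1) entails_formula[OF assms(2)] by auto
  show ?thesis
  proof (rule seq_defL[OF assms(1), where \<Delta> = ?\<Delta>])
    fix \<Gamma> \<theta>
    assume \<theta>: "is_subst \<theta>" and "\<forall>A\<in>#?\<Delta>. \<Gamma> \<tturnstile> subst \<theta> A"
      and "seq_clause \<Gamma> (subst \<theta> (suc_tm i)) (subst \<theta> l) (subst \<theta> b)"
    then have "\<Gamma> \<tturnstile> seq_fm (suc_tm (subst \<theta> k)) (subst \<theta> l') (subst \<theta> b)"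
      using typing by (intro seq_clause_suc_mono) (auto simp: subst_ctx_fm)
    then show "\<Gamma> \<tturnstile> subst \<theta> (seq_fm (suc_tm k) l' b)" by simp
  qed (use assms typing in auto)
qed

lemma ctx_le_refl: "typed k Tnt \<Longrightarrow> typed l Tlst \<Longrightarrow> \<Gamma> \<tturnstile> ctx_le_fm k l l"
  by (auto intro: entails_ctx_leI seq_elementI)

lemma ctx_subset_imp_ctx_le: "\<Gamma> \<tturnstile> ctx_subset_fm l l' \<Longrightarrow> typed k Tnt \<Longrightarrow> \<Gamma> \<tturnstile> ctx_le_fm k l l'"
  by (intro entails_ctx_leI seq_elementI) (auto intro: entails_ctx_subsetD entails_mono)

lemma seq_le_suc:
  assumes "\<Gamma> \<tturnstile> nat_fm i" "typed l Tlst"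
  shows "\<Gamma> \<tturnstile> seq_le_fm i l (suc_tm i) l"
proof -
  let ?P = "\<lambda>i. Forall Tlst (seq_le_fm (lift i 0) (Bnd 0) (suc_tm (lift i 0)) (Bnd 0))"
  have "\<Gamma> \<tturnstile> ?P i"
  proof (rule entails_nat_induct[OF assms(1), where P = ?P])
    show "predicate Tnt ?P" by (simp add: predicate_def inst_lift_le)
    have "\<Gamma> \<tturnstile> seq_le_fm zero_tm l (suc_tm zero_tm) l" if "typed l Tlst" for \<Gamma> l
      using that by (intro entails_seq_leI) (auto intro: seq_zero[OF _ ctx_le_refl])
    then show "\<Gamma> \<tturnstile> ?P zero_tm" for \<Gamma> by (simp add: entails_all_iff)
    fix \<Gamma> j assume "\<Gamma> \<tturnstile> nat_fm j" and "\<Gamma> \<tturnstile> ?P j"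
    then have j: "typed j Tnt" and IH: "\<And>l. typed l Tlst \<Longrightarrow> \<Gamma> \<tturnstile> seq_le_fm j l (suc_tm j) l"
      by (auto simp: entails_all_iff)
    have "\<Gamma>' \<tturnstile> seq_fm (suc_tm (suc_tm j)) l b"
      if "\<Gamma> \<sqsubseteq> \<Gamma>'" "\<Gamma>' \<tturnstile> seq_fm (suc_tm j) l b" for \<Gamma>' l b
    proof (rule seq_suc[OF that(2)])
      have l: "typed l Tlst" using that(2) by auto
      show "\<Gamma>' \<tturnstile> ctx_le_fm (suc_tm (suc_tm j)) l l" using j l by (simp add: ctx_le_refl)
      show "\<Gamma>' \<tturnstile> seq_le_fm j l (suc_tm j) l" using IH[OF l] that(1) by (rule entails_mono)
      show "\<Gamma>' \<tturnstile> seq_le_Cons_fm j l (suc_tm j) l"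
        using j l that(1) by (auto simp: entails_seq_le_Cons_iff intro!: entails_mono[OF IH])
    qed
    then show "\<Gamma> \<tturnstile> ?P (suc_tm j)" using j by (simp add: entails_all_iff entails_seq_leI)
  qed
  then show ?thesis using assms by (auto simp: entails_all_iff)
qed

lemma ctx_subset_Cons:
  assumes "\<Gamma> \<tturnstile> ctx_subset_fm l l'" "typed a Tatm"
  shows "\<Gamma> \<tturnstile> ctx_subset_fm (a \<^bold># l) (a \<^bold># l')"
proof (rule entails_ctx_subsetI)
  have typing: "typed l Tlst" "typed l' Tlst" using entails_formula[OF assms(1)] by auto
  then show "typed (a \<^bold># l) Tlst" "typed (a \<^bold># l') Tlst" using assms(2) by auto
  fix \<Gamma>' x assume \<Gamma>': "\<Gamma> \<sqsubseteq> \<Gamma>'" and x: "\<Gamma>' \<tturnstile> element_fm x (a \<^bold># l)"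
  show "\<Gamma>' \<tturnstile> element_fm x (a \<^bold># l')"
  proof (rule element_ConsE[OF x, where P = "\<lambda>x. element_fm x (a \<^bold># l')"])
    show "predicate Tatm (\<lambda>x. element_fm x (a \<^bold># l'))" using assms(2) typing
      by (simp add: predicate_def)
    show "\<Gamma>' \<tturnstile> element_fm a (a \<^bold># l')" using assms(2) typing by (intro element_headI)
    fix \<Gamma>'' assume "\<Gamma>' \<sqsubseteq> \<Gamma>''" "\<Gamma>'' \<tturnstile> element_fm x l"
    then show "\<Gamma>'' \<tturnstile> element_fm x (a \<^bold># l')"
      using assms(2) \<Gamma>'
      by (intro element_tailI entails_ctx_subsetD[OF entails_mono[OF assms(1)]]) auto
  qed
qed

lemma seq_le_weaken:
  assumes "\<Gamma> \<tturnstile> nat_fm i" "\<Gamma> \<tturnstile> ctx_subset_fm l l'"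
  shows "\<Gamma> \<tturnstile> seq_le_fm i l i l'"
proof -
  let ?P = "\<lambda>i. Forall Tlst (Forall Tlst (ctx_subset_fm (Bnd 1) (Bnd 0) \<^bold>\<supset>
    seq_le_fm (lift (lift i 0) 0) (Bnd 1) (lift (lift i 0) 0) (Bnd 0)))"
  have P_iff: "\<Gamma> \<tturnstile> ?P i \<longleftrightarrow> (\<forall>\<Gamma>' l l'. \<Gamma> \<sqsubseteq> \<Gamma>' \<longrightarrow> \<Gamma>' \<tturnstile> ctx_subset_fm l l' \<longrightarrow>
      \<Gamma>' \<tturnstile> seq_le_fm i l i l')" if "typed i Tnt" for \<Gamma> i
    using that by (simp add: entails_all_iff entails_imp_iff) blast
  have "\<Gamma> \<tturnstile> ?P i"
  proof (rule entails_nat_induct[OF assms(1), where P = ?P])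
    show "predicate Tnt ?P" by (simp add: predicate_def inst_lift_le)
    have "\<Gamma> \<tturnstile> seq_le_fm zero_tm l zero_tm l'" if "\<Gamma> \<tturnstile> ctx_subset_fm l l'" for \<Gamma> l l'
      using that by (intro entails_seq_leI)
        (auto elim: seq_zero[OF _ entails_mono[OF ctx_subset_imp_ctx_le[OF that]]])
    then show "\<Gamma> \<tturnstile> ?P zero_tm" for \<Gamma> by (simp add: P_iff[of zero_tm, simplified])
    fix \<Gamma> j assume "\<Gamma> \<tturnstile> nat_fm j" and "\<Gamma> \<tturnstile> ?P j"
    then have j: "typed j Tnt"
      and IH: "\<And>\<Gamma>' l l'. \<Gamma> \<sqsubseteq> \<Gamma>' \<Longrightarrow> \<Gamma>' \<tturnstile> ctx_subset_fm l l' \<Longrightarrow> \<Gamma>' \<tturnstile> seq_le_fm j l j l'"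
      using P_iff by blast+
    have suc: "\<Gamma>' \<tturnstile> seq_fm (suc_tm j) l' b" if \<Gamma>': "\<Gamma> \<sqsubseteq> \<Gamma>'"
      and sub: "\<Gamma>' \<tturnstile> ctx_subset_fm l l'" and "\<Gamma>' \<tturnstile> seq_fm (suc_tm j) l b" for \<Gamma>' l l' b
      using that(3)
    proof (rule seq_suc)
      show "\<Gamma>' \<tturnstile> ctx_le_fm (suc_tm j) l l'" using sub j by (simp add: ctx_subset_imp_ctx_le)
      show "\<Gamma>' \<tturnstile> seq_le_fm j l j l'" using \<Gamma>' sub by (rule IH)
      show "\<Gamma>' \<tturnstile> seq_le_Cons_fm j l j l'"
        using IH[OF \<Gamma>' ctx_subset_Cons[OF sub]] j entails_ctx_fm_typed(3)[OF sub]
        by (simp add: entails_seq_le_Cons_iff)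
    qed
    have "\<Gamma>' \<tturnstile> seq_le_fm (suc_tm j) l (suc_tm j) l'"
      if "\<Gamma> \<sqsubseteq> \<Gamma>'" "\<Gamma>' \<tturnstile> ctx_subset_fm l l'" for \<Gamma>' l l'
      by (rule entails_seq_leI, rule suc[OF _ entails_mono[OF that(2)]]) (use that j in auto)
    then show "\<Gamma> \<tturnstile> ?P (suc_tm j)" using j by (simp add: P_iff[of "suc_tm j", simplified])
  qed
  then show ?thesis using assms entails_typed(1)[OF assms(1)] P_iff by blast
qed

lemma ctx_le_Cons:
  assumes "\<Gamma> \<tturnstile> nat_fm k" "\<Gamma> \<tturnstile> ctx_le_fm k l l'" "typed a Tatm"
  shows "\<Gamma> \<tturnstile> ctx_le_fm k (a \<^bold># l) (a \<^bold># l')"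
proof (rule entails_ctx_leI)
  have typing: "typed k Tnt" "typed l Tlst" "typed l' Tlst" using entails_formula[OF assms(2)] by auto
  then show "typed k Tnt" "typed (a \<^bold># l) Tlst" "typed (a \<^bold># l') Tlst" using assms(3) by auto
  have sub: "\<Gamma> \<tturnstile> ctx_subset_fm l' (a \<^bold># l')"
    using typing assms(3) by (auto intro: entails_ctx_subsetI element_tailI)
  let ?P = "\<lambda>x. seq_fm k (a \<^bold># l') \<^bold>\<langle>x\<^bold>\<rangle>"
  fix \<Gamma>' x assume \<Gamma>': "\<Gamma> \<sqsubseteq> \<Gamma>'" and x: "\<Gamma>' \<tturnstile> element_fm x (a \<^bold># l)"
  show "\<Gamma>' \<tturnstile> ?P x"
  proof (rule element_ConsE[OF x, where P = ?P])
    show "predicate Tatm ?P" using assms(3) typing by (simp add: predicate_def)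
    show "\<Gamma>' \<tturnstile> ?P a" using assms(3) typing by (intro seq_elementI element_headI)
    fix \<Gamma>'' assume "\<Gamma>' \<sqsubseteq> \<Gamma>''" and x: "\<Gamma>'' \<tturnstile> element_fm x l"
    then have \<Gamma>'': "\<Gamma> \<sqsubseteq> \<Gamma>''" using \<Gamma>' by simp
    show "\<Gamma>'' \<tturnstile> ?P x"
      using seq_le_weaken[OF entails_mono[OF assms(1) \<Gamma>''] entails_mono[OF sub \<Gamma>'']]
        entails_ctx_leD[OF entails_mono[OF assms(2) \<Gamma>''] x]
      by (rule entails_seq_leD)
  qed
qed

text \<open>The bound \<open>k'\<close> depends on the heights only, as in the case of \<open>\<^bold>\<And>\<close> it has to serve for all instances.\<close>

definition cut_bound_fm :: "tm \<Rightarrow> tm \<Rightarrow> tm \<Rightarrow> tm" where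
  "cut_bound_fm i k k' =
    Forall Tlst (seq_le_fm (lift k 0) (Bnd 0) (lift k' 0) (Bnd 0)) \<^bold>\<and>
    Forall Tlst (Forall Tlst (ctx_le_fm (lift (lift k 0) 0) (Bnd 1) (Bnd 0) \<^bold>\<supset>
      seq_le_fm (lift (lift i 0) 0) (Bnd 1) (lift (lift k' 0) 0) (Bnd 0)))"

lemma wff_cut_bound [simp]: "wff (cut_bound_fm i k k')"
  by (simp add: cut_bound_fm_def)

lemma has_type_cut_bound [simp]:
  "has_type \<Delta> (cut_bound_fm i k k') To \<longleftrightarrow> has_type \<Delta> i Tnt \<and> has_type \<Delta> k Tnt \<and> has_type \<Delta> k' Tnt"
  by (auto simp: cut_bound_fm_def)

lemma inst_cut_bound [simp]:
  "inst (cut_bound_fm i k k') j s = cut_bound_fm (inst i j s) (inst k j s) (inst k' j s)"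
  by (simp add: cut_bound_fm_def inst_lift_le)

lemma entails_cut_bound_typed [dest]:
  "\<Gamma> \<tturnstile> cut_bound_fm i k k' \<Longrightarrow> typed i Tnt \<and> typed k Tnt \<and> typed k' Tnt"
  by (auto dest: entails_formula simp: formula_def)

lemma entails_cut_boundI:
  assumes "\<And>l. typed l Tlst \<Longrightarrow> \<Gamma> \<tturnstile> seq_le_fm k l k' l"
    and "\<And>\<Gamma>' l l'. \<Gamma> \<sqsubseteq> \<Gamma>' \<Longrightarrow> \<Gamma>' \<tturnstile> ctx_le_fm k l l' \<Longrightarrow> \<Gamma>' \<tturnstile> seq_le_fm i l k' l'"
    and "typed i Tnt" "typed k Tnt" "typed k' Tnt"
  shows "\<Gamma> \<tturnstile> cut_bound_fm i k k'"
  using assms by (simp add: cut_bound_fm_def entails_all_iff entails_imp_iff)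

lemma cut_bound_imp_seq_le:
  assumes "\<Gamma> \<tturnstile> cut_bound_fm i k k'"
  shows "typed l Tlst \<Longrightarrow> \<Gamma> \<tturnstile> seq_le_fm k l k' l"
    and "\<Gamma> \<tturnstile> ctx_le_fm k l l' \<Longrightarrow> \<Gamma> \<tturnstile> seq_le_fm i l k' l'"
  using assms entails_cut_bound_typed[OF assms] entails_ctx_fm_typed(2)[of \<Gamma> k l l']
  by (simp_all add: cut_bound_fm_def entails_all_iff entails_imp_iff)

lemma cut_bound_zero: "typed k Tnt \<Longrightarrow> \<Gamma> \<tturnstile> cut_bound_fm zero_tm k k"
  by (intro entails_cut_boundI entails_seq_leI) (auto intro: seq_zero entails_mono)

lemma cut_bound_suc:
  assumes "\<Gamma> \<tturnstile> nat_fm k" "\<Gamma> \<tturnstile> nat_fm k'" and bound: "\<Gamma> \<tturnstile> cut_bound_fm i k k'"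
  shows "\<Gamma> \<tturnstile> cut_bound_fm (suc_tm i) k (suc_tm k')"
proof (rule entails_cut_boundI)
  show typing: "typed (suc_tm i) Tnt" "typed k Tnt" "typed (suc_tm k') Tnt" using bound by auto
  have le_suc: "\<Gamma>' \<tturnstile> seq_fm (suc_tm k') l b" if "\<Gamma> \<sqsubseteq> \<Gamma>'" "\<Gamma>' \<tturnstile> seq_fm k l b" for \<Gamma>' l b
  proof -
    have l: "typed l Tlst" using that(2) by auto
    have "\<Gamma>' \<tturnstile> seq_fm k' l b"
      using cut_bound_imp_seq_le(1)[OF entails_mono[OF bound that(1)] l] that(2)
      by (rule entails_seq_leD)
    with seq_le_suc[OF entails_mono[OF assms(2) that(1)] l] show ?thesis by (rule entails_seq_leD)
  qed
  then show "\<Gamma> \<tturnstile> seq_le_fm k l (suc_tm k') l" if "typed l Tlst" for l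
    using that typing by (intro entails_seq_leI)
  fix \<Gamma>' l l' assume \<Gamma>': "\<Gamma> \<sqsubseteq> \<Gamma>'" and ctx: "\<Gamma>' \<tturnstile> ctx_le_fm k l l'"
  have l: "typed l Tlst" "typed l' Tlst" using ctx by auto
  show "\<Gamma>' \<tturnstile> seq_le_fm (suc_tm i) l (suc_tm k') l'"
  proof (rule entails_seq_leI)
    fix \<Gamma>'' b assume \<Gamma>'': "\<Gamma>' \<sqsubseteq> \<Gamma>''" and "\<Gamma>'' \<tturnstile> seq_fm (suc_tm i) l b"
    from this(2) show "\<Gamma>'' \<tturnstile> seq_fm (suc_tm k') l' b"
    proof (rule seq_suc)
      have "\<Gamma> \<sqsubseteq> \<Gamma>''" using \<Gamma>' \<Gamma>'' by simp
      note k = entails_mono[OF assms(1) this] and cut = cut_bound_imp_seq_le(2)[OF entails_mono[OF bound this]]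
      note ctx = entails_mono[OF ctx \<Gamma>'']
      show "\<Gamma>'' \<tturnstile> ctx_le_fm (suc_tm k') l l'"
        using typing l \<open>\<Gamma> \<sqsubseteq> \<Gamma>''\<close>
        by (intro entails_ctx_leI le_suc) (auto intro: entails_ctx_leD[OF entails_mono[OF ctx]])
      show "\<Gamma>'' \<tturnstile> seq_le_fm i l k' l'" using ctx by (rule cut)
      show "\<Gamma>'' \<tturnstile> seq_le_Cons_fm i l k' l'"
        using typing l cut[OF ctx_le_Cons[OF k ctx]] by (simp add: entails_seq_le_Cons_iff)
    qed
  qed (use typing l in auto)
qed

lemma ex_cut_bound:
  assumes "\<Gamma> \<tturnstile> nat_fm i" "\<Gamma> \<tturnstile> nat_fm k"
  shows "\<Gamma> \<tturnstile> Exists Tnt (nat_fm (Bnd 0) \<^bold>\<and> cut_bound_fm i k (Bnd 0))"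
proof -
  let ?ex = "\<lambda>i k. Exists Tnt (nat_fm (Bnd 0) \<^bold>\<and> cut_bound_fm i k (Bnd 0))"
  let ?P = "\<lambda>i. Forall Tnt (nat_fm (Bnd 0) \<^bold>\<supset> ?ex (lift (lift i 0) 0) (Bnd 1))"
  have P_iff: "\<Gamma> \<tturnstile> ?P i \<longleftrightarrow> (\<forall>\<Gamma>' k. \<Gamma> \<sqsubseteq> \<Gamma>' \<longrightarrow> \<Gamma>' \<tturnstile> nat_fm k \<longrightarrow> \<Gamma>' \<tturnstile> ?ex i k)"
    if "typed i Tnt" for \<Gamma> i
    using that by (simp add: entails_all_iff entails_imp_iff) blast
  have exI: "\<Gamma> \<tturnstile> ?ex i k" if "\<Gamma> \<tturnstile> nat_fm k'" "\<Gamma> \<tturnstile> cut_bound_fm i k k'" for \<Gamma> i k k'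
    using that entails_typed(1)[OF that(1)] entails_cut_bound_typed[OF that(2)]
    by (intro entails_exI[where t = k']) auto
  have "\<Gamma> \<tturnstile> ?P i"
  proof (rule entails_nat_induct[OF assms(1), where P = ?P])
    show "predicate Tnt ?P" by (simp add: predicate_def inst_lift_le)
    have "\<Gamma> \<tturnstile> ?ex zero_tm k" if "\<Gamma> \<tturnstile> nat_fm k" for \<Gamma> k
      using that by (auto intro: exI cut_bound_zero)
    then show "\<Gamma> \<tturnstile> ?P zero_tm" for \<Gamma> by (simp add: P_iff[of zero_tm, simplified])
    fix \<Gamma> j assume "\<Gamma> \<tturnstile> nat_fm j" and "\<Gamma> \<tturnstile> ?P j"
    then have j: "typed j Tnt" and IH: "\<And>\<Gamma>' k. \<Gamma> \<sqsubseteq> \<Gamma>' \<Longrightarrow> \<Gamma>' \<tturnstile> nat_fm k \<Longrightarrow> \<Gamma>' \<tturnstile> ?ex j k"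
      using P_iff by blast+
    have "\<Gamma>' \<tturnstile> ?ex (suc_tm j) k" if "\<Gamma> \<sqsubseteq> \<Gamma>'" and k: "\<Gamma>' \<tturnstile> nat_fm k" for \<Gamma>' k
      using IH[OF that]
    proof (rule entails_exE)
      fix \<Gamma>'' k' assume "\<Gamma>' \<sqsubseteq> \<Gamma>''" "typed k' Tnt"
        "\<Gamma>'' \<tturnstile> inst (nat_fm (Bnd 0) \<^bold>\<and> cut_bound_fm j k (Bnd 0)) 0 k'"
      then have "\<Gamma>'' \<tturnstile> nat_fm k" "\<Gamma>'' \<tturnstile> nat_fm k'" "\<Gamma>'' \<tturnstile> cut_bound_fm j k k'"
        using k j entails_mono[OF k] entails_typed(1)[OF k] by auto
      then show "\<Gamma>'' \<tturnstile> ?ex (suc_tm j) k"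
        by (intro exI[where k' = "suc_tm k'"] entails_nat_suc cut_bound_suc)
    qed
    then show "\<Gamma> \<tturnstile> ?P (suc_tm j)" using j by (simp add: P_iff[of "suc_tm j", simplified])
  qed
  then show ?thesis using P_iff entails_typed(1)[OF assms(1)] assms(2) by blast
qed

lemma cut_boundE:
  assumes "\<Gamma> \<tturnstile> nat_fm i" "\<Gamma> \<tturnstile> nat_fm k"
    and continuation: "\<And>\<Gamma>' k'. \<Gamma> \<sqsubseteq> \<Gamma>' \<Longrightarrow> \<Gamma>' \<tturnstile> nat_fm k' \<Longrightarrow> \<Gamma>' \<tturnstile> cut_bound_fm i k k' \<Longrightarrow> \<Gamma>' \<tturnstile> C"
  shows "\<Gamma> \<tturnstile> C"
  using ex_cut_bound[OF assms(1,2)]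
proof (rule entails_exE)
  fix \<Gamma>' k' assume "\<Gamma> \<sqsubseteq> \<Gamma>'" "typed k' Tnt"
    "\<Gamma>' \<tturnstile> inst (nat_fm (Bnd 0) \<^bold>\<and> cut_bound_fm i k (Bnd 0)) 0 k'"
  then show "\<Gamma>' \<tturnstile> C"
    using entails_typed(1)[OF assms(1)] entails_typed(1)[OF assms(2)] by (intro continuation) auto
qed

lemma seq_maxE:
  assumes "\<Gamma> \<tturnstile> nat_fm i" "\<Gamma> \<tturnstile> seq_fm i l b" "\<Gamma> \<tturnstile> nat_fm k" "\<Gamma> \<tturnstile> seq_fm k m c"
    and continuation: "\<And>\<Gamma>' k'. \<Gamma> \<sqsubseteq> \<Gamma>' \<Longrightarrow> \<Gamma>' \<tturnstile> nat_fm k' \<Longrightarrow> \<Gamma>' \<tturnstile> seq_fm k' l b \<Longrightarrow>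
      \<Gamma>' \<tturnstile> seq_fm k' m c \<Longrightarrow> \<Gamma>' \<tturnstile> C"
  shows "\<Gamma> \<tturnstile> C"
proof (rule cut_boundE[OF assms(1,3)])
  fix \<Gamma>' k' assume \<Gamma>': "\<Gamma> \<sqsubseteq> \<Gamma>'" and k': "\<Gamma>' \<tturnstile> nat_fm k'" and bound: "\<Gamma>' \<tturnstile> cut_bound_fm i k k'"
  have l: "typed l Tlst" and m: "typed m Tlst" using assms(2,4) by auto
  have "\<Gamma>' \<tturnstile> seq_le_fm i l k' l" "\<Gamma>' \<tturnstile> seq_le_fm k m k' m"
    using cut_bound_imp_seq_le[OF bound] l m entails_typed(1)[OF assms(3)]
    by (auto intro: ctx_le_refl)
  then show "\<Gamma>' \<tturnstile> C"
    using continuation[OF \<Gamma>' k'] entails_seq_leD entails_mono[OF assms(2) \<Gamma>'] entails_mono[OF assms(4) \<Gamma>']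
    by blast
qed


section \<open>Inversion in the object logic\<close>

lemma seq_mono: "\<Gamma> \<tturnstile> nat_fm i \<Longrightarrow> \<Gamma> \<tturnstile> seq_fm i l b \<Longrightarrow> \<Gamma> \<tturnstile> seq_fm (suc_tm i) l b"
  by (rule entails_seq_leD[OF seq_le_suc]) auto

lemma seq_nat_cases:
  assumes i: "\<Gamma> \<tturnstile> nat_fm i" and b: "\<Gamma> \<tturnstile> seq_fm i l b" and pred_Q: "predicate Tnt Q"
    and zero: "\<And>\<Gamma>. \<Gamma> \<tturnstile> seq_fm zero_tm l b \<Longrightarrow> \<Gamma> \<tturnstile> Q zero_tm"
    and suc: "\<And>\<Gamma> j. \<Gamma> \<tturnstile> nat_fm j \<Longrightarrow> \<Gamma> \<tturnstile> seq_fm (suc_tm j) l b \<Longrightarrow> \<Gamma> \<tturnstile> Q (suc_tm j)"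
  shows "\<Gamma> \<tturnstile> Q i"
proof -
  let ?P = "\<lambda>i. seq_fm i l b \<^bold>\<supset> Q i"
  have typing: "typed l Tlst" "typed b Tprp" using b by auto
  have "\<Gamma> \<tturnstile> ?P i"
  proof (rule entails_nat_induct[OF i, where P = ?P])
    show "predicate Tnt ?P" using pred_Q typing by (auto simp: predicate_def)
    show "\<Gamma> \<tturnstile> ?P zero_tm" for \<Gamma> using typing by (intro entails_impI zero) auto
    show "\<Gamma> \<tturnstile> ?P (suc_tm j)" if "\<Gamma> \<tturnstile> nat_fm j" for \<Gamma> j
      using typing that by (intro entails_impI suc) (auto intro: entails_mono)
  qed
  then show ?thesis using b by (rule entails_mp)
qed

lemma seq_ampE:
  assumes "\<Gamma> \<tturnstile> nat_fm i" "\<Gamma> \<tturnstile> seq_fm i l (b \<^bold>& c)"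
  shows "\<Gamma> \<tturnstile> seq_fm i l b" "\<Gamma> \<tturnstile> seq_fm i l c"
proof -
  let ?Q = "\<lambda>i. seq_fm i l b \<^bold>\<and> seq_fm i l c"
  have typing: "typed l Tlst" "typed b Tprp" "typed c Tprp" using assms(2) by auto
  have "\<Gamma> \<tturnstile> ?Q i"
  proof (rule seq_nat_cases[OF assms, where Q = ?Q])
    show "predicate Tnt ?Q" using typing by (simp add: predicate_def)
    show "\<Gamma> \<tturnstile> ?Q zero_tm" if "\<Gamma> \<tturnstile> seq_fm zero_tm l (b \<^bold>& c)" for \<Gamma>
      by (rule seq_defL[OF that, where \<Delta> = "{#}"]) (use typing in \<open>auto elim: seq_clause.cases\<close>)
    show "\<Gamma> \<tturnstile> ?Q (suc_tm j)" if "\<Gamma> \<tturnstile> nat_fm j" "\<Gamma> \<tturnstile> seq_fm (suc_tm j) l (b \<^bold>& c)" for \<Gamma> j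
    proof (rule seq_defL[OF that(2), where \<Delta> = "{#nat_fm j#}"])
      fix \<Gamma> \<theta>
      assume \<theta>: "is_subst \<theta>" and j: "\<forall>A\<in>#{#nat_fm j#}. \<Gamma> \<tturnstile> subst \<theta> A"
        and "seq_clause \<Gamma> (subst \<theta> (suc_tm j)) (subst \<theta> l) (subst \<theta> (b \<^bold>& c))"
      from this(3) show "\<Gamma> \<tturnstile> subst \<theta> (?Q (suc_tm j))"
      proof cases
        case (amp b' c' j')
        have "\<Gamma> \<tturnstile> seq_fm (subst \<theta> j) (subst \<theta> l) (subst \<theta> b)"
          by (rule seq_conv_right[of _ _ _ b']) (use amp \<theta> typing in \<open>auto intro: conv_sym\<close>)
        moreover have "\<Gamma> \<tturnstile> seq_fm (subst \<theta> j) (subst \<theta> l) (subst \<theta> c)"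
          by (rule seq_conv_right[of _ _ _ c']) (use amp \<theta> typing in \<open>auto intro: conv_sym\<close>)
        ultimately show ?thesis using j by (auto intro: seq_mono)
      qed auto
    qed (use that typing in auto)
  qed
  then show "\<Gamma> \<tturnstile> seq_fm i l b" "\<Gamma> \<tturnstile> seq_fm i l c" by auto
qed

lemma seq_impE:
  assumes "\<Gamma> \<tturnstile> nat_fm i" "\<Gamma> \<tturnstile> seq_fm i l (a \<^bold>\<Rightarrow> b)"
  shows "\<Gamma> \<tturnstile> seq_fm i (a \<^bold># l) b"
proof -
  let ?Q = "\<lambda>i. seq_fm i (a \<^bold># l) b"
  have typing: "typed l Tlst" "typed a Tatm" "typed b Tprp" using assms(2) by auto
  show ?thesis
  proof (rule seq_nat_cases[OF assms, where Q = ?Q])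
    show "predicate Tnt ?Q" using typing by (simp add: predicate_def)
    show "\<Gamma> \<tturnstile> ?Q zero_tm" if "\<Gamma> \<tturnstile> seq_fm zero_tm l (a \<^bold>\<Rightarrow> b)" for \<Gamma>
      by (rule seq_defL[OF that, where \<Delta> = "{#}"]) (use typing in \<open>auto elim: seq_clause.cases\<close>)
    show "\<Gamma> \<tturnstile> ?Q (suc_tm j)" if "\<Gamma> \<tturnstile> nat_fm j" "\<Gamma> \<tturnstile> seq_fm (suc_tm j) l (a \<^bold>\<Rightarrow> b)" for \<Gamma> j
    proof (rule seq_defL[OF that(2), where \<Delta> = "{#nat_fm j#}"])
      fix \<Gamma> \<theta>
      assume \<theta>: "is_subst \<theta>" and j: "\<forall>A\<in>#{#nat_fm j#}. \<Gamma> \<tturnstile> subst \<theta> A"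
        and "seq_clause \<Gamma> (subst \<theta> (suc_tm j)) (subst \<theta> l) (subst \<theta> (a \<^bold>\<Rightarrow> b))"
      from this(3) show "\<Gamma> \<tturnstile> subst \<theta> (?Q (suc_tm j))"
        by cases (use \<theta> j typing in \<open>auto intro!: seq_mono elim!: seq_conv intro: conv_sym\<close>)
    qed (use that typing in auto)
  qed
qed

lemma seq_allE:
  assumes "\<Gamma> \<tturnstile> nat_fm i" "\<Gamma> \<tturnstile> seq_fm i l (\<^bold>\<And> f)" "typed x Ti"
  shows "\<Gamma> \<tturnstile> seq_fm i l (f \<cdot> x)"
proof -
  let ?Q = "\<lambda>i. seq_fm i l (f \<cdot> x)"
  have typing: "typed l Tlst" "typed f Tip" using assms(2) by auto
  show ?thesis
  proof (rule seq_nat_cases[OF assms(1,2), where Q = ?Q])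
    show "predicate Tnt ?Q" using typing assms(3) by (simp add: predicate_def)
    show "\<Gamma> \<tturnstile> ?Q zero_tm" if "\<Gamma> \<tturnstile> seq_fm zero_tm l (\<^bold>\<And> f)" for \<Gamma>
      by (rule seq_defL[OF that, where \<Delta> = "{#}"])
        (use typing assms(3) in \<open>auto elim: seq_clause.cases\<close>)
    show "\<Gamma> \<tturnstile> ?Q (suc_tm j)" if "\<Gamma> \<tturnstile> nat_fm j" "\<Gamma> \<tturnstile> seq_fm (suc_tm j) l (\<^bold>\<And> f)" for \<Gamma> j
    proof (rule seq_defL[OF that(2), where \<Delta> = "{#nat_fm j#}"])
      fix \<Gamma> \<theta>
      assume \<theta>: "is_subst \<theta>" and j: "\<forall>A\<in>#{#nat_fm j#}. \<Gamma> \<tturnstile> subst \<theta> A"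
        and "seq_clause \<Gamma> (subst \<theta> (suc_tm j)) (subst \<theta> l) (subst \<theta> (\<^bold>\<And> f))"
      from this(3) show "\<Gamma> \<tturnstile> subst \<theta> (?Q (suc_tm j))"
      proof cases
        case (all f' j')
        then have "\<Gamma> \<tturnstile> seq_fm (subst \<theta> j) (subst \<theta> l) (f' \<cdot> subst \<theta> x)" using \<theta> assms(3) by simp
        moreover have "f' \<cdot> subst \<theta> x \<approx> subst \<theta> f \<cdot> subst \<theta> x"
          using all by (auto intro: conv_app conv_sym)
        ultimately have "\<Gamma> \<tturnstile> seq_fm (subst \<theta> j) (subst \<theta> l) (subst \<theta> f \<cdot> subst \<theta> x)"
          by (rule seq_conv_right) (use \<theta> typing assms(3) in simp)
        then show ?thesis using j by (auto intro: seq_mono)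
      qed auto
    qed (use that typing assms(3) in auto)
  qed
qed

lemma seq_zero_atom_nilE:
  assumes "\<Gamma> \<tturnstile> seq_fm zero_tm nil_tm \<^bold>\<langle>a\<^bold>\<rangle>" "formula C"
  shows "\<Gamma> \<tturnstile> C"
proof (rule entails_botE[OF _ assms(2)])
  show "\<Gamma> \<tturnstile> \<^bold>\<bottom>"
    by (rule seq_defL[OF assms(1), where \<Delta> = "{#}"]) (auto elim!: seq_clause.cases elim: element_nilE)
qed

lemma seq_suc_atom_nilE:
  assumes "\<Gamma> \<tturnstile> seq_fm (suc_tm i) nil_tm \<^bold>\<langle>a\<^bold>\<rangle>"
    and continuation: "\<And>\<Gamma>' g. \<Gamma> \<sqsubseteq> \<Gamma>' \<Longrightarrow> \<Gamma>' \<tturnstile> prog_fm a g \<Longrightarrow> \<Gamma>' \<tturnstile> seq_fm i nil_tm g \<Longrightarrow> \<Gamma>' \<tturnstile> C"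
  shows "\<Gamma> \<tturnstile> C"
proof -
  let ?ex = "\<lambda>a i. Exists Tprp (prog_fm a (Bnd 0) \<^bold>\<and> seq_fm i nil_tm (Bnd 0))"
  have typing: "typed i Tnt" "typed a Tatm" using assms(1) by auto
  have "\<Gamma> \<tturnstile> ?ex a i"
  proof (rule seq_defL[OF assms(1), where \<Delta> = "{#}"])
    fix \<Gamma> \<theta>
    assume \<theta>: "is_subst \<theta>"
      and "seq_clause \<Gamma> (subst \<theta> (suc_tm i)) (subst \<theta> nil_tm) (subst \<theta> \<^bold>\<langle>a\<^bold>\<rangle>)"
    from this(2) show "\<Gamma> \<tturnstile> subst \<theta> (?ex a i)"
    proof cases
      case (element a')
      then show ?thesis using \<theta> typing by (auto elim!: element_nilE)
    next
      case (prog a' g j)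
      then have "\<Gamma> \<tturnstile> prog_fm (subst \<theta> a) g"
        using \<theta> typing by (auto elim!: entails_patom_conv intro: conv_sym)
      then show ?thesis using prog \<theta> typing by (auto intro!: entails_exI[where t = g])
    qed auto
  qed (use typing in auto)
  then show ?thesis
  proof (rule entails_exE)
    fix \<Gamma>' g assume "\<Gamma> \<sqsubseteq> \<Gamma>'" "typed g Tprp"
      "\<Gamma>' \<tturnstile> inst (prog_fm a (Bnd 0) \<^bold>\<and> seq_fm i nil_tm (Bnd 0)) 0 g"
    then show "\<Gamma>' \<tturnstile> C" using typing by (intro continuation) auto
  qed
qed

lemma seq_atom_nilE:
  assumes "\<Gamma> \<tturnstile> nat_fm i" "\<Gamma> \<tturnstile> seq_fm i nil_tm \<^bold>\<langle>a\<^bold>\<rangle>"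
    and continuation: "\<And>\<Gamma>' g. \<Gamma> \<sqsubseteq> \<Gamma>' \<Longrightarrow> \<Gamma>' \<tturnstile> prog_fm a g \<Longrightarrow> \<Gamma>' \<tturnstile> seq_fm i nil_tm g \<Longrightarrow> \<Gamma>' \<tturnstile> C"
  shows "\<Gamma> \<tturnstile> C"
proof -
  let ?ex = "\<lambda>i. Exists Tprp (prog_fm a (Bnd 0) \<^bold>\<and> seq_fm (lift i 0) nil_tm (Bnd 0))"
  have typing: "typed i Tnt" "typed a Tatm" using assms(2) by auto
  have "\<Gamma> \<tturnstile> ?ex i"
  proof (rule seq_nat_cases[OF assms(1,2), where Q = ?ex])
    show "predicate Tnt ?ex" using typing by (simp add: predicate_def inst_lift_le)
    show "\<Gamma> \<tturnstile> ?ex zero_tm" if "\<Gamma> \<tturnstile> seq_fm zero_tm nil_tm \<^bold>\<langle>a\<^bold>\<rangle>" for \<Gamma>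
      by (rule seq_zero_atom_nilE[OF that]) (use typing in simp)
    show "\<Gamma> \<tturnstile> ?ex (suc_tm j)" if "\<Gamma> \<tturnstile> nat_fm j" "\<Gamma> \<tturnstile> seq_fm (suc_tm j) nil_tm \<^bold>\<langle>a\<^bold>\<rangle>" for \<Gamma> j
      using that(2)
    proof (rule seq_suc_atom_nilE)
      fix \<Gamma>' g assume "\<Gamma> \<sqsubseteq> \<Gamma>'" "\<Gamma>' \<tturnstile> prog_fm a g" "\<Gamma>' \<tturnstile> seq_fm j nil_tm g"
      then show "\<Gamma>' \<tturnstile> ?ex (suc_tm j)" using typing seq_mono[OF entails_mono[OF that(1)]]
        by (intro entails_exI[where t = g]) auto
    qed
  qed
  then show ?thesis
  proof (rule entails_exE)
    fix \<Gamma>' g assume "\<Gamma> \<sqsubseteq> \<Gamma>'" "typed g Tprp"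
      "\<Gamma>' \<tturnstile> inst (prog_fm a (Bnd 0) \<^bold>\<and> seq_fm (lift i 0) nil_tm (Bnd 0)) 0 g"
    then show "\<Gamma>' \<tturnstile> C" using typing by (intro continuation) auto
  qed
qed


section \<open>Equality of object-level terms\<close>

lemma equiv_refl: "typed m Ti \<Longrightarrow> \<Gamma> \<tturnstile> m \<^bold>\<equiv> m"
  by (simp add: equivI)

lemma equiv_sym:
  assumes "\<Gamma> \<tturnstile> m \<^bold>\<equiv> n"
  shows "\<Gamma> \<tturnstile> n \<^bold>\<equiv> m"
proof (rule equiv_subst[OF assms, where P = "\<lambda>x. x \<^bold>\<equiv> m"])
  have "typed m Ti" using assms by auto
  then show "\<Gamma> \<tturnstile> m \<^bold>\<equiv> m" "predicate Ti (\<lambda>x. x \<^bold>\<equiv> m)" by (simp_all add: equivI predicate_def)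
qed

lemma equiv_trans:
  assumes "\<Gamma> \<tturnstile> l \<^bold>\<equiv> m" "\<Gamma> \<tturnstile> m \<^bold>\<equiv> n"
  shows "\<Gamma> \<tturnstile> l \<^bold>\<equiv> n"
proof (rule equiv_subst[where P = "\<lambda>x. l \<^bold>\<equiv> x", OF assms(2,1)])
  have "typed l Ti" using assms(1) by auto
  then show "predicate Ti (\<lambda>x. l \<^bold>\<equiv> x)" by (simp add: predicate_def)
qed

lemma equiv_app_cong:
  assumes "\<Gamma> \<tturnstile> m \<^bold>\<equiv> m'" "typed n Ti"
  shows "\<Gamma> \<tturnstile> app_tm m n \<^bold>\<equiv> app_tm m' n"
proof (rule equiv_subst[OF assms(1), where P = "\<lambda>x. app_tm m n \<^bold>\<equiv> app_tm x n"])
  have "typed m Ti" using assms(1) by auto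
  with assms(2) show "\<Gamma> \<tturnstile> app_tm m n \<^bold>\<equiv> app_tm m n" "predicate Ti (\<lambda>x. app_tm m n \<^bold>\<equiv> app_tm x n)"
    by (simp_all add: equivI predicate_def)
qed

lemma equiv_fun_cong:
  assumes "\<Gamma> \<tturnstile> m \<^bold>\<equiv> n" "typed r Tii"
  shows "\<Gamma> \<tturnstile> (r \<cdot> m) \<^bold>\<equiv> (r \<cdot> n)"
proof (rule equiv_subst[OF assms(1), where P = "\<lambda>x. (r \<cdot> m) \<^bold>\<equiv> (r \<cdot> x)"])
  have "typed m Ti" using assms(1) by auto
  with assms(2) show "\<Gamma> \<tturnstile> (r \<cdot> m) \<^bold>\<equiv> (r \<cdot> m)" "predicate Ti (\<lambda>x. (r \<cdot> m) \<^bold>\<equiv> (r \<cdot> x))"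
    by (simp_all add: equivI predicate_def)
qed

lemma equiv_app_inject:
  assumes "\<Gamma> \<tturnstile> app_tm m n \<^bold>\<equiv> app_tm m' n'"
  shows "\<Gamma> \<tturnstile> m \<^bold>\<equiv> m'" "\<Gamma> \<tturnstile> n \<^bold>\<equiv> n'"
proof -
  have "\<Gamma> \<tturnstile> m \<^bold>\<equiv> m' \<^bold>\<and> n \<^bold>\<equiv> n'"
    by (rule equiv_defL[OF assms, where \<Delta> = "{#}"])
      (use entails_typed(5)[OF assms] in \<open>auto intro: equivI\<close>)
  then show "\<Gamma> \<tturnstile> m \<^bold>\<equiv> m'" "\<Gamma> \<tturnstile> n \<^bold>\<equiv> n'" by auto
qed

lemma equiv_arr_inject:
  assumes "\<Gamma> \<tturnstile> arr_tm t u \<^bold>\<equiv> arr_tm t' u'"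
  shows "\<Gamma> \<tturnstile> t \<^bold>\<equiv> t'" "\<Gamma> \<tturnstile> u \<^bold>\<equiv> u'"
proof -
  have "\<Gamma> \<tturnstile> t \<^bold>\<equiv> t' \<^bold>\<and> u \<^bold>\<equiv> u'"
    by (rule equiv_defL[OF assms, where \<Delta> = "{#}"])
      (use entails_typed(5)[OF assms] in \<open>auto intro: equivI\<close>)
  then show "\<Gamma> \<tturnstile> t \<^bold>\<equiv> t'" "\<Gamma> \<tturnstile> u \<^bold>\<equiv> u'" by auto
qed

lemma equiv_abs_inst:
  assumes "\<Gamma> \<tturnstile> abs_tm r \<^bold>\<equiv> abs_tm r'" "typed n Ti"
  shows "\<Gamma> \<tturnstile> (r \<cdot> n) \<^bold>\<equiv> (r' \<cdot> n)"
  by (rule equiv_defL[OF assms(1), where \<Delta> = "{#}"])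
    (use assms(2) entails_typed(5)[OF assms(1)] in \<open>auto intro!: equivI conv_app\<close>)

lemma equiv_abs_app_E:
  assumes "\<Gamma> \<tturnstile> abs_tm r \<^bold>\<equiv> app_tm m n" "formula C"
  shows "\<Gamma> \<tturnstile> C"
  by (rule entails_botE[OF _ assms(2)], rule equiv_defL[OF assms(1), where \<Delta> = "{#}"]) auto


section \<open>Provability of object-level judgements\<close>

lemma bind_lift: "i \<le> k \<Longrightarrow> bind v (Suc k) (lift t i) = lift (bind v k t) i"
  by (induction t arbitrary: i k) auto

lemma wff_provable [simp]: "wff (\<^bold>\<turnstile> b)"
  by (simp add: provable_def)

lemma has_type_provable [simp]: "has_type \<Delta> (\<^bold>\<turnstile> b) T \<longleftrightarrow> T = To \<and> has_type \<Delta> b Tprp"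
  by (auto simp: provable_def)

lemma formula_provable [simp]: "formula (\<^bold>\<turnstile> b) \<longleftrightarrow> typed b Tprp"
  by (simp add: formula_def)

lemma inst_provable [simp]: "inst (\<^bold>\<turnstile> b) k s = \<^bold>\<turnstile> (inst b k s)"
  by (simp add: provable_def inst_lift_le)

lemma bind_provable [simp]: "bind v k (\<^bold>\<turnstile> b) = \<^bold>\<turnstile> (bind v k b)"
  by (simp add: provable_def bind_lift)

lemma entails_provable_typed [dest]: "\<Gamma> \<tturnstile> \<^bold>\<turnstile> b \<Longrightarrow> typed b Tprp"
  by (auto dest: entails_formula)

lemma provableI: "\<Gamma> \<tturnstile> nat_fm i \<Longrightarrow> \<Gamma> \<tturnstile> seq_fm i nil_tm b \<Longrightarrow> \<Gamma> \<tturnstile> \<^bold>\<turnstile> b"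
  unfolding provable_def using entails_typed(3)[of \<Gamma> i nil_tm b]
  by (intro entails_exI[where t = i]) auto

lemma provableE:
  assumes "\<Gamma> \<tturnstile> \<^bold>\<turnstile> b"
    and continuation: "\<And>\<Gamma>' i. \<Gamma> \<sqsubseteq> \<Gamma>' \<Longrightarrow> \<Gamma>' \<tturnstile> nat_fm i \<Longrightarrow> \<Gamma>' \<tturnstile> seq_fm i nil_tm b \<Longrightarrow> \<Gamma>' \<tturnstile> C"
  shows "\<Gamma> \<tturnstile> C"
  using assms(1)[unfolded provable_def]
proof (rule entails_exE)
  fix \<Gamma>' i assume "\<Gamma> \<sqsubseteq> \<Gamma>'" "typed i Tnt"
    "\<Gamma>' \<tturnstile> inst (nat_fm (Bnd 0) \<^bold>\<and> seq_fm (Bnd 0) nil_tm (lift b 0)) 0 i"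
  then show "\<Gamma>' \<tturnstile> C" using entails_provable_typed[OF assms(1)] by (intro continuation) auto
qed

lemma provable_atomE:
  assumes "\<Gamma> \<tturnstile> \<^bold>\<turnstile> \<^bold>\<langle>a\<^bold>\<rangle>"
    and continuation: "\<And>\<Gamma>' i g. \<Gamma> \<sqsubseteq> \<Gamma>' \<Longrightarrow> \<Gamma>' \<tturnstile> nat_fm i \<Longrightarrow> \<Gamma>' \<tturnstile> prog_fm a g \<Longrightarrow>
      \<Gamma>' \<tturnstile> seq_fm i nil_tm g \<Longrightarrow> \<Gamma>' \<tturnstile> C"
  shows "\<Gamma> \<tturnstile> C"
  using assms(1)
proof (rule provableE)
  fix \<Gamma>' i assume \<Gamma>': "\<Gamma> \<sqsubseteq> \<Gamma>'" and i: "\<Gamma>' \<tturnstile> nat_fm i" and "\<Gamma>' \<tturnstile> seq_fm i nil_tm \<^bold>\<langle>a\<^bold>\<rangle>"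
  from i this(3) show "\<Gamma>' \<tturnstile> C"
  proof (rule seq_atom_nilE)
    fix \<Gamma>'' g assume "\<Gamma>' \<sqsubseteq> \<Gamma>''" "\<Gamma>'' \<tturnstile> prog_fm a g" "\<Gamma>'' \<tturnstile> seq_fm i nil_tm g"
    then show "\<Gamma>'' \<tturnstile> C" using \<Gamma>' entails_mono[OF i] by (intro continuation[of \<Gamma>'' i g]) auto
  qed
qed

lemma provable_tt: "\<Gamma> \<tturnstile> \<^bold>\<turnstile> tt_tm"
  by (rule provableI[OF entails_nat_zero seq_ttI]) auto

lemma provable_progI:
  assumes "prog_clause a g" "\<Gamma> \<tturnstile> \<^bold>\<turnstile> g"
  shows "\<Gamma> \<tturnstile> \<^bold>\<turnstile> \<^bold>\<langle>a\<^bold>\<rangle>"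
  using assms(2)
  by (rule provableE) (rule provableI[OF entails_nat_suc seq_progI[OF prog_defR[OF assms(1)]]])

lemma provable_ampI:
  assumes "\<Gamma> \<tturnstile> \<^bold>\<turnstile> b" "\<Gamma> \<tturnstile> \<^bold>\<turnstile> c"
  shows "\<Gamma> \<tturnstile> \<^bold>\<turnstile> (b \<^bold>& c)"
  using assms(1)
proof (rule provableE)
  fix \<Gamma>' i assume \<Gamma>': "\<Gamma> \<sqsubseteq> \<Gamma>'" and i: "\<Gamma>' \<tturnstile> nat_fm i" and b: "\<Gamma>' \<tturnstile> seq_fm i nil_tm b"
  from entails_mono[OF assms(2) \<Gamma>'] show "\<Gamma>' \<tturnstile> \<^bold>\<turnstile> (b \<^bold>& c)"
  proof (rule provableE)
    fix \<Gamma>'' j assume \<Gamma>'': "\<Gamma>' \<sqsubseteq> \<Gamma>''" and j: "\<Gamma>'' \<tturnstile> nat_fm j" and c: "\<Gamma>'' \<tturnstile> seq_fm j nil_tm c"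
    show "\<Gamma>'' \<tturnstile> \<^bold>\<turnstile> (b \<^bold>& c)"
      using entails_mono[OF i \<Gamma>''] entails_mono[OF b \<Gamma>''] j c
      by (rule seq_maxE) (rule provableI[OF entails_nat_suc seq_ampI])
  qed
qed

lemma provable_cut:
  assumes i: "\<Gamma> \<tturnstile> nat_fm i" and b: "\<Gamma> \<tturnstile> seq_fm i (a \<^bold># nil_tm) b" and a: "\<Gamma> \<tturnstile> \<^bold>\<turnstile> \<^bold>\<langle>a\<^bold>\<rangle>"
  shows "\<Gamma> \<tturnstile> \<^bold>\<turnstile> b"
  using a
proof (rule provableE)
  fix \<Gamma>' k assume \<Gamma>': "\<Gamma> \<sqsubseteq> \<Gamma>'" and k: "\<Gamma>' \<tturnstile> nat_fm k" and a: "\<Gamma>' \<tturnstile> seq_fm k nil_tm \<^bold>\<langle>a\<^bold>\<rangle>"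
  let ?P = "\<lambda>x. seq_fm k nil_tm \<^bold>\<langle>x\<^bold>\<rangle>"
  have typing: "typed k Tnt" "typed a Tatm" using a by auto
  have ctx: "\<Gamma>' \<tturnstile> ctx_le_fm k (a \<^bold># nil_tm) nil_tm"
  proof (rule entails_ctx_leI)
    fix \<Gamma>'' x assume \<Gamma>'': "\<Gamma>' \<sqsubseteq> \<Gamma>''" and x: "\<Gamma>'' \<tturnstile> element_fm x (a \<^bold># nil_tm)"
    show "\<Gamma>'' \<tturnstile> ?P x"
    proof (rule element_ConsE[OF x, where P = ?P])
      show "predicate Tatm ?P" using typing by (simp add: predicate_def)
      show "\<Gamma>'' \<tturnstile> ?P a" using a \<Gamma>'' by (rule entails_mono)
      show "\<Gamma>''' \<tturnstile> ?P x" if "\<Gamma>''' \<tturnstile> element_fm x nil_tm" for \<Gamma>'''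
        by (rule element_nilE[OF that]) (use x typing in auto)
    qed
  qed (use typing in auto)
  show "\<Gamma>' \<tturnstile> \<^bold>\<turnstile> b"
    using entails_mono[OF i \<Gamma>'] k
  proof (rule cut_boundE)
    fix \<Gamma>'' k'
    assume \<Gamma>'': "\<Gamma>' \<sqsubseteq> \<Gamma>''" and k': "\<Gamma>'' \<tturnstile> nat_fm k'" and "\<Gamma>'' \<tturnstile> cut_bound_fm i k k'"
    from cut_bound_imp_seq_le(2)[OF this(3) entails_mono[OF ctx \<Gamma>'']]
    have "\<Gamma>'' \<tturnstile> seq_fm k' nil_tm b"
      by (rule entails_seq_leD) (use \<Gamma>' \<Gamma>'' in \<open>auto intro: entails_mono[OF b]\<close>)
    with k' show "\<Gamma>'' \<tturnstile> \<^bold>\<turnstile> b" by (rule provableI)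
  qed
qed

lemma provable_eval_abs: "typed r Tii \<Longrightarrow> \<Gamma> \<tturnstile> \<^bold>\<turnstile> \<^bold>\<langle>abs_tm r \<^bold>\<Down> abs_tm r\<^bold>\<rangle>"
  by (rule provable_progI[OF eval_abs provable_tt])

lemma provable_eval_app:
  assumes "\<Gamma> \<tturnstile> \<^bold>\<turnstile> \<^bold>\<langle>m \<^bold>\<Down> abs_tm r\<^bold>\<rangle>" "\<Gamma> \<tturnstile> \<^bold>\<turnstile> \<^bold>\<langle>(r \<cdot> n) \<^bold>\<Down> v\<^bold>\<rangle>" "typed n Ti"
  shows "\<Gamma> \<tturnstile> \<^bold>\<turnstile> \<^bold>\<langle>app_tm m n \<^bold>\<Down> v\<^bold>\<rangle>"
  by (rule provable_progI[OF eval_app provable_ampI[OF assms(1,2)]])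
    (use assms(3) entails_provable_typed[OF assms(1)] entails_provable_typed[OF assms(2)] in auto)

lemma provable_red_beta:
  "typed r Tii \<Longrightarrow> typed n Ti \<Longrightarrow> \<Gamma> \<tturnstile> \<^bold>\<turnstile> \<^bold>\<langle>app_tm (abs_tm r) n \<^bold>\<leadsto> (r \<cdot> n)\<^bold>\<rangle>"
  by (rule provable_progI[OF red_beta provable_tt])

lemma provable_red_app:
  assumes "\<Gamma> \<tturnstile> \<^bold>\<turnstile> \<^bold>\<langle>m \<^bold>\<leadsto> m'\<^bold>\<rangle>" "typed n Ti"
  shows "\<Gamma> \<tturnstile> \<^bold>\<turnstile> \<^bold>\<langle>app_tm m n \<^bold>\<leadsto> app_tm m' n\<^bold>\<rangle>"
  by (rule provable_progI[OF red_app assms(1)])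
    (use assms(2) entails_provable_typed[OF assms(1)] in auto)

lemma provable_reds_refl: "typed m Ti \<Longrightarrow> \<Gamma> \<tturnstile> \<^bold>\<turnstile> \<^bold>\<langle>m \<^bold>\<leadsto>\<^sup>* m\<^bold>\<rangle>"
  by (rule provable_progI[OF reds_refl provable_tt])

lemma provable_reds_step:
  assumes "\<Gamma> \<tturnstile> \<^bold>\<turnstile> \<^bold>\<langle>m \<^bold>\<leadsto> m'\<^bold>\<rangle>" "\<Gamma> \<tturnstile> \<^bold>\<turnstile> \<^bold>\<langle>m' \<^bold>\<leadsto>\<^sup>* n\<^bold>\<rangle>"
  shows "\<Gamma> \<tturnstile> \<^bold>\<turnstile> \<^bold>\<langle>m \<^bold>\<leadsto>\<^sup>* n\<^bold>\<rangle>"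
  by (rule provable_progI[OF reds_step provable_ampI[OF assms]])
    (use entails_provable_typed[OF assms(1)] entails_provable_typed[OF assms(2)] in auto)

lemma provable_typeof_app:
  assumes "\<Gamma> \<tturnstile> \<^bold>\<turnstile> \<^bold>\<langle>typeof_tm m (arr_tm u t)\<^bold>\<rangle>" "\<Gamma> \<tturnstile> \<^bold>\<turnstile> \<^bold>\<langle>typeof_tm n u\<^bold>\<rangle>"
  shows "\<Gamma> \<tturnstile> \<^bold>\<turnstile> \<^bold>\<langle>typeof_tm (app_tm m n) t\<^bold>\<rangle>"
  by (rule provable_progI[OF typeof_app provable_ampI[OF assms]])
    (use entails_provable_typed[OF assms(1)] entails_provable_typed[OF assms(2)] in auto)


section \<open>Case analysis on program clauses\<close>

lemma prog_clause_typed: "prog_clause a g \<Longrightarrow> typed g Tprp"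
  using prog_defR entails_typed(4) by blast

lemma prog_seq_defL:
  assumes "\<Gamma> \<tturnstile> prog_fm a g" "\<Gamma> \<tturnstile> seq_fm i nil_tm g" "formula C"
    and clause: "\<And>\<Gamma> \<theta> a' g'. prog_clause a' g' \<Longrightarrow> is_subst \<theta> \<Longrightarrow> subst \<theta> a \<approx> a' \<Longrightarrow>
      \<Gamma> \<tturnstile> seq_fm (subst \<theta> i) nil_tm g' \<Longrightarrow> \<Gamma> \<tturnstile> subst \<theta> C"
  shows "\<Gamma> \<tturnstile> C"
proof (rule prog_defL[OF assms(1,3), where \<Delta> = "{#seq_fm i nil_tm g#}"])
  fix \<Gamma> \<theta> a' g'
  assume \<theta>: "is_subst \<theta>" and a': "prog_clause a' g'" "subst \<theta> a \<approx> a'" and g': "subst \<theta> g \<approx> g'"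
    and "\<forall>A\<in>#{#seq_fm i nil_tm g#}. \<Gamma> \<tturnstile> subst \<theta> A"
  then have "\<Gamma> \<tturnstile> seq_fm (subst \<theta> i) nil_tm (subst \<theta> g)" by simp
  then have "\<Gamma> \<tturnstile> seq_fm (subst \<theta> i) nil_tm g'"
    using g' prog_clause_typed[OF a'(1)] by (rule seq_conv_right)
  with a' \<theta> show "\<Gamma> \<tturnstile> subst \<theta> C" by (intro clause)
qed (use assms in auto)

lemma seq_typeof_bodyE:
  assumes "\<Gamma> \<tturnstile> nat_fm i" "typed n Ti"
    and "\<Gamma> \<tturnstile> seq_fm i nil_tm (\<^bold>\<And> (Lam (typeof_tm (Bnd 0) u \<^bold>\<Rightarrow> \<^bold>\<langle>typeof_tm (r \<cdot> Bnd 0) w\<^bold>\<rangle>)))"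
    and typing: "typed r Tii" "typed u Ti" "typed w Ti"
  shows "\<Gamma> \<tturnstile> seq_fm i (typeof_tm n u \<^bold># nil_tm) \<^bold>\<langle>typeof_tm (r \<cdot> n) w\<^bold>\<rangle>"
proof (rule seq_impE[OF assms(1)])
  let ?body = "typeof_tm (Bnd 0) u \<^bold>\<Rightarrow> \<^bold>\<langle>typeof_tm (r \<cdot> Bnd 0) w\<^bold>\<rangle>"
  have "Lam ?body \<cdot> n \<approx> typeof_tm n u \<^bold>\<Rightarrow> \<^bold>\<langle>typeof_tm (r \<cdot> n) w\<^bold>\<rangle>"
    using conv_beta[of ?body n] typing by simp
  then show "\<Gamma> \<tturnstile> seq_fm i nil_tm (typeof_tm n u \<^bold>\<Rightarrow> \<^bold>\<langle>typeof_tm (r \<cdot> n) w\<^bold>\<rangle>)"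
    by (rule seq_conv_right[OF seq_allE[OF assms(1,3,2)]]) (use assms(2) typing in simp)
qed

lemma eval_cases:
  assumes "\<Gamma> \<tturnstile> nat_fm i" "\<Gamma> \<tturnstile> prog_fm (m \<^bold>\<Down> v) g" "\<Gamma> \<tturnstile> seq_fm i nil_tm g"
    and abs: "\<And>\<Gamma>' r. \<Gamma> \<sqsubseteq> \<Gamma>' \<Longrightarrow> typed r Tii \<Longrightarrow> \<Gamma>' \<tturnstile> m \<^bold>\<equiv> abs_tm r \<Longrightarrow> \<Gamma>' \<tturnstile> v \<^bold>\<equiv> abs_tm r \<Longrightarrow>
      \<Gamma>' \<tturnstile> C"
    and app: "\<And>\<Gamma>' m' n r. \<Gamma> \<sqsubseteq> \<Gamma>' \<Longrightarrow> \<Gamma>' \<tturnstile> m \<^bold>\<equiv> app_tm m' n \<Longrightarrow>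
      \<Gamma>' \<tturnstile> seq_fm i nil_tm \<^bold>\<langle>m' \<^bold>\<Down> abs_tm r\<^bold>\<rangle> \<Longrightarrow> \<Gamma>' \<tturnstile> seq_fm i nil_tm \<^bold>\<langle>(r \<cdot> n) \<^bold>\<Down> v\<^bold>\<rangle> \<Longrightarrow> \<Gamma>' \<tturnstile> C"
  shows "\<Gamma> \<tturnstile> C"
proof -
  let ?abs = "\<lambda>m v. Exists Tii (m \<^bold>\<equiv> abs_tm (Bnd 0) \<^bold>\<and> v \<^bold>\<equiv> abs_tm (Bnd 0))"
  let ?app = "\<lambda>m v i. Exists Ti (Exists Ti (Exists Tii (m \<^bold>\<equiv> app_tm (Bnd 2) (Bnd 1) \<^bold>\<and>
    seq_fm i nil_tm (\<^bold>\<langle>Bnd 2 \<^bold>\<Down> abs_tm (Bnd 0)\<^bold>\<rangle> \<^bold>& \<^bold>\<langle>(Bnd 0 \<cdot> Bnd 1) \<^bold>\<Down> v\<^bold>\<rangle>))))"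
  have typing: "typed i Tnt" "typed m Ti" "typed v Ti" using assms(1,2) by auto
  have "\<Gamma> \<tturnstile> ?abs m v \<^bold>\<or> ?app m v i"
  proof (rule prog_seq_defL[OF assms(2,3)])
    fix \<Gamma> \<theta> a' g'
    assume "prog_clause a' g'" and \<theta>: "is_subst \<theta>" and a': "subst \<theta> (m \<^bold>\<Down> v) \<approx> a'"
      and g': "\<Gamma> \<tturnstile> seq_fm (subst \<theta> i) nil_tm g'"
    from this(1) a' show "\<Gamma> \<tturnstile> subst \<theta> (?abs m v \<^bold>\<or> ?app m v i)"
    proof cases
      case (eval_abs r)
      then have "\<Gamma> \<tturnstile> ?abs (subst \<theta> m) (subst \<theta> v)"
        using \<theta> typing a' by (auto intro!: entails_exI[where t = r] equivI)
      then show ?thesis using \<theta> typing by (simp add: entails_orI1)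
    next
      case (eval_app m' n v' r)
      then have "\<Gamma> \<tturnstile> seq_fm (subst \<theta> i) nil_tm (\<^bold>\<langle>m' \<^bold>\<Down> abs_tm r\<^bold>\<rangle> \<^bold>& \<^bold>\<langle>(r \<cdot> n) \<^bold>\<Down> subst \<theta> v\<^bold>\<rangle>)"
        using a' \<theta> typing by (intro seq_conv_right[OF g']) (auto intro: conv_sym)
      then have "\<Gamma> \<tturnstile> ?app (subst \<theta> m) (subst \<theta> v) (subst \<theta> i)"
        using eval_app \<theta> typing a'
        by (auto intro!: entails_ex3I[where t = m' and u = n and v = r] equivI)
      then show ?thesis using \<theta> typing by (simp add: entails_orI2)
    qed auto
  qed (use typing in auto)
  then show ?thesis
  proof (rule entails_orE)
    fix \<Gamma>' assume \<Gamma>': "\<Gamma> \<sqsubseteq> \<Gamma>'" and "\<Gamma>' \<tturnstile> ?abs m v"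
    from this(2) show "\<Gamma>' \<tturnstile> C"
      by (rule entails_exE) (rule abs, use \<Gamma>' typing in auto)
  next
    fix \<Gamma>' assume \<Gamma>': "\<Gamma> \<sqsubseteq> \<Gamma>'" and "\<Gamma>' \<tturnstile> ?app m v i"
    from this(2) show "\<Gamma>' \<tturnstile> C"
      by (rule entails_ex3E)
        (rule app, use \<Gamma>' typing in \<open>auto intro: seq_ampE[OF entails_mono[OF assms(1)]]\<close>)
  qed
qed

lemma red_cases:
  assumes "\<Gamma> \<tturnstile> nat_fm i" "\<Gamma> \<tturnstile> prog_fm (m \<^bold>\<leadsto> v) g" "\<Gamma> \<tturnstile> seq_fm i nil_tm g"
    and beta: "\<And>\<Gamma>' r n. \<Gamma> \<sqsubseteq> \<Gamma>' \<Longrightarrow> typed r Tii \<Longrightarrow> typed n Ti \<Longrightarrow>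
      \<Gamma>' \<tturnstile> m \<^bold>\<equiv> app_tm (abs_tm r) n \<Longrightarrow> \<Gamma>' \<tturnstile> v \<^bold>\<equiv> (r \<cdot> n) \<Longrightarrow> \<Gamma>' \<tturnstile> C"
    and app: "\<And>\<Gamma>' m' n m''. \<Gamma> \<sqsubseteq> \<Gamma>' \<Longrightarrow> \<Gamma>' \<tturnstile> m \<^bold>\<equiv> app_tm m' n \<Longrightarrow> \<Gamma>' \<tturnstile> v \<^bold>\<equiv> app_tm m'' n \<Longrightarrow>
      \<Gamma>' \<tturnstile> seq_fm i nil_tm \<^bold>\<langle>m' \<^bold>\<leadsto> m''\<^bold>\<rangle> \<Longrightarrow> \<Gamma>' \<tturnstile> C"
  shows "\<Gamma> \<tturnstile> C"
proof -
  let ?beta = "\<lambda>m v. Exists Tii (Exists Ti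
    (m \<^bold>\<equiv> app_tm (abs_tm (Bnd 1)) (Bnd 0) \<^bold>\<and> v \<^bold>\<equiv> (Bnd 1 \<cdot> Bnd 0)))"
  let ?app = "\<lambda>m v i. Exists Ti (Exists Ti (Exists Ti (m \<^bold>\<equiv> app_tm (Bnd 2) (Bnd 1) \<^bold>\<and>
    v \<^bold>\<equiv> app_tm (Bnd 0) (Bnd 1) \<^bold>\<and> seq_fm i nil_tm \<^bold>\<langle>Bnd 2 \<^bold>\<leadsto> Bnd 0\<^bold>\<rangle>)))"
  have typing: "typed i Tnt" "typed m Ti" "typed v Ti" using assms(1,2) by auto
  have "\<Gamma> \<tturnstile> ?beta m v \<^bold>\<or> ?app m v i"
  proof (rule prog_seq_defL[OF assms(2,3)])
    fix \<Gamma> \<theta> a' g'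
    assume "prog_clause a' g'" and \<theta>: "is_subst \<theta>" and a': "subst \<theta> (m \<^bold>\<leadsto> v) \<approx> a'"
      and g': "\<Gamma> \<tturnstile> seq_fm (subst \<theta> i) nil_tm g'"
    from this(1) a' show "\<Gamma> \<tturnstile> subst \<theta> (?beta m v \<^bold>\<or> ?app m v i)"
    proof cases
      case (red_beta r n)
      then have "\<Gamma> \<tturnstile> ?beta (subst \<theta> m) (subst \<theta> v)"
        using \<theta> typing a' by (auto intro!: entails_ex2I[where t = r and u = n] equivI)
      then show ?thesis using \<theta> typing by (simp add: entails_orI1)
    next
      case (red_app m' n m'')
      then have "\<Gamma> \<tturnstile> ?app (subst \<theta> m) (subst \<theta> v) (subst \<theta> i)"
        using \<theta> typing a' g' by (auto intro!: entails_ex3I[where t = m' and u = n and v = m''] equivI)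
      then show ?thesis using \<theta> typing by (simp add: entails_orI2)
    qed auto
  qed (use typing in auto)
  then show ?thesis
  proof (rule entails_orE)
    fix \<Gamma>' assume \<Gamma>': "\<Gamma> \<sqsubseteq> \<Gamma>'" and "\<Gamma>' \<tturnstile> ?beta m v"
    from this(2) show "\<Gamma>' \<tturnstile> C"
      by (rule entails_ex2E) (rule beta, use \<Gamma>' typing in auto)
  next
    fix \<Gamma>' assume \<Gamma>': "\<Gamma> \<sqsubseteq> \<Gamma>'" and "\<Gamma>' \<tturnstile> ?app m v i"
    from this(2) show "\<Gamma>' \<tturnstile> C"
      by (rule entails_ex3E) (rule app, use \<Gamma>' typing in auto)
  qed
qed

lemma reds_cases:
  assumes "\<Gamma> \<tturnstile> nat_fm i" "\<Gamma> \<tturnstile> prog_fm (m \<^bold>\<leadsto>\<^sup>* v) g" "\<Gamma> \<tturnstile> seq_fm i nil_tm g"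
    and refl: "\<And>\<Gamma>'. \<Gamma> \<sqsubseteq> \<Gamma>' \<Longrightarrow> \<Gamma>' \<tturnstile> m \<^bold>\<equiv> v \<Longrightarrow> \<Gamma>' \<tturnstile> C"
    and step: "\<And>\<Gamma>' m'. \<Gamma> \<sqsubseteq> \<Gamma>' \<Longrightarrow> \<Gamma>' \<tturnstile> seq_fm i nil_tm \<^bold>\<langle>m \<^bold>\<leadsto> m'\<^bold>\<rangle> \<Longrightarrow>
      \<Gamma>' \<tturnstile> seq_fm i nil_tm \<^bold>\<langle>m' \<^bold>\<leadsto>\<^sup>* v\<^bold>\<rangle> \<Longrightarrow> \<Gamma>' \<tturnstile> C"
  shows "\<Gamma> \<tturnstile> C"
proof -
  let ?step = "\<lambda>m v i. Exists Ti (seq_fm i nil_tm (\<^bold>\<langle>m \<^bold>\<leadsto> Bnd 0\<^bold>\<rangle> \<^bold>& \<^bold>\<langle>Bnd 0 \<^bold>\<leadsto>\<^sup>* v\<^bold>\<rangle>))"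
  have typing: "typed i Tnt" "typed m Ti" "typed v Ti" using assms(1,2) by auto
  have "\<Gamma> \<tturnstile> m \<^bold>\<equiv> v \<^bold>\<or> ?step m v i"
  proof (rule prog_seq_defL[OF assms(2,3)])
    fix \<Gamma> \<theta> a' g'
    assume "prog_clause a' g'" and \<theta>: "is_subst \<theta>" and a': "subst \<theta> (m \<^bold>\<leadsto>\<^sup>* v) \<approx> a'"
      and g': "\<Gamma> \<tturnstile> seq_fm (subst \<theta> i) nil_tm g'"
    from this(1) a' show "\<Gamma> \<tturnstile> subst \<theta> (m \<^bold>\<equiv> v \<^bold>\<or> ?step m v i)"
    proof cases
      case (reds_refl n)
      then have "subst \<theta> m \<approx> n" "n \<approx> subst \<theta> v" using a' by (auto intro: conv_sym)
      then have "\<Gamma> \<tturnstile> subst \<theta> m \<^bold>\<equiv> subst \<theta> v" using \<theta> typing by (auto intro: equivI conv_trans)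
      then show ?thesis using \<theta> typing by (simp add: entails_orI1)
    next
      case (reds_step m1 v1 m')
      then have "\<Gamma> \<tturnstile> seq_fm (subst \<theta> i) nil_tm (\<^bold>\<langle>subst \<theta> m \<^bold>\<leadsto> m'\<^bold>\<rangle> \<^bold>& \<^bold>\<langle>m' \<^bold>\<leadsto>\<^sup>* subst \<theta> v\<^bold>\<rangle>)"
        using a' \<theta> typing by (intro seq_conv_right[OF g']) (auto intro: conv_sym)
      then have "\<Gamma> \<tturnstile> ?step (subst \<theta> m) (subst \<theta> v) (subst \<theta> i)"
        using reds_step \<theta> typing by (auto intro!: entails_exI[where t = m'])
      then show ?thesis using \<theta> typing by (simp add: entails_orI2)
    qed auto
  qed (use typing in auto)
  then show ?thesis
  proof (rule entails_orE)
    fix \<Gamma>' assume \<Gamma>': "\<Gamma> \<sqsubseteq> \<Gamma>'" and "\<Gamma>' \<tturnstile> ?step m v i"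
    from this(2) show "\<Gamma>' \<tturnstile> C"
      by (rule entails_exE)
        (rule step, use \<Gamma>' typing in \<open>auto intro: seq_ampE[OF entails_mono[OF assms(1)]]\<close>)
  qed (rule refl)
qed

lemma typeof_cases_fm:
  assumes i: "\<Gamma> \<tturnstile> nat_fm i" and prog: "\<Gamma> \<tturnstile> prog_fm (typeof_tm m t) g" and seq: "\<Gamma> \<tturnstile> seq_fm i nil_tm g"
  shows "\<Gamma> \<tturnstile>
    Exists Tii (Exists Ti (Exists Ti (m \<^bold>\<equiv> abs_tm (Bnd 2) \<^bold>\<and> t \<^bold>\<equiv> arr_tm (Bnd 1) (Bnd 0) \<^bold>\<and> seq_fm i nil_tm
      (\<^bold>\<And> (Lam (typeof_tm (Bnd 0) (Bnd 2) \<^bold>\<Rightarrow> \<^bold>\<langle>typeof_tm (Bnd 3 \<cdot> Bnd 0) (Bnd 1)\<^bold>\<rangle>)))))) \<^bold>\<or>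
    Exists Ti (Exists Ti (Exists Ti (m \<^bold>\<equiv> app_tm (Bnd 2) (Bnd 1) \<^bold>\<and> seq_fm i nil_tm
      (\<^bold>\<langle>typeof_tm (Bnd 2) (arr_tm (Bnd 0) t)\<^bold>\<rangle> \<^bold>& \<^bold>\<langle>typeof_tm (Bnd 1) (Bnd 0)\<^bold>\<rangle>))))"
    (is "\<Gamma> \<tturnstile> ?abs m t i \<^bold>\<or> ?app m t i")
proof (rule prog_seq_defL[OF prog seq])
  have typing: "typed i Tnt" "typed m Ti" "typed t Ti" using i prog by auto
  then show "formula (?abs m t i \<^bold>\<or> ?app m t i)" by auto
  fix \<Gamma> \<theta> a' g'
  assume "prog_clause a' g'" and \<theta>: "is_subst \<theta>" and a': "subst \<theta> (typeof_tm m t) \<approx> a'"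
    and g': "\<Gamma> \<tturnstile> seq_fm (subst \<theta> i) nil_tm g'"
  from this(1) a' show "\<Gamma> \<tturnstile> subst \<theta> (?abs m t i \<^bold>\<or> ?app m t i)"
  proof cases
    case (typeof_abs r u w)
    then have "\<Gamma> \<tturnstile> ?abs (subst \<theta> m) (subst \<theta> t) (subst \<theta> i)"
      using \<theta> typing a' g' by (auto intro!: entails_ex3I[where t = r and u = u and v = w] equivI)
    then show ?thesis using \<theta> typing by (simp add: entails_orI1)
  next
    case (typeof_app m' n t' u)
    then have "\<Gamma> \<tturnstile> seq_fm (subst \<theta> i) nil_tm
        (\<^bold>\<langle>typeof_tm m' (arr_tm u (subst \<theta> t))\<^bold>\<rangle> \<^bold>& \<^bold>\<langle>typeof_tm n u\<^bold>\<rangle>)"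
      using a' \<theta> typing by (intro seq_conv_right[OF g']) (auto intro: conv_sym)
    then have "\<Gamma> \<tturnstile> ?app (subst \<theta> m) (subst \<theta> t) (subst \<theta> i)"
      using typeof_app \<theta> typing a'
      by (auto intro!: entails_ex3I[where t = m' and u = n and v = u] equivI)
    then show ?thesis using \<theta> typing by (simp add: entails_orI2)
  qed auto
qed

lemma typeof_cases:
  assumes "\<Gamma> \<tturnstile> nat_fm i" "\<Gamma> \<tturnstile> prog_fm (typeof_tm m t) g" "\<Gamma> \<tturnstile> seq_fm i nil_tm g"
    and abs: "\<And>\<Gamma>' r u w. \<Gamma> \<sqsubseteq> \<Gamma>' \<Longrightarrow> typed r Tii \<Longrightarrow> \<Gamma>' \<tturnstile> m \<^bold>\<equiv> abs_tm r \<Longrightarrow>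
      \<Gamma>' \<tturnstile> t \<^bold>\<equiv> arr_tm u w \<Longrightarrow>
      (\<And>n. typed n Ti \<Longrightarrow> \<Gamma>' \<tturnstile> seq_fm i (typeof_tm n u \<^bold># nil_tm) \<^bold>\<langle>typeof_tm (r \<cdot> n) w\<^bold>\<rangle>) \<Longrightarrow> \<Gamma>' \<tturnstile> C"
    and app: "\<And>\<Gamma>' m' n u. \<Gamma> \<sqsubseteq> \<Gamma>' \<Longrightarrow> \<Gamma>' \<tturnstile> m \<^bold>\<equiv> app_tm m' n \<Longrightarrow>
      \<Gamma>' \<tturnstile> seq_fm i nil_tm \<^bold>\<langle>typeof_tm m' (arr_tm u t)\<^bold>\<rangle> \<Longrightarrow>
      \<Gamma>' \<tturnstile> seq_fm i nil_tm \<^bold>\<langle>typeof_tm n u\<^bold>\<rangle> \<Longrightarrow> \<Gamma>' \<tturnstile> C"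
  shows "\<Gamma> \<tturnstile> C"
proof -
  have typing: "typed i Tnt" "typed m Ti" "typed t Ti" using assms(1,2) by auto
  show ?thesis
  proof ((rule entails_orE[OF typeof_cases_fm[OF assms(1-3)]]; erule entails_ex3E), goal_cases abs app)
    case (abs \<Gamma>' \<Gamma>'' r u w)
    then show ?case using typing
      by (intro assms(4)) (auto intro: seq_typeof_bodyE[OF entails_mono[OF assms(1)]])
  next
    case (app \<Gamma>' \<Gamma>'' m' n u)
    then show ?case using typing
      by (intro assms(5)) (auto intro: seq_ampE[OF entails_mono[OF assms(1)]])
  qed
qed


section \<open>Induction and inversion for object-level judgements\<close>

definition predicate2 :: "(tm \<Rightarrow> tm \<Rightarrow> tm) \<Rightarrow> bool" where
  "predicate2 P \<longleftrightarrow> wff (P (Bnd 1) (Bnd 0)) \<and> has_type [Ti, Ti] (P (Bnd 1) (Bnd 0)) To \<and>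
    (\<forall>m v k s. inst (P m v) k s = P (inst m k s) (inst v k s))"

lemma predicate2_fix_left:
  assumes "predicate2 P" "typed m Ti"
  shows "predicate Ti (P m)"
proof -
  let ?b = "P (Bnd 1) (Bnd 0)"
  have "wff ?b" "has_type [Ti, Ti] ?b To" using assms(1) by (auto simp: predicate2_def)
  then have "wff (inst ?b 1 m)" "has_type [Ti] (inst ?b 1 m) To"
    using wff_inst has_type_inst[OF assms(2), of "[Ti]" "[]" ?b To] by auto
  then show ?thesis using assms by (simp add: predicate_def predicate2_def)
qed

lemma predicate2_fix_right:
  assumes "predicate2 P" "typed v Ti"
  shows "predicate Ti (\<lambda>m. P m v)"
proof -
  let ?b = "P (Bnd 1) (Bnd 0)"
  have "wff ?b" "has_type [Ti, Ti] ?b To" using assms(1) by (auto simp: predicate2_def)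
  then have "wff (inst ?b 0 v)" "has_type [Ti] (inst ?b 0 v) To"
    using wff_inst has_type_inst_Cons[of Ti "[Ti]" ?b To v] assms(2) by auto
  then show ?thesis using assms by (simp add: predicate_def predicate2_def)
qed

lemma predicate2_formula: "predicate2 P \<Longrightarrow> typed m Ti \<Longrightarrow> typed v Ti \<Longrightarrow> formula (P m v)"
  by (rule predicate_formula[OF predicate2_fix_left])

lemma equiv_subst2:
  assumes "\<Gamma> \<tturnstile> m \<^bold>\<equiv> m'" "\<Gamma> \<tturnstile> v \<^bold>\<equiv> v'" "\<Gamma> \<tturnstile> P m' v'" and pred_P: "predicate2 P"
  shows "\<Gamma> \<tturnstile> P m v"
proof -
  have "\<Gamma> \<tturnstile> P m v'"
    by (rule equiv_subst[OF equiv_sym[OF assms(1)], where P = "\<lambda>m. P m v'"])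
      (use assms predicate2_fix_right entails_typed(5)[OF assms(2)] in auto)
  then show ?thesis
    by (rule equiv_subst[OF equiv_sym[OF assms(2)]])
      (use pred_P predicate2_fix_left entails_typed(5)[OF assms(1)] in auto)
qed

abbreviation is_judgement :: "fsym \<Rightarrow> bool" where
  "is_judgement c \<equiv> fsym_type c = Ti \<rightarrow>\<^sub>t Ti \<rightarrow>\<^sub>t Tatm"

abbreviation judgement_tm :: "fsym \<Rightarrow> tm \<Rightarrow> tm \<Rightarrow> tm" where
  "judgement_tm c m v \<equiv> Cst (Fn c) \<cdot> m \<cdot> v"

lemma predicate2_provable:
  "is_judgement c \<Longrightarrow> predicate2 (\<lambda>m v. \<^bold>\<turnstile> \<^bold>\<langle>judgement_tm c m v\<^bold>\<rangle>)"
  by (simp add: predicate2_def)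

lemma provable_equiv:
  assumes judgement: "is_judgement c"
    and "\<Gamma> \<tturnstile> m \<^bold>\<equiv> m'" "\<Gamma> \<tturnstile> v \<^bold>\<equiv> v'" "\<Gamma> \<tturnstile> \<^bold>\<turnstile> \<^bold>\<langle>judgement_tm c m' v'\<^bold>\<rangle>"
  shows "\<Gamma> \<tturnstile> \<^bold>\<turnstile> \<^bold>\<langle>judgement_tm c m v\<^bold>\<rangle>"
  using assms(2-4) predicate2_provable[OF judgement]
  by (rule equiv_subst2[where P = "\<lambda>m v. \<^bold>\<turnstile> \<^bold>\<langle>judgement_tm c m v\<^bold>\<rangle>"])

lemma judgement_typed:
  assumes "is_judgement c" "\<Gamma> \<tturnstile> seq_fm i l \<^bold>\<langle>judgement_tm c m v\<^bold>\<rangle>"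
  shows "typed m Ti" "typed v Ti"
  using entails_typed(3)[OF assms(2)] assms(1) by auto

definition at_height_fm :: "fsym \<Rightarrow> (tm \<Rightarrow> tm \<Rightarrow> tm) \<Rightarrow> tm \<Rightarrow> tm" where
  "at_height_fm c P i = Forall Ti (Forall Ti
    (seq_fm (lift (lift i 0) 0) nil_tm \<^bold>\<langle>judgement_tm c (Bnd 1) (Bnd 0)\<^bold>\<rangle> \<^bold>\<supset> P (Bnd 1) (Bnd 0)))"

lemma predicate_at_height:
  assumes "is_judgement c" "predicate2 P"
  shows "predicate Tnt (at_height_fm c P)"
proof -
  have "has_type [Ti, Ti, Tnt] (P (Bnd 1) (Bnd 0)) To"
    using assms(2) has_type_append[of "[Ti, Ti]" _ To "[Tnt]"] by (simp add: predicate2_def)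
  with assms show ?thesis
    by (simp add: predicate_def predicate2_def at_height_fm_def inst_lift_le)
qed

lemma entails_at_height_iff:
  assumes judgement: "is_judgement c" and pred_P: "predicate2 P" and i: "typed i Tnt"
  shows "\<Gamma> \<tturnstile> at_height_fm c P i \<longleftrightarrow>
    (\<forall>\<Gamma>' m v. \<Gamma> \<sqsubseteq> \<Gamma>' \<longrightarrow> \<Gamma>' \<tturnstile> seq_fm i nil_tm \<^bold>\<langle>judgement_tm c m v\<^bold>\<rangle> \<longrightarrow> \<Gamma>' \<tturnstile> P m v)"
proof -
  have "wff (P m (Bnd 0)) \<and> has_type [Ti] (P m (Bnd 0)) To" if "typed m Ti" for m
    using predicate2_fix_left[OF pred_P that] by (simp add: predicate_def)
  then have "\<Gamma> \<tturnstile> at_height_fm c P i \<longleftrightarrow> (\<forall>m v. typed m Ti \<longrightarrow> typed v Ti \<longrightarrow>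
      \<Gamma> \<tturnstile> seq_fm i nil_tm \<^bold>\<langle>judgement_tm c m v\<^bold>\<rangle> \<^bold>\<supset> P m v)"
    using assms by (auto simp: at_height_fm_def entails_all_iff predicate2_def)
  also have "\<dots> \<longleftrightarrow> (\<forall>\<Gamma>' m v. \<Gamma> \<sqsubseteq> \<Gamma>' \<longrightarrow>
      \<Gamma>' \<tturnstile> seq_fm i nil_tm \<^bold>\<langle>judgement_tm c m v\<^bold>\<rangle> \<longrightarrow> \<Gamma>' \<tturnstile> P m v)"
    using judgement i predicate2_formula[OF pred_P]
    by (simp add: entails_imp_iff) (metis judgement_typed[OF judgement])
  finally show ?thesis .
qed

lemma judgement_induct:
  assumes judgement: "is_judgement c" and pred_P: "predicate2 P"
    and "\<Gamma> \<tturnstile> \<^bold>\<turnstile> \<^bold>\<langle>judgement_tm c m v\<^bold>\<rangle>"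
    and step: "\<And>\<Gamma> i m v g. \<Gamma> \<tturnstile> nat_fm i \<Longrightarrow> \<Gamma> \<tturnstile> prog_fm (judgement_tm c m v) g \<Longrightarrow>
      \<Gamma> \<tturnstile> seq_fm i nil_tm g \<Longrightarrow>
      (\<And>\<Gamma>' m v. \<Gamma> \<sqsubseteq> \<Gamma>' \<Longrightarrow> \<Gamma>' \<tturnstile> seq_fm i nil_tm \<^bold>\<langle>judgement_tm c m v\<^bold>\<rangle> \<Longrightarrow> \<Gamma>' \<tturnstile> P m v) \<Longrightarrow>
      \<Gamma> \<tturnstile> P m v"
  shows "\<Gamma> \<tturnstile> P m v"
  using assms(3)
proof (rule provableE)
  fix \<Gamma>' i assume i: "\<Gamma>' \<tturnstile> nat_fm i" and seq: "\<Gamma>' \<tturnstile> seq_fm i nil_tm \<^bold>\<langle>judgement_tm c m v\<^bold>\<rangle>"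
  note at_height_iff = entails_at_height_iff[OF judgement pred_P]
  from i predicate_at_height[OF judgement pred_P] have "\<Gamma>' \<tturnstile> at_height_fm c P i"
  proof (rule entails_nat_induct)
    have "\<Gamma> \<tturnstile> P m v" if "\<Gamma> \<tturnstile> seq_fm zero_tm nil_tm \<^bold>\<langle>judgement_tm c m v\<^bold>\<rangle>" for \<Gamma> m v
      using that predicate2_formula[OF pred_P judgement_typed[OF judgement that]]
      by (rule seq_zero_atom_nilE)
    moreover have "typed zero_tm Tnt" by simp
    ultimately show "\<Gamma> \<tturnstile> at_height_fm c P zero_tm" for \<Gamma> by (subst at_height_iff) blast+
  next
    fix \<Gamma> j assume j: "\<Gamma> \<tturnstile> nat_fm j" and IH: "\<Gamma> \<tturnstile> at_height_fm c P j"
    have "\<Gamma>' \<tturnstile> P m v"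
      if \<Gamma>': "\<Gamma> \<sqsubseteq> \<Gamma>'" and "\<Gamma>' \<tturnstile> seq_fm (suc_tm j) nil_tm \<^bold>\<langle>judgement_tm c m v\<^bold>\<rangle>" for \<Gamma>' m v
      using that(2)
    proof (rule seq_suc_atom_nilE)
      fix \<Gamma>'' g
      assume "\<Gamma>' \<sqsubseteq> \<Gamma>''" and g: "\<Gamma>'' \<tturnstile> prog_fm (judgement_tm c m v) g" "\<Gamma>'' \<tturnstile> seq_fm j nil_tm g"
      then have "\<Gamma> \<sqsubseteq> \<Gamma>''" using \<Gamma>' by blast
      from entails_mono[OF j this] g show "\<Gamma>'' \<tturnstile> P m v"
        by (rule step)
          (use entails_mono[OF IH \<open>\<Gamma> \<sqsubseteq> \<Gamma>''\<close>] at_height_iff[OF entails_typed(1)[OF j]] in blast)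
    qed
    moreover have "typed (suc_tm j) Tnt" using entails_typed(1)[OF j] by simp
    ultimately show "\<Gamma> \<tturnstile> at_height_fm c P (suc_tm j)" by (subst at_height_iff) blast+
  qed
  then show "\<Gamma>' \<tturnstile> P m v"
    using at_height_iff[OF entails_typed(1)[OF i]] seq by blast
qed

lemma eval_induct:
  assumes "\<Gamma> \<tturnstile> \<^bold>\<turnstile> \<^bold>\<langle>m \<^bold>\<Down> v\<^bold>\<rangle>" and pred_P: "predicate2 P"
    and abs: "\<And>\<Gamma> r. typed r Tii \<Longrightarrow> \<Gamma> \<tturnstile> P (abs_tm r) (abs_tm r)"
    and app: "\<And>\<Gamma> m n r v. \<Gamma> \<tturnstile> \<^bold>\<turnstile> \<^bold>\<langle>m \<^bold>\<Down> abs_tm r\<^bold>\<rangle> \<Longrightarrow> \<Gamma> \<tturnstile> P m (abs_tm r) \<Longrightarrow> typed n Ti \<Longrightarrow>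
      \<Gamma> \<tturnstile> \<^bold>\<turnstile> \<^bold>\<langle>(r \<cdot> n) \<^bold>\<Down> v\<^bold>\<rangle> \<Longrightarrow> \<Gamma> \<tturnstile> P (r \<cdot> n) v \<Longrightarrow> \<Gamma> \<tturnstile> P (app_tm m n) v"
  shows "\<Gamma> \<tturnstile> P m v"
proof (rule judgement_induct[OF _ pred_P assms(1)])
  fix \<Gamma> i m v g
  assume i: "\<Gamma> \<tturnstile> nat_fm i" and prog: "\<Gamma> \<tturnstile> prog_fm (m \<^bold>\<Down> v) g" and seq: "\<Gamma> \<tturnstile> seq_fm i nil_tm g"
    and IH: "\<And>\<Gamma>' m v. \<Gamma> \<sqsubseteq> \<Gamma>' \<Longrightarrow> \<Gamma>' \<tturnstile> seq_fm i nil_tm \<^bold>\<langle>m \<^bold>\<Down> v\<^bold>\<rangle> \<Longrightarrow> \<Gamma>' \<tturnstile> P m v"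
  from i prog seq show "\<Gamma> \<tturnstile> P m v"
  proof (rule eval_cases)
    fix \<Gamma>' r assume "typed r Tii" "\<Gamma>' \<tturnstile> m \<^bold>\<equiv> abs_tm r" "\<Gamma>' \<tturnstile> v \<^bold>\<equiv> abs_tm r"
    then show "\<Gamma>' \<tturnstile> P m v" using pred_P by (intro equiv_subst2[where P = P, OF _ _ abs])
  next
    fix \<Gamma>' m' n r
    assume \<Gamma>': "\<Gamma> \<sqsubseteq> \<Gamma>'" and m: "\<Gamma>' \<tturnstile> m \<^bold>\<equiv> app_tm m' n"
      and fn: "\<Gamma>' \<tturnstile> seq_fm i nil_tm \<^bold>\<langle>m' \<^bold>\<Down> abs_tm r\<^bold>\<rangle>"
      and val: "\<Gamma>' \<tturnstile> seq_fm i nil_tm \<^bold>\<langle>(r \<cdot> n) \<^bold>\<Down> v\<^bold>\<rangle>"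
    have "\<Gamma>' \<tturnstile> P (app_tm m' n) v"
      using provableI[OF entails_mono[OF i \<Gamma>'] fn] IH[OF \<Gamma>' fn] _
        provableI[OF entails_mono[OF i \<Gamma>'] val] IH[OF \<Gamma>' val]
      by (rule app) (use m in auto)
    then show "\<Gamma>' \<tturnstile> P m v"
      using m pred_P entails_typed(3)[OF val]
      by (intro equiv_subst2[where P = P, OF m equiv_refl]) auto
  qed
qed simp

lemma red_induct:
  assumes "\<Gamma> \<tturnstile> \<^bold>\<turnstile> \<^bold>\<langle>m \<^bold>\<leadsto> v\<^bold>\<rangle>" and pred_P: "predicate2 P"
    and beta: "\<And>\<Gamma> r n. typed r Tii \<Longrightarrow> typed n Ti \<Longrightarrow> \<Gamma> \<tturnstile> P (app_tm (abs_tm r) n) (r \<cdot> n)"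
    and app: "\<And>\<Gamma> m m' n. \<Gamma> \<tturnstile> \<^bold>\<turnstile> \<^bold>\<langle>m \<^bold>\<leadsto> m'\<^bold>\<rangle> \<Longrightarrow> \<Gamma> \<tturnstile> P m m' \<Longrightarrow> typed n Ti \<Longrightarrow>
      \<Gamma> \<tturnstile> P (app_tm m n) (app_tm m' n)"
  shows "\<Gamma> \<tturnstile> P m v"
proof (rule judgement_induct[OF _ pred_P assms(1)])
  fix \<Gamma> i m v g
  assume i: "\<Gamma> \<tturnstile> nat_fm i" and prog: "\<Gamma> \<tturnstile> prog_fm (m \<^bold>\<leadsto> v) g" and seq: "\<Gamma> \<tturnstile> seq_fm i nil_tm g"
    and IH: "\<And>\<Gamma>' m v. \<Gamma> \<sqsubseteq> \<Gamma>' \<Longrightarrow> \<Gamma>' \<tturnstile> seq_fm i nil_tm \<^bold>\<langle>m \<^bold>\<leadsto> v\<^bold>\<rangle> \<Longrightarrow> \<Gamma>' \<tturnstile> P m v"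
  from i prog seq show "\<Gamma> \<tturnstile> P m v"
  proof (rule red_cases)
    fix \<Gamma>' r n
    assume "typed r Tii" "typed n Ti" "\<Gamma>' \<tturnstile> m \<^bold>\<equiv> app_tm (abs_tm r) n" "\<Gamma>' \<tturnstile> v \<^bold>\<equiv> (r \<cdot> n)"
    then show "\<Gamma>' \<tturnstile> P m v" using pred_P by (intro equiv_subst2[where P = P, OF _ _ beta])
  next
    fix \<Gamma>' m' n m''
    assume \<Gamma>': "\<Gamma> \<sqsubseteq> \<Gamma>'" and m: "\<Gamma>' \<tturnstile> m \<^bold>\<equiv> app_tm m' n" and v: "\<Gamma>' \<tturnstile> v \<^bold>\<equiv> app_tm m'' n"
      and red: "\<Gamma>' \<tturnstile> seq_fm i nil_tm \<^bold>\<langle>m' \<^bold>\<leadsto> m''\<^bold>\<rangle>"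
    have "\<Gamma>' \<tturnstile> P (app_tm m' n) (app_tm m'' n)"
      using provableI[OF entails_mono[OF i \<Gamma>'] red] IH[OF \<Gamma>' red] by (rule app) (use m in auto)
    with m v show "\<Gamma>' \<tturnstile> P m v" using pred_P by (rule equiv_subst2[where P = P])
  qed
qed simp

lemma reds_induct:
  assumes "\<Gamma> \<tturnstile> \<^bold>\<turnstile> \<^bold>\<langle>m \<^bold>\<leadsto>\<^sup>* v\<^bold>\<rangle>" and pred_P: "predicate2 P"
    and refl: "\<And>\<Gamma> m. typed m Ti \<Longrightarrow> \<Gamma> \<tturnstile> P m m"
    and step: "\<And>\<Gamma> m m' v. \<Gamma> \<tturnstile> \<^bold>\<turnstile> \<^bold>\<langle>m \<^bold>\<leadsto> m'\<^bold>\<rangle> \<Longrightarrow> \<Gamma> \<tturnstile> \<^bold>\<turnstile> \<^bold>\<langle>m' \<^bold>\<leadsto>\<^sup>* v\<^bold>\<rangle> \<Longrightarrow> \<Gamma> \<tturnstile> P m' v \<Longrightarrow>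
      \<Gamma> \<tturnstile> P m v"
  shows "\<Gamma> \<tturnstile> P m v"
proof (rule judgement_induct[OF _ pred_P assms(1)])
  fix \<Gamma> i m v g
  assume i: "\<Gamma> \<tturnstile> nat_fm i" and prog: "\<Gamma> \<tturnstile> prog_fm (m \<^bold>\<leadsto>\<^sup>* v) g" and seq: "\<Gamma> \<tturnstile> seq_fm i nil_tm g"
    and IH: "\<And>\<Gamma>' m v. \<Gamma> \<sqsubseteq> \<Gamma>' \<Longrightarrow> \<Gamma>' \<tturnstile> seq_fm i nil_tm \<^bold>\<langle>m \<^bold>\<leadsto>\<^sup>* v\<^bold>\<rangle> \<Longrightarrow> \<Gamma>' \<tturnstile> P m v"
  from i prog seq show "\<Gamma> \<tturnstile> P m v"
  proof (rule reds_cases)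
    fix \<Gamma>' assume mv: "\<Gamma>' \<tturnstile> m \<^bold>\<equiv> v"
    then have "typed v Ti" by auto
    then show "\<Gamma>' \<tturnstile> P m v" using mv pred_P
      by (intro equiv_subst2[where P = P, OF mv equiv_refl refl]) auto
  next
    fix \<Gamma>' m'
    assume \<Gamma>': "\<Gamma> \<sqsubseteq> \<Gamma>'" and red: "\<Gamma>' \<tturnstile> seq_fm i nil_tm \<^bold>\<langle>m \<^bold>\<leadsto> m'\<^bold>\<rangle>"
      and reds: "\<Gamma>' \<tturnstile> seq_fm i nil_tm \<^bold>\<langle>m' \<^bold>\<leadsto>\<^sup>* v\<^bold>\<rangle>"
    from provableI[OF entails_mono[OF i \<Gamma>'] red] provableI[OF entails_mono[OF i \<Gamma>'] reds] IH[OF \<Gamma>' reds]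
    show "\<Gamma>' \<tturnstile> P m v" by (rule step)
  qed
qed simp

lemma provable_eval_absE:
  assumes "\<Gamma> \<tturnstile> \<^bold>\<turnstile> \<^bold>\<langle>abs_tm r \<^bold>\<Down> v\<^bold>\<rangle>"
  shows "\<Gamma> \<tturnstile> abs_tm r \<^bold>\<equiv> v"
  using assms
proof (rule provable_atomE)
  fix \<Gamma>' i g
  assume "\<Gamma>' \<tturnstile> nat_fm i" and prog: "\<Gamma>' \<tturnstile> prog_fm (abs_tm r \<^bold>\<Down> v) g" and "\<Gamma>' \<tturnstile> seq_fm i nil_tm g"
  then show "\<Gamma>' \<tturnstile> abs_tm r \<^bold>\<equiv> v"
  proof (rule eval_cases)
    fix \<Gamma>'' r' assume "\<Gamma>'' \<tturnstile> abs_tm r \<^bold>\<equiv> abs_tm r'" "\<Gamma>'' \<tturnstile> v \<^bold>\<equiv> abs_tm r'"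
    then show "\<Gamma>'' \<tturnstile> abs_tm r \<^bold>\<equiv> v" by (rule equiv_trans[OF _ equiv_sym])
  next
    fix \<Gamma>'' m n assume "\<Gamma>'' \<tturnstile> abs_tm r \<^bold>\<equiv> app_tm m n"
    then show "\<Gamma>'' \<tturnstile> abs_tm r \<^bold>\<equiv> v" by (rule equiv_abs_app_E) (use prog in auto)
  qed
qed

lemma provable_eval_appE:
  assumes "\<Gamma> \<tturnstile> \<^bold>\<turnstile> \<^bold>\<langle>app_tm m n \<^bold>\<Down> v\<^bold>\<rangle>" "formula C"
    and continuation: "\<And>\<Gamma>' r. \<Gamma> \<sqsubseteq> \<Gamma>' \<Longrightarrow> \<Gamma>' \<tturnstile> \<^bold>\<turnstile> \<^bold>\<langle>m \<^bold>\<Down> abs_tm r\<^bold>\<rangle> \<Longrightarrow> \<Gamma>' \<tturnstile> \<^bold>\<turnstile> \<^bold>\<langle>(r \<cdot> n) \<^bold>\<Down> v\<^bold>\<rangle> \<Longrightarrow> \<Gamma>' \<tturnstile> C"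
  shows "\<Gamma> \<tturnstile> C"
  using assms(1)
proof (rule provable_atomE)
  fix \<Gamma>' i g
  assume \<Gamma>': "\<Gamma> \<sqsubseteq> \<Gamma>'" and i: "\<Gamma>' \<tturnstile> nat_fm i" and prog: "\<Gamma>' \<tturnstile> prog_fm (app_tm m n \<^bold>\<Down> v) g"
    and seq: "\<Gamma>' \<tturnstile> seq_fm i nil_tm g"
  from i prog seq show "\<Gamma>' \<tturnstile> C"
  proof (rule eval_cases)
    fix \<Gamma>'' r assume "\<Gamma>'' \<tturnstile> app_tm m n \<^bold>\<equiv> abs_tm r"
    from equiv_sym[OF this] assms(2) show "\<Gamma>'' \<tturnstile> C" by (rule equiv_abs_app_E)
  next
    fix \<Gamma>'' m' n' r
    assume \<Gamma>'': "\<Gamma>' \<sqsubseteq> \<Gamma>''" and eq: "\<Gamma>'' \<tturnstile> app_tm m n \<^bold>\<equiv> app_tm m' n'"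
      and fn: "\<Gamma>'' \<tturnstile> seq_fm i nil_tm \<^bold>\<langle>m' \<^bold>\<Down> abs_tm r\<^bold>\<rangle>"
      and val: "\<Gamma>'' \<tturnstile> seq_fm i nil_tm \<^bold>\<langle>(r \<cdot> n') \<^bold>\<Down> v\<^bold>\<rangle>"
    have r: "typed r Tii" and v: "typed v Ti"
      using entails_typed(3)[OF fn] entails_typed(3)[OF val] by auto
    have "\<Gamma>'' \<tturnstile> \<^bold>\<turnstile> \<^bold>\<langle>m \<^bold>\<Down> abs_tm r\<^bold>\<rangle>"
      using provableI[OF entails_mono[OF i \<Gamma>''] fn] r
      by (intro provable_equiv[OF _ equiv_app_inject(1)[OF eq] equiv_refl]) auto
    moreover have "\<Gamma>'' \<tturnstile> \<^bold>\<turnstile> \<^bold>\<langle>(r \<cdot> n) \<^bold>\<Down> v\<^bold>\<rangle>"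
      using provableI[OF entails_mono[OF i \<Gamma>''] val] v
      by (intro provable_equiv[OF _ equiv_fun_cong[OF equiv_app_inject(2)[OF eq] r] equiv_refl]) auto
    ultimately show "\<Gamma>'' \<tturnstile> C" using \<Gamma>' \<Gamma>'' by (intro continuation) auto
  qed
qed

lemma provable_red_absE:
  assumes "\<Gamma> \<tturnstile> \<^bold>\<turnstile> \<^bold>\<langle>abs_tm r \<^bold>\<leadsto> v\<^bold>\<rangle>" "formula C"
  shows "\<Gamma> \<tturnstile> C"
  using assms(1)
proof (rule provable_atomE)
  fix \<Gamma>' i g
  assume "\<Gamma>' \<tturnstile> nat_fm i" "\<Gamma>' \<tturnstile> prog_fm (abs_tm r \<^bold>\<leadsto> v) g" "\<Gamma>' \<tturnstile> seq_fm i nil_tm g"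
  then show "\<Gamma>' \<tturnstile> C" by (rule red_cases) (erule equiv_abs_app_E[OF _ assms(2)])+
qed

lemma provable_red_appE:
  assumes "\<Gamma> \<tturnstile> \<^bold>\<turnstile> \<^bold>\<langle>app_tm m n \<^bold>\<leadsto> v\<^bold>\<rangle>"
    and beta: "\<And>\<Gamma>' r. \<Gamma> \<sqsubseteq> \<Gamma>' \<Longrightarrow> typed r Tii \<Longrightarrow> \<Gamma>' \<tturnstile> m \<^bold>\<equiv> abs_tm r \<Longrightarrow>
      \<Gamma>' \<tturnstile> v \<^bold>\<equiv> (r \<cdot> n) \<Longrightarrow> \<Gamma>' \<tturnstile> C"
    and app: "\<And>\<Gamma>' m'. \<Gamma> \<sqsubseteq> \<Gamma>' \<Longrightarrow> \<Gamma>' \<tturnstile> \<^bold>\<turnstile> \<^bold>\<langle>m \<^bold>\<leadsto> m'\<^bold>\<rangle> \<Longrightarrow> \<Gamma>' \<tturnstile> v \<^bold>\<equiv> app_tm m' n \<Longrightarrow> \<Gamma>' \<tturnstile> C"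
  shows "\<Gamma> \<tturnstile> C"
  using assms(1)
proof (rule provable_atomE)
  fix \<Gamma>' i g
  assume \<Gamma>': "\<Gamma> \<sqsubseteq> \<Gamma>'" and i: "\<Gamma>' \<tturnstile> nat_fm i" and "\<Gamma>' \<tturnstile> prog_fm (app_tm m n \<^bold>\<leadsto> v) g"
    and "\<Gamma>' \<tturnstile> seq_fm i nil_tm g"
  from this(2-4) show "\<Gamma>' \<tturnstile> C"
  proof (rule red_cases)
    fix \<Gamma>'' r n'
    assume \<Gamma>'': "\<Gamma>' \<sqsubseteq> \<Gamma>''" and r: "typed r Tii"
      and eq: "\<Gamma>'' \<tturnstile> app_tm m n \<^bold>\<equiv> app_tm (abs_tm r) n'" and v: "\<Gamma>'' \<tturnstile> v \<^bold>\<equiv> (r \<cdot> n')"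
    have "\<Gamma>'' \<tturnstile> v \<^bold>\<equiv> (r \<cdot> n)"
      by (rule equiv_trans[OF v equiv_sym[OF equiv_fun_cong[OF equiv_app_inject(2)[OF eq] r]]])
    with equiv_app_inject(1)[OF eq] show "\<Gamma>'' \<tturnstile> C" using \<Gamma>' \<Gamma>'' r by (intro beta) auto
  next
    fix \<Gamma>'' m' n' m''
    assume \<Gamma>'': "\<Gamma>' \<sqsubseteq> \<Gamma>''" and eq: "\<Gamma>'' \<tturnstile> app_tm m n \<^bold>\<equiv> app_tm m' n'"
      and v: "\<Gamma>'' \<tturnstile> v \<^bold>\<equiv> app_tm m'' n'" and red: "\<Gamma>'' \<tturnstile> seq_fm i nil_tm \<^bold>\<langle>m' \<^bold>\<leadsto> m''\<^bold>\<rangle>"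
    have "typed m'' Ti" using entails_typed(3)[OF red] by auto
    then have "\<Gamma>'' \<tturnstile> v \<^bold>\<equiv> app_tm m'' n"
      using equiv_trans[OF v equiv_sym[OF equiv_fun_cong[OF equiv_app_inject(2)[OF eq]]]] by simp
    moreover have "\<Gamma>'' \<tturnstile> \<^bold>\<turnstile> \<^bold>\<langle>m \<^bold>\<leadsto> m''\<^bold>\<rangle>"
      using provableI[OF entails_mono[OF i \<Gamma>''] red] \<open>typed m'' Ti\<close>
      by (intro provable_equiv[OF _ equiv_app_inject(1)[OF eq] equiv_refl]) auto
    ultimately show "\<Gamma>'' \<tturnstile> C" using \<Gamma>' \<Gamma>'' by (intro app) auto
  qed
qed

lemma provable_typeof_appE:
  assumes "\<Gamma> \<tturnstile> \<^bold>\<turnstile> \<^bold>\<langle>typeof_tm (app_tm m n) t\<^bold>\<rangle>" "formula C"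
    and continuation: "\<And>\<Gamma>' u. \<Gamma> \<sqsubseteq> \<Gamma>' \<Longrightarrow> \<Gamma>' \<tturnstile> \<^bold>\<turnstile> \<^bold>\<langle>typeof_tm m (arr_tm u t)\<^bold>\<rangle> \<Longrightarrow>
      \<Gamma>' \<tturnstile> \<^bold>\<turnstile> \<^bold>\<langle>typeof_tm n u\<^bold>\<rangle> \<Longrightarrow> \<Gamma>' \<tturnstile> C"
  shows "\<Gamma> \<tturnstile> C"
  using assms(1)
proof (rule provable_atomE)
  fix \<Gamma>' i g
  assume \<Gamma>': "\<Gamma> \<sqsubseteq> \<Gamma>'" and i: "\<Gamma>' \<tturnstile> nat_fm i"
    and "\<Gamma>' \<tturnstile> prog_fm (typeof_tm (app_tm m n) t) g" "\<Gamma>' \<tturnstile> seq_fm i nil_tm g"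
  from this(2-4) show "\<Gamma>' \<tturnstile> C"
  proof (rule typeof_cases)
    fix \<Gamma>'' r assume "\<Gamma>'' \<tturnstile> app_tm m n \<^bold>\<equiv> abs_tm r"
    from equiv_sym[OF this] assms(2) show "\<Gamma>'' \<tturnstile> C" by (rule equiv_abs_app_E)
  next
    fix \<Gamma>'' m' n' u
    assume \<Gamma>'': "\<Gamma>' \<sqsubseteq> \<Gamma>''" and eq: "\<Gamma>'' \<tturnstile> app_tm m n \<^bold>\<equiv> app_tm m' n'"
      and fn: "\<Gamma>'' \<tturnstile> seq_fm i nil_tm \<^bold>\<langle>typeof_tm m' (arr_tm u t)\<^bold>\<rangle>"
      and arg: "\<Gamma>'' \<tturnstile> seq_fm i nil_tm \<^bold>\<langle>typeof_tm n' u\<^bold>\<rangle>"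
    have typing: "typed u Ti" "typed t Ti" using entails_typed(3)[OF fn] by auto
    have "\<Gamma>'' \<tturnstile> \<^bold>\<turnstile> \<^bold>\<langle>typeof_tm m (arr_tm u t)\<^bold>\<rangle>"
      using provableI[OF entails_mono[OF i \<Gamma>''] fn] typing
      by (intro provable_equiv[OF _ equiv_app_inject(1)[OF eq] equiv_refl]) auto
    moreover have "\<Gamma>'' \<tturnstile> \<^bold>\<turnstile> \<^bold>\<langle>typeof_tm n u\<^bold>\<rangle>"
      using provableI[OF entails_mono[OF i \<Gamma>''] arg] typing
      by (intro provable_equiv[OF _ equiv_app_inject(2)[OF eq] equiv_refl]) auto
    ultimately show "\<Gamma>'' \<tturnstile> C" using \<Gamma>' \<Gamma>'' by (intro continuation) auto
  qed
qed

text \<open>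
  Subject reduction for a \<open>\<beta>\<close>-redex: typing of the abstraction is a derivation under the
  hypothesis \<open>typeof n u\<close>, which the object-level cut discharges, so no substitution lemma for
  typing derivations is needed.
\<close>

lemma provable_typeof_beta:
  assumes abs: "\<Gamma> \<tturnstile> \<^bold>\<turnstile> \<^bold>\<langle>typeof_tm (abs_tm r) (arr_tm u t)\<^bold>\<rangle>"
    and arg: "\<Gamma> \<tturnstile> \<^bold>\<turnstile> \<^bold>\<langle>typeof_tm n u\<^bold>\<rangle>"
  shows "\<Gamma> \<tturnstile> \<^bold>\<turnstile> \<^bold>\<langle>typeof_tm (r \<cdot> n) t\<^bold>\<rangle>"
  using abs
proof (rule provable_atomE)
  have typing: "typed r Tii" "typed n Ti" "typed u Ti" "typed t Ti"
    using entails_provable_typed[OF abs] entails_provable_typed[OF arg] by auto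
  fix \<Gamma>' i g
  assume \<Gamma>': "\<Gamma> \<sqsubseteq> \<Gamma>'" and i: "\<Gamma>' \<tturnstile> nat_fm i"
    and "\<Gamma>' \<tturnstile> prog_fm (typeof_tm (abs_tm r) (arr_tm u t)) g" "\<Gamma>' \<tturnstile> seq_fm i nil_tm g"
  from this(2-4) show "\<Gamma>' \<tturnstile> \<^bold>\<turnstile> \<^bold>\<langle>typeof_tm (r \<cdot> n) t\<^bold>\<rangle>"
  proof (rule typeof_cases)
    fix \<Gamma>'' r' u' t'
    assume \<Gamma>'': "\<Gamma>' \<sqsubseteq> \<Gamma>''" and r: "\<Gamma>'' \<tturnstile> abs_tm r \<^bold>\<equiv> abs_tm r'"
      and t: "\<Gamma>'' \<tturnstile> arr_tm u t \<^bold>\<equiv> arr_tm u' t'"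
      and body: "\<And>n. typed n Ti \<Longrightarrow>
        \<Gamma>'' \<tturnstile> seq_fm i (typeof_tm n u' \<^bold># nil_tm) \<^bold>\<langle>typeof_tm (r' \<cdot> n) t'\<^bold>\<rangle>"
    have "\<Gamma> \<sqsubseteq> \<Gamma>''" using \<Gamma>' \<Gamma>'' by blast
    from equiv_refl[OF typing(2)] equiv_sym[OF equiv_arr_inject(1)[OF t]] entails_mono[OF arg \<open>\<Gamma> \<sqsubseteq> \<Gamma>''\<close>]
    have "\<Gamma>'' \<tturnstile> \<^bold>\<turnstile> \<^bold>\<langle>typeof_tm n u'\<^bold>\<rangle>" by (rule provable_equiv[rotated]) simp
    then have "\<Gamma>'' \<tturnstile> \<^bold>\<turnstile> \<^bold>\<langle>typeof_tm (r' \<cdot> n) t'\<^bold>\<rangle>"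
      by (rule provable_cut[OF entails_mono[OF i \<Gamma>''] body[OF typing(2)]])
    then show "\<Gamma>'' \<tturnstile> \<^bold>\<turnstile> \<^bold>\<langle>typeof_tm (r \<cdot> n) t\<^bold>\<rangle>"
      by (rule provable_equiv[OF _ equiv_abs_inst[OF r typing(2)] equiv_arr_inject(2)[OF t], rotated]) simp
  next
    fix \<Gamma>'' m' n' assume "\<Gamma>'' \<tturnstile> abs_tm r \<^bold>\<equiv> app_tm m' n'"
    then show "\<Gamma>'' \<tturnstile> \<^bold>\<turnstile> \<^bold>\<langle>typeof_tm (r \<cdot> n) t\<^bold>\<rangle>" by (rule equiv_abs_app_E) (use typing in simp)
  qed
qed


section \<open>Determinacy, equivalence and subject reduction\<close>

definition unique_fm :: "fsym \<Rightarrow> tm \<Rightarrow> tm \<Rightarrow> tm" where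
  "unique_fm c m v =
    Forall Ti (\<^bold>\<turnstile> \<^bold>\<langle>judgement_tm c (lift m 0) (Bnd 0)\<^bold>\<rangle> \<^bold>\<supset> lift v 0 \<^bold>\<equiv> Bnd 0)"

definition transfer_fm :: "fsym \<Rightarrow> tm \<Rightarrow> tm \<Rightarrow> tm" where
  "transfer_fm c m n =
    Forall Ti (\<^bold>\<turnstile> \<^bold>\<langle>judgement_tm c (lift m 0) (Bnd 0)\<^bold>\<rangle> \<^bold>\<supset> \<^bold>\<turnstile> \<^bold>\<langle>judgement_tm c (lift n 0) (Bnd 0)\<^bold>\<rangle>)"

lemma predicate2_unique:
  "is_judgement c \<Longrightarrow> predicate2 (unique_fm c)"
  by (simp add: predicate2_def unique_fm_def inst_lift_le)

lemma predicate2_transfer: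
  assumes "is_judgement c"
  shows "predicate2 (transfer_fm c)" "predicate2 (\<lambda>m n. transfer_fm c n m)"
  using assms by (simp_all add: predicate2_def transfer_fm_def inst_lift_le)

lemma entails_uniqueI:
  assumes "is_judgement c" "typed m Ti" "typed v Ti"
    and "\<And>\<Gamma>' w. \<Gamma> \<sqsubseteq> \<Gamma>' \<Longrightarrow> \<Gamma>' \<tturnstile> \<^bold>\<turnstile> \<^bold>\<langle>judgement_tm c m w\<^bold>\<rangle> \<Longrightarrow> \<Gamma>' \<tturnstile> v \<^bold>\<equiv> w"
  shows "\<Gamma> \<tturnstile> unique_fm c m v"
  unfolding unique_fm_def
proof (rule entails_allI)
  fix w assume "typed w Ti"
  then have "\<Gamma> \<tturnstile> \<^bold>\<turnstile> \<^bold>\<langle>judgement_tm c m w\<^bold>\<rangle> \<^bold>\<supset> v \<^bold>\<equiv> w"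
    using assms(1-3) by (intro entails_impI assms(4)) simp_all
  then show "\<Gamma> \<tturnstile> inst (\<^bold>\<turnstile> \<^bold>\<langle>judgement_tm c (lift m 0) (Bnd 0)\<^bold>\<rangle> \<^bold>\<supset> lift v 0 \<^bold>\<equiv> Bnd 0) 0 w"
    using assms(2,3) by simp
qed (use assms(1-3) in simp_all)

lemma entails_uniqueD:
  assumes "\<Gamma> \<tturnstile> unique_fm c m v" "\<Gamma> \<tturnstile> \<^bold>\<turnstile> \<^bold>\<langle>judgement_tm c m w\<^bold>\<rangle>"
    and judgement: "is_judgement c" and v: "typed v Ti"
  shows "\<Gamma> \<tturnstile> v \<^bold>\<equiv> w"
proof (rule entails_mp[OF _ assms(2)])
  have "typed m Ti" "typed w Ti" using entails_provable_typed[OF assms(2)] judgement by auto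
  with entails_allE[OF assms(1)[unfolded unique_fm_def], of w] v
  show "\<Gamma> \<tturnstile> \<^bold>\<turnstile> \<^bold>\<langle>judgement_tm c m w\<^bold>\<rangle> \<^bold>\<supset> v \<^bold>\<equiv> w" by simp
qed

lemma entails_transferI:
  assumes "is_judgement c" "typed m Ti" "typed n Ti"
    and "\<And>\<Gamma>' w. \<Gamma> \<sqsubseteq> \<Gamma>' \<Longrightarrow> \<Gamma>' \<tturnstile> \<^bold>\<turnstile> \<^bold>\<langle>judgement_tm c m w\<^bold>\<rangle> \<Longrightarrow> \<Gamma>' \<tturnstile> \<^bold>\<turnstile> \<^bold>\<langle>judgement_tm c n w\<^bold>\<rangle>"
  shows "\<Gamma> \<tturnstile> transfer_fm c m n"
  unfolding transfer_fm_def
proof (rule entails_allI)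
  fix w assume "typed w Ti"
  then have "\<Gamma> \<tturnstile> \<^bold>\<turnstile> \<^bold>\<langle>judgement_tm c m w\<^bold>\<rangle> \<^bold>\<supset> \<^bold>\<turnstile> \<^bold>\<langle>judgement_tm c n w\<^bold>\<rangle>"
    using assms(1-3) by (intro entails_impI assms(4)) simp_all
  then show "\<Gamma> \<tturnstile> inst (\<^bold>\<turnstile> \<^bold>\<langle>judgement_tm c (lift m 0) (Bnd 0)\<^bold>\<rangle> \<^bold>\<supset> \<^bold>\<turnstile> \<^bold>\<langle>judgement_tm c (lift n 0) (Bnd 0)\<^bold>\<rangle>) 0 w"
    using assms(2,3) by simp
qed (use assms(1-3) in simp_all)

lemma entails_transferD:
  assumes "\<Gamma> \<tturnstile> transfer_fm c m n" "\<Gamma> \<tturnstile> \<^bold>\<turnstile> \<^bold>\<langle>judgement_tm c m w\<^bold>\<rangle>"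
    and judgement: "is_judgement c" and n: "typed n Ti"
  shows "\<Gamma> \<tturnstile> \<^bold>\<turnstile> \<^bold>\<langle>judgement_tm c n w\<^bold>\<rangle>"
proof (rule entails_mp[OF _ assms(2)])
  have "typed m Ti" "typed w Ti" using entails_provable_typed[OF assms(2)] judgement by auto
  with entails_allE[OF assms(1)[unfolded transfer_fm_def], of w] n
  show "\<Gamma> \<tturnstile> \<^bold>\<turnstile> \<^bold>\<langle>judgement_tm c m w\<^bold>\<rangle> \<^bold>\<supset> \<^bold>\<turnstile> \<^bold>\<langle>judgement_tm c n w\<^bold>\<rangle>" by simp
qed

lemma eval_determinate:
  assumes "\<Gamma> \<tturnstile> \<^bold>\<turnstile> \<^bold>\<langle>m \<^bold>\<Down> v\<^bold>\<rangle>" "\<Gamma> \<tturnstile> \<^bold>\<turnstile> \<^bold>\<langle>m \<^bold>\<Down> w\<^bold>\<rangle>"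
  shows "\<Gamma> \<tturnstile> v \<^bold>\<equiv> w"
proof (rule entails_uniqueD[OF _ assms(2)])
  show "\<Gamma> \<tturnstile> unique_fm F_eval m v"
    using assms(1)
  proof (rule eval_induct)
    fix \<Gamma> r assume "typed r Tii"
    then show "\<Gamma> \<tturnstile> unique_fm F_eval (abs_tm r) (abs_tm r)"
      by (intro entails_uniqueI provable_eval_absE) simp_all
  next
    fix \<Gamma> m n r v
    assume fn: "\<Gamma> \<tturnstile> \<^bold>\<turnstile> \<^bold>\<langle>m \<^bold>\<Down> abs_tm r\<^bold>\<rangle>" and fn_unique: "\<Gamma> \<tturnstile> unique_fm F_eval m (abs_tm r)"
      and n: "typed n Ti" and val: "\<Gamma> \<tturnstile> \<^bold>\<turnstile> \<^bold>\<langle>(r \<cdot> n) \<^bold>\<Down> v\<^bold>\<rangle>"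
      and val_unique: "\<Gamma> \<tturnstile> unique_fm F_eval (r \<cdot> n) v"
    have typing: "typed m Ti" "typed r Tii" "typed v Ti"
      using entails_provable_typed[OF fn] entails_provable_typed[OF val] by auto
    show "\<Gamma> \<tturnstile> unique_fm F_eval (app_tm m n) v"
    proof (rule entails_uniqueI)
      fix \<Gamma>' w assume \<Gamma>': "\<Gamma> \<sqsubseteq> \<Gamma>'" and w: "\<Gamma>' \<tturnstile> \<^bold>\<turnstile> \<^bold>\<langle>app_tm m n \<^bold>\<Down> w\<^bold>\<rangle>"
      then have "typed w Ti" by auto
      with w typing show "\<Gamma>' \<tturnstile> v \<^bold>\<equiv> w"
      proof (elim provable_eval_appE)
        fix \<Gamma>'' r'
        assume "\<Gamma>' \<sqsubseteq> \<Gamma>''" and fn': "\<Gamma>'' \<tturnstile> \<^bold>\<turnstile> \<^bold>\<langle>m \<^bold>\<Down> abs_tm r'\<^bold>\<rangle>" and val': "\<Gamma>'' \<tturnstile> \<^bold>\<turnstile> \<^bold>\<langle>(r' \<cdot> n) \<^bold>\<Down> w\<^bold>\<rangle>"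
        then have \<Gamma>'': "\<Gamma> \<sqsubseteq> \<Gamma>''" using \<Gamma>' by blast
        have "\<Gamma>'' \<tturnstile> abs_tm r \<^bold>\<equiv> abs_tm r'"
          by (rule entails_uniqueD[OF entails_mono[OF fn_unique \<Gamma>''] fn']) (use typing in simp_all)
        from equiv_abs_inst[OF this n] equiv_refl[OF \<open>typed w Ti\<close>] val'
        have "\<Gamma>'' \<tturnstile> \<^bold>\<turnstile> \<^bold>\<langle>(r \<cdot> n) \<^bold>\<Down> w\<^bold>\<rangle>" by (rule provable_equiv[rotated]) simp
        then show "\<Gamma>'' \<tturnstile> v \<^bold>\<equiv> w"
          by (rule entails_uniqueD[OF entails_mono[OF val_unique \<Gamma>'']]) (use typing in simp_all)
      qed simp
    qed (use typing n in simp_all)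
  qed (simp add: predicate2_unique)
qed (use entails_provable_typed[OF assms(1)] in auto)

lemma red_beta_unique:
  assumes typing: "typed r Tii" "typed n Ti"
  shows "\<Gamma> \<tturnstile> unique_fm F_red (app_tm (abs_tm r) n) (r \<cdot> n)"
proof (rule entails_uniqueI)
  fix \<Gamma>' w assume red: "\<Gamma>' \<tturnstile> \<^bold>\<turnstile> \<^bold>\<langle>app_tm (abs_tm r) n \<^bold>\<leadsto> w\<^bold>\<rangle>"
  then have "typed w Ti" by auto
  from red show "\<Gamma>' \<tturnstile> (r \<cdot> n) \<^bold>\<equiv> w"
  proof (rule provable_red_appE)
    fix \<Gamma>'' r' assume "\<Gamma>'' \<tturnstile> abs_tm r \<^bold>\<equiv> abs_tm r'" and w: "\<Gamma>'' \<tturnstile> w \<^bold>\<equiv> (r' \<cdot> n)"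
    from this(1) typing(2) have "\<Gamma>'' \<tturnstile> (r \<cdot> n) \<^bold>\<equiv> (r' \<cdot> n)" by (rule equiv_abs_inst)
    then show "\<Gamma>'' \<tturnstile> (r \<cdot> n) \<^bold>\<equiv> w" using w by (rule equiv_trans[OF _ equiv_sym])
  next
    fix \<Gamma>'' m' assume "\<Gamma>'' \<tturnstile> \<^bold>\<turnstile> \<^bold>\<langle>abs_tm r \<^bold>\<leadsto> m'\<^bold>\<rangle>"
    then show "\<Gamma>'' \<tturnstile> (r \<cdot> n) \<^bold>\<equiv> w"
      by (rule provable_red_absE) (use typing \<open>typed w Ti\<close> in simp)
  qed
qed (use typing in simp_all)

lemma red_app_unique:
  assumes red: "\<Gamma> \<tturnstile> \<^bold>\<turnstile> \<^bold>\<langle>m \<^bold>\<leadsto> m'\<^bold>\<rangle>" and unique: "\<Gamma> \<tturnstile> unique_fm F_red m m'" and n: "typed n Ti"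
  shows "\<Gamma> \<tturnstile> unique_fm F_red (app_tm m n) (app_tm m' n)"
proof (rule entails_uniqueI)
  show typing: "typed (app_tm m n) Ti" "typed (app_tm m' n) Ti"
    using n entails_provable_typed[OF red] by auto
  fix \<Gamma>' w assume \<Gamma>': "\<Gamma> \<sqsubseteq> \<Gamma>'" and w: "\<Gamma>' \<tturnstile> \<^bold>\<turnstile> \<^bold>\<langle>app_tm m n \<^bold>\<leadsto> w\<^bold>\<rangle>"
  then have "typed w Ti" by auto
  from w show "\<Gamma>' \<tturnstile> app_tm m' n \<^bold>\<equiv> w"
  proof (rule provable_red_appE)
    fix \<Gamma>'' r assume "\<Gamma>' \<sqsubseteq> \<Gamma>''" and m: "\<Gamma>'' \<tturnstile> m \<^bold>\<equiv> abs_tm r"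
    then have "\<Gamma> \<sqsubseteq> \<Gamma>''" using \<Gamma>' by blast
    have "\<Gamma>'' \<tturnstile> m' \<^bold>\<equiv> m'" using typing by (auto intro: equiv_refl)
    from equiv_sym[OF m] this entails_mono[OF red \<open>\<Gamma> \<sqsubseteq> \<Gamma>''\<close>]
    have "\<Gamma>'' \<tturnstile> \<^bold>\<turnstile> \<^bold>\<langle>abs_tm r \<^bold>\<leadsto> m'\<^bold>\<rangle>" by (rule provable_equiv[rotated]) simp
    then show "\<Gamma>'' \<tturnstile> app_tm m' n \<^bold>\<equiv> w"
      by (rule provable_red_absE) (use typing \<open>typed w Ti\<close> in simp)
  next
    fix \<Gamma>'' m''
    assume "\<Gamma>' \<sqsubseteq> \<Gamma>''" and m'': "\<Gamma>'' \<tturnstile> \<^bold>\<turnstile> \<^bold>\<langle>m \<^bold>\<leadsto> m''\<^bold>\<rangle>" and w: "\<Gamma>'' \<tturnstile> w \<^bold>\<equiv> app_tm m'' n"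
    then have "\<Gamma> \<sqsubseteq> \<Gamma>''" using \<Gamma>' by blast
    have "\<Gamma>'' \<tturnstile> m' \<^bold>\<equiv> m''"
      by (rule entails_uniqueD[OF entails_mono[OF unique \<open>\<Gamma> \<sqsubseteq> \<Gamma>''\<close>] m'']) (use typing in auto)
    then show "\<Gamma>'' \<tturnstile> app_tm m' n \<^bold>\<equiv> w"
      using n by (intro equiv_trans[OF equiv_app_cong equiv_sym[OF w]])
  qed
qed simp

lemma red_determinate:
  assumes "\<Gamma> \<tturnstile> \<^bold>\<turnstile> \<^bold>\<langle>m \<^bold>\<leadsto> v\<^bold>\<rangle>" "\<Gamma> \<tturnstile> \<^bold>\<turnstile> \<^bold>\<langle>m \<^bold>\<leadsto> w\<^bold>\<rangle>"
  shows "\<Gamma> \<tturnstile> v \<^bold>\<equiv> w"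
proof (rule entails_uniqueD[OF _ assms(2)])
  have "predicate2 (unique_fm F_red)" by (simp add: predicate2_unique)
  with assms(1) show "\<Gamma> \<tturnstile> unique_fm F_red m v"
    using red_beta_unique red_app_unique by (rule red_induct)
qed (use entails_provable_typed[OF assms(1)] in auto)

lemma red_transfer_eval:
  assumes "\<Gamma> \<tturnstile> \<^bold>\<turnstile> \<^bold>\<langle>m \<^bold>\<leadsto> n\<^bold>\<rangle>"
  shows "\<Gamma> \<tturnstile> transfer_fm F_eval n m"
  using assms
proof (rule red_induct)
  fix \<Gamma> r n assume typing: "typed r Tii" "typed n Ti"
  show "\<Gamma> \<tturnstile> transfer_fm F_eval (r \<cdot> n) (app_tm (abs_tm r) n)"
  proof (rule entails_transferI)
    fix \<Gamma>' v assume "\<Gamma>' \<tturnstile> \<^bold>\<turnstile> \<^bold>\<langle>(r \<cdot> n) \<^bold>\<Down> v\<^bold>\<rangle>"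
    with provable_eval_abs[OF typing(1)] show "\<Gamma>' \<tturnstile> \<^bold>\<turnstile> \<^bold>\<langle>app_tm (abs_tm r) n \<^bold>\<Down> v\<^bold>\<rangle>"
      using typing(2) by (rule provable_eval_app)
  qed (use typing in simp_all)
next
  fix \<Gamma> m m' n
  assume "\<Gamma> \<tturnstile> \<^bold>\<turnstile> \<^bold>\<langle>m \<^bold>\<leadsto> m'\<^bold>\<rangle>" and transfer: "\<Gamma> \<tturnstile> transfer_fm F_eval m' m" and n: "typed n Ti"
  then have typing: "typed m Ti" "typed m' Ti" by auto
  show "\<Gamma> \<tturnstile> transfer_fm F_eval (app_tm m' n) (app_tm m n)"
  proof (rule entails_transferI)
    fix \<Gamma>' v assume \<Gamma>': "\<Gamma> \<sqsubseteq> \<Gamma>'" and app: "\<Gamma>' \<tturnstile> \<^bold>\<turnstile> \<^bold>\<langle>app_tm m' n \<^bold>\<Down> v\<^bold>\<rangle>"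
    then have "typed v Ti" by auto
    from app show "\<Gamma>' \<tturnstile> \<^bold>\<turnstile> \<^bold>\<langle>app_tm m n \<^bold>\<Down> v\<^bold>\<rangle>"
    proof (rule provable_eval_appE)
      fix \<Gamma>'' r
      assume "\<Gamma>' \<sqsubseteq> \<Gamma>''" and fn: "\<Gamma>'' \<tturnstile> \<^bold>\<turnstile> \<^bold>\<langle>m' \<^bold>\<Down> abs_tm r\<^bold>\<rangle>" and val: "\<Gamma>'' \<tturnstile> \<^bold>\<turnstile> \<^bold>\<langle>(r \<cdot> n) \<^bold>\<Down> v\<^bold>\<rangle>"
      then have "\<Gamma> \<sqsubseteq> \<Gamma>''" using \<Gamma>' by blast
      from entails_mono[OF transfer this] fn have "\<Gamma>'' \<tturnstile> \<^bold>\<turnstile> \<^bold>\<langle>m \<^bold>\<Down> abs_tm r\<^bold>\<rangle>"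
        by (rule entails_transferD) (use typing in simp_all)
      then show "\<Gamma>'' \<tturnstile> \<^bold>\<turnstile> \<^bold>\<langle>app_tm m n \<^bold>\<Down> v\<^bold>\<rangle>" using val n by (rule provable_eval_app)
    qed (use typing n \<open>typed v Ti\<close> in simp)
  qed (use typing n in simp_all)
qed (simp add: predicate2_transfer)

lemma red_transfer_typeof:
  assumes "\<Gamma> \<tturnstile> \<^bold>\<turnstile> \<^bold>\<langle>m \<^bold>\<leadsto> n\<^bold>\<rangle>"
  shows "\<Gamma> \<tturnstile> transfer_fm F_typeof m n"
  using assms
proof (rule red_induct)
  fix \<Gamma> r n assume typing: "typed r Tii" "typed n Ti"
  show "\<Gamma> \<tturnstile> transfer_fm F_typeof (app_tm (abs_tm r) n) (r \<cdot> n)"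
  proof (rule entails_transferI)
    fix \<Gamma>' t assume app: "\<Gamma>' \<tturnstile> \<^bold>\<turnstile> \<^bold>\<langle>typeof_tm (app_tm (abs_tm r) n) t\<^bold>\<rangle>"
    then have "typed t Ti" by auto
    from app show "\<Gamma>' \<tturnstile> \<^bold>\<turnstile> \<^bold>\<langle>typeof_tm (r \<cdot> n) t\<^bold>\<rangle>"
      by (rule provable_typeof_appE) (simp add: typing \<open>typed t Ti\<close>, rule provable_typeof_beta)
  qed (use typing in simp_all)
next
  fix \<Gamma> m m' n
  assume "\<Gamma> \<tturnstile> \<^bold>\<turnstile> \<^bold>\<langle>m \<^bold>\<leadsto> m'\<^bold>\<rangle>" and transfer: "\<Gamma> \<tturnstile> transfer_fm F_typeof m m'" and n: "typed n Ti"
  then have typing: "typed m Ti" "typed m' Ti" by auto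
  show "\<Gamma> \<tturnstile> transfer_fm F_typeof (app_tm m n) (app_tm m' n)"
  proof (rule entails_transferI)
    fix \<Gamma>' t assume \<Gamma>': "\<Gamma> \<sqsubseteq> \<Gamma>'" and app: "\<Gamma>' \<tturnstile> \<^bold>\<turnstile> \<^bold>\<langle>typeof_tm (app_tm m n) t\<^bold>\<rangle>"
    then have "typed t Ti" by auto
    from app show "\<Gamma>' \<tturnstile> \<^bold>\<turnstile> \<^bold>\<langle>typeof_tm (app_tm m' n) t\<^bold>\<rangle>"
    proof (rule provable_typeof_appE)
      fix \<Gamma>'' u
      assume "\<Gamma>' \<sqsubseteq> \<Gamma>''" and fn: "\<Gamma>'' \<tturnstile> \<^bold>\<turnstile> \<^bold>\<langle>typeof_tm m (arr_tm u t)\<^bold>\<rangle>"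
        and arg: "\<Gamma>'' \<tturnstile> \<^bold>\<turnstile> \<^bold>\<langle>typeof_tm n u\<^bold>\<rangle>"
      then have "\<Gamma> \<sqsubseteq> \<Gamma>''" using \<Gamma>' by blast
      from entails_mono[OF transfer this] fn have "\<Gamma>'' \<tturnstile> \<^bold>\<turnstile> \<^bold>\<langle>typeof_tm m' (arr_tm u t)\<^bold>\<rangle>"
        by (rule entails_transferD) (use typing in simp_all)
      then show "\<Gamma>'' \<tturnstile> \<^bold>\<turnstile> \<^bold>\<langle>typeof_tm (app_tm m' n) t\<^bold>\<rangle>" using arg by (rule provable_typeof_app)
    qed (use typing n \<open>typed t Ti\<close> in simp)
  qed (use typing n in simp_all)
qed (simp add: predicate2_transfer)

lemma transfer_refl:
  "is_judgement c \<Longrightarrow> typed m Ti \<Longrightarrow> \<Gamma> \<tturnstile> transfer_fm c m m"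
  by (rule entails_transferI)

lemma transfer_trans:
  assumes "\<Gamma> \<tturnstile> transfer_fm c l m" "\<Gamma> \<tturnstile> transfer_fm c m n"
    and typing: "is_judgement c" "typed l Ti" "typed m Ti" "typed n Ti"
  shows "\<Gamma> \<tturnstile> transfer_fm c l n"
  using typing(1,2,4)
proof (rule entails_transferI)
  fix \<Gamma>' w assume \<Gamma>': "\<Gamma> \<sqsubseteq> \<Gamma>'" and "\<Gamma>' \<tturnstile> \<^bold>\<turnstile> \<^bold>\<langle>judgement_tm c l w\<^bold>\<rangle>"
  from entails_mono[OF assms(1) \<Gamma>'] this(2) typing(1,3) have "\<Gamma>' \<tturnstile> \<^bold>\<turnstile> \<^bold>\<langle>judgement_tm c m w\<^bold>\<rangle>"
    by (rule entails_transferD)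
  from entails_mono[OF assms(2) \<Gamma>'] this typing(1,4) show "\<Gamma>' \<tturnstile> \<^bold>\<turnstile> \<^bold>\<langle>judgement_tm c n w\<^bold>\<rangle>"
    by (rule entails_transferD)
qed

lemma reds_least:
  assumes "\<Gamma> \<tturnstile> \<^bold>\<turnstile> \<^bold>\<langle>m \<^bold>\<leadsto>\<^sup>* n\<^bold>\<rangle>" and pred_P: "predicate2 P"
    and refl: "\<And>\<Gamma> m. typed m Ti \<Longrightarrow> \<Gamma> \<tturnstile> P m m"
    and trans: "\<And>\<Gamma> l m n. \<Gamma> \<tturnstile> P l m \<Longrightarrow> \<Gamma> \<tturnstile> P m n \<Longrightarrow> typed l Ti \<Longrightarrow> typed m Ti \<Longrightarrow>
      typed n Ti \<Longrightarrow> \<Gamma> \<tturnstile> P l n"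
    and red: "\<And>\<Gamma> m n. \<Gamma> \<tturnstile> \<^bold>\<turnstile> \<^bold>\<langle>m \<^bold>\<leadsto> n\<^bold>\<rangle> \<Longrightarrow> \<Gamma> \<tturnstile> P m n"
  shows "\<Gamma> \<tturnstile> P m n"
  using assms(1) pred_P refl
proof (rule reds_induct)
  fix \<Gamma> m m' n
  assume step: "\<Gamma> \<tturnstile> \<^bold>\<turnstile> \<^bold>\<langle>m \<^bold>\<leadsto> m'\<^bold>\<rangle>" "\<Gamma> \<tturnstile> \<^bold>\<turnstile> \<^bold>\<langle>m' \<^bold>\<leadsto>\<^sup>* n\<^bold>\<rangle>" "\<Gamma> \<tturnstile> P m' n"
  then have "typed m Ti" "typed m' Ti" "typed n Ti" by auto
  with red[OF step(1)] step(3) show "\<Gamma> \<tturnstile> P m n" by (rule trans)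
qed

lemma reds_transfer:
  assumes "\<Gamma> \<tturnstile> \<^bold>\<turnstile> \<^bold>\<langle>m \<^bold>\<leadsto>\<^sup>* n\<^bold>\<rangle>" and judgement: "is_judgement c"
  shows "(\<And>\<Gamma> m n. \<Gamma> \<tturnstile> \<^bold>\<turnstile> \<^bold>\<langle>m \<^bold>\<leadsto> n\<^bold>\<rangle> \<Longrightarrow> \<Gamma> \<tturnstile> transfer_fm c m n) \<Longrightarrow> \<Gamma> \<tturnstile> transfer_fm c m n"
    and "(\<And>\<Gamma> m n. \<Gamma> \<tturnstile> \<^bold>\<turnstile> \<^bold>\<langle>m \<^bold>\<leadsto> n\<^bold>\<rangle> \<Longrightarrow> \<Gamma> \<tturnstile> transfer_fm c n m) \<Longrightarrow> \<Gamma> \<tturnstile> transfer_fm c n m"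
  using reds_least[OF assms(1), where P = "transfer_fm c"]
    reds_least[OF assms(1), where P = "\<lambda>m n. transfer_fm c n m"]
    predicate2_transfer[OF judgement] transfer_refl[OF judgement] transfer_trans[OF _ _ judgement]
    by blast+

lemma reds_eval:
  assumes "\<Gamma> \<tturnstile> \<^bold>\<turnstile> \<^bold>\<langle>m \<^bold>\<leadsto>\<^sup>* n\<^bold>\<rangle>" "\<Gamma> \<tturnstile> \<^bold>\<turnstile> \<^bold>\<langle>n \<^bold>\<Down> v\<^bold>\<rangle>"
  shows "\<Gamma> \<tturnstile> \<^bold>\<turnstile> \<^bold>\<langle>m \<^bold>\<Down> v\<^bold>\<rangle>"
  by (rule entails_transferD[OF reds_transfer(2)[OF assms(1) _ red_transfer_eval] assms(2)])
    (use entails_provable_typed[OF assms(1)] in auto)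

lemma reds_typeof:
  assumes "\<Gamma> \<tturnstile> \<^bold>\<turnstile> \<^bold>\<langle>m \<^bold>\<leadsto>\<^sup>* n\<^bold>\<rangle>" "\<Gamma> \<tturnstile> \<^bold>\<turnstile> \<^bold>\<langle>typeof_tm m t\<^bold>\<rangle>"
  shows "\<Gamma> \<tturnstile> \<^bold>\<turnstile> \<^bold>\<langle>typeof_tm n t\<^bold>\<rangle>"
  by (rule entails_transferD[OF reds_transfer(1)[OF assms(1) _ red_transfer_typeof] assms(2)])
    (use entails_provable_typed[OF assms(1)] in auto)

lemma reds_trans:
  assumes "\<Gamma> \<tturnstile> \<^bold>\<turnstile> \<^bold>\<langle>l \<^bold>\<leadsto>\<^sup>* m\<^bold>\<rangle>" "\<Gamma> \<tturnstile> \<^bold>\<turnstile> \<^bold>\<langle>m \<^bold>\<leadsto>\<^sup>* n\<^bold>\<rangle>"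
  shows "\<Gamma> \<tturnstile> \<^bold>\<turnstile> \<^bold>\<langle>l \<^bold>\<leadsto>\<^sup>* n\<^bold>\<rangle>"
proof (rule entails_transferD[OF reds_transfer(2)[OF assms(1)] assms(2)])
  fix \<Gamma> m n assume red: "\<Gamma> \<tturnstile> \<^bold>\<turnstile> \<^bold>\<langle>m \<^bold>\<leadsto> n\<^bold>\<rangle>"
  then have typing: "typed m Ti" "typed n Ti" by auto
  show "\<Gamma> \<tturnstile> transfer_fm F_reds n m"
    by (rule entails_transferI[OF _ typing(2,1) provable_reds_step[OF entails_mono[OF red]]]) simp
qed (use entails_provable_typed[OF assms(1)] in auto)

lemma reds_app:
  assumes "\<Gamma> \<tturnstile> \<^bold>\<turnstile> \<^bold>\<langle>m \<^bold>\<leadsto>\<^sup>* m'\<^bold>\<rangle>" and n: "typed n Ti"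
  shows "\<Gamma> \<tturnstile> \<^bold>\<turnstile> \<^bold>\<langle>app_tm m n \<^bold>\<leadsto>\<^sup>* app_tm m' n\<^bold>\<rangle>"
proof (rule reds_induct[OF assms(1), where P = "\<lambda>m m'. \<^bold>\<turnstile> \<^bold>\<langle>app_tm m n \<^bold>\<leadsto>\<^sup>* app_tm m' n\<^bold>\<rangle>"])
  fix \<Gamma> m l m' assume "\<Gamma> \<tturnstile> \<^bold>\<turnstile> \<^bold>\<langle>m \<^bold>\<leadsto> l\<^bold>\<rangle>" "\<Gamma> \<tturnstile> \<^bold>\<turnstile> \<^bold>\<langle>app_tm l n \<^bold>\<leadsto>\<^sup>* app_tm m' n\<^bold>\<rangle>"
  from provable_red_app[OF this(1) n] this(2)
  show "\<Gamma> \<tturnstile> \<^bold>\<turnstile> \<^bold>\<langle>app_tm m n \<^bold>\<leadsto>\<^sup>* app_tm m' n\<^bold>\<rangle>" by (rule provable_reds_step)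
qed (use n in \<open>simp_all add: provable_reds_refl predicate2_def\<close>)

lemma eval_reds:
  assumes "\<Gamma> \<tturnstile> \<^bold>\<turnstile> \<^bold>\<langle>m \<^bold>\<Down> v\<^bold>\<rangle>"
  shows "\<Gamma> \<tturnstile> \<^bold>\<turnstile> \<^bold>\<langle>m \<^bold>\<leadsto>\<^sup>* v\<^bold>\<rangle>"
proof (rule eval_induct[OF assms, where P = "\<lambda>m v. \<^bold>\<turnstile> \<^bold>\<langle>m \<^bold>\<leadsto>\<^sup>* v\<^bold>\<rangle>"])
  fix \<Gamma> m n r v
  assume fn: "\<Gamma> \<tturnstile> \<^bold>\<turnstile> \<^bold>\<langle>m \<^bold>\<leadsto>\<^sup>* abs_tm r\<^bold>\<rangle>" and n: "typed n Ti" and val: "\<Gamma> \<tturnstile> \<^bold>\<turnstile> \<^bold>\<langle>(r \<cdot> n) \<^bold>\<leadsto>\<^sup>* v\<^bold>\<rangle>"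
  have "typed r Tii" using entails_provable_typed[OF fn] by auto
  then have "\<Gamma> \<tturnstile> \<^bold>\<turnstile> \<^bold>\<langle>app_tm (abs_tm r) n \<^bold>\<leadsto>\<^sup>* v\<^bold>\<rangle>"
    by (rule provable_reds_step[OF provable_red_beta[OF _ n] val])
  with reds_app[OF fn n] show "\<Gamma> \<tturnstile> \<^bold>\<turnstile> \<^bold>\<langle>app_tm m n \<^bold>\<leadsto>\<^sup>* v\<^bold>\<rangle>" by (rule reds_trans)
qed (simp_all add: provable_reds_refl predicate2_def)

lemma reds_abs_imp_eval:
  assumes "\<Gamma> \<tturnstile> \<^bold>\<turnstile> \<^bold>\<langle>m \<^bold>\<leadsto>\<^sup>* abs_tm r\<^bold>\<rangle>"
  shows "\<Gamma> \<tturnstile> \<^bold>\<turnstile> \<^bold>\<langle>m \<^bold>\<Down> abs_tm r\<^bold>\<rangle>"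
  using entails_provable_typed[OF assms] by (auto intro: reds_eval[OF assms provable_eval_abs])

lemma red_typeof:
  assumes "\<Gamma> \<tturnstile> \<^bold>\<turnstile> \<^bold>\<langle>m \<^bold>\<leadsto> n\<^bold>\<rangle>" "\<Gamma> \<tturnstile> \<^bold>\<turnstile> \<^bold>\<langle>typeof_tm m t\<^bold>\<rangle>"
  shows "\<Gamma> \<tturnstile> \<^bold>\<turnstile> \<^bold>\<langle>typeof_tm n t\<^bold>\<rangle>"
  by (rule entails_transferD[OF red_transfer_typeof[OF assms(1)] assms(2)])
    (use entails_provable_typed[OF assms(1)] in auto)

lemma derivableI: "{#} \<tturnstile>\<^bsub>D\<^esub> F \<Longrightarrow> derivable D F"
  by (simp add: derivable_def entails_derives)

lemmas entails_all_fm_simps = all_fm_def lam_def entails_all_iff entails_imp_iff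

theorem theorem8p1:
  shows "let m = (0, Ti); m1 = (1, Ti); m2 = (2, Ti); n = (3, Ti); t = (4, Ti);
      r = (0, Ti \<rightarrow>\<^sub>t Ti); r1 = (1, Ti \<rightarrow>\<^sub>t Ti); r2 = (2, Ti \<rightarrow>\<^sub>t Ti) in
    \<comment> \<open>determinacy\<close>
    derivable D_all (all_fm m (all_fm m1 (all_fm m2
      (\<^bold>\<turnstile> \<^bold>\<langle>Free m \<^bold>\<Down> Free m1\<^bold>\<rangle> \<^bold>\<supset> \<^bold>\<turnstile> \<^bold>\<langle>Free m \<^bold>\<Down> Free m2\<^bold>\<rangle> \<^bold>\<supset> Free m1 \<^bold>\<equiv> Free m2)))) \<and>
    derivable D_all (all_fm m (all_fm m1 (all_fm m2
      (\<^bold>\<turnstile> \<^bold>\<langle>Free m \<^bold>\<leadsto> Free m1\<^bold>\<rangle> \<^bold>\<supset> \<^bold>\<turnstile> \<^bold>\<langle>Free m \<^bold>\<leadsto> Free m2\<^bold>\<rangle> \<^bold>\<supset> Free m1 \<^bold>\<equiv> Free m2)))) \<and>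
    derivable D_all (all_fm m (all_fm r1 (all_fm r2
      (\<^bold>\<turnstile> \<^bold>\<langle>Free m \<^bold>\<leadsto>\<^sup>* abs_tm (Free r1)\<^bold>\<rangle> \<^bold>\<supset> \<^bold>\<turnstile> \<^bold>\<langle>Free m \<^bold>\<leadsto>\<^sup>* abs_tm (Free r2)\<^bold>\<rangle> \<^bold>\<supset>
       abs_tm (Free r1) \<^bold>\<equiv> abs_tm (Free r2))))) \<and>
    \<comment> \<open>equivalence\<close>
    derivable D_all (all_fm m (all_fm r
      (\<^bold>\<turnstile> \<^bold>\<langle>Free m \<^bold>\<Down> abs_tm (Free r)\<^bold>\<rangle> \<^bold>\<supset> \<^bold>\<turnstile> \<^bold>\<langle>Free m \<^bold>\<leadsto>\<^sup>* abs_tm (Free r)\<^bold>\<rangle>))) \<and>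
    derivable D_all (all_fm m (all_fm r
      (\<^bold>\<turnstile> \<^bold>\<langle>Free m \<^bold>\<leadsto>\<^sup>* abs_tm (Free r)\<^bold>\<rangle> \<^bold>\<supset> \<^bold>\<turnstile> \<^bold>\<langle>Free m \<^bold>\<Down> abs_tm (Free r)\<^bold>\<rangle>))) \<and>
    \<comment> \<open>subject reduction\<close>
    (\<forall>R \<in> {\<lambda>M N. M \<^bold>\<Down> N, \<lambda>M N. M \<^bold>\<leadsto> N, \<lambda>M N. M \<^bold>\<leadsto>\<^sup>* N}.
      derivable D_all (all_fm m (all_fm n
        (\<^bold>\<turnstile> \<^bold>\<langle>R (Free m) (Free n)\<^bold>\<rangle> \<^bold>\<supset>
         all_fm t (\<^bold>\<turnstile> \<^bold>\<langle>typeof_tm (Free m) (Free t)\<^bold>\<rangle> \<^bold>\<supset> \<^bold>\<turnstile> \<^bold>\<langle>typeof_tm (Free n) (Free t)\<^bold>\<rangle>)))))"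
  unfolding Let_def
proof (intro conjI ballI derivableI,
    goal_cases det_eval det_red det_reds eval_imp_reds reds_imp_eval subject_reduction)
  case det_eval
  show ?case by (auto simp: entails_all_fm_simps intro: eval_determinate entails_mono)
next
  case det_red
  show ?case by (auto simp: entails_all_fm_simps intro: red_determinate entails_mono)
next
  case det_reds
  show ?case
    by (auto simp: entails_all_fm_simps intro: eval_determinate reds_abs_imp_eval entails_mono)
next
  case eval_imp_reds
  show ?case by (auto simp: entails_all_fm_simps intro: eval_reds)
next
  case reds_imp_eval
  show ?case by (auto simp: entails_all_fm_simps intro: reds_abs_imp_eval)
next
  case (subject_reduction R)
  then show ?case
    by (auto simp: entails_all_fm_simps intro: red_typeof[OF entails_mono] reds_typeof[OF entails_mono]
        reds_typeof[OF eval_reds[OF entails_mono]])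
qed

end
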